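(* Let $N\in\mathbb{N}$, $\mu_1,\dots,\mu_N>0$, $\nu_1,\dots,\nu_N\in(0,1)$, $\Lambda>0$. Let $\mathcal{N}$ be a homogeneous Poisson process with rate $\Lambda$, independent of the inverse process $\mathcal{L}^{\nu}=\mathcal{L}^{\nu_1,\dots,\nu_N}$ of $\sum_{j=1}^N\mu_j^{1/\nu_j}H_j^{\nu_j}(t)$. Then the probabilities $p_k^\nu(t)=\mathsf{P}\{\mathcal{N}(\mathcal{L}^\nu(t))=k\}$ satisfy $$\sum_{j=1}^N\mu_j\frac{d^{\nu_j}}{dt^{\nu_j}}p_k^\nu(t)=-\Lambda\left(p_k^\nu(t)-p_{k-1}^\nu(t)\right),\quad k\ge0,$$ with $p_{-1}^\nu\equiv0$ and the initial condition $p_0^\nu(0)=1$, $p_k^\nu(0)=0$ for $k\ge1$, where the fractional derivatives are in the Caputo–Djrbashian sense.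
   Context: For $\beta\in(0,1)$, a stable subordinator $H^{\beta}$ is a nondecreasing Lévy process with $\mathsf{E}e^{-sH^{\beta}(t)}=e^{-ts^{\beta}}$, $s>0$. $H_1^{\nu_1},\dots,H_N^{\nu_N}$ are independent stable subordinators of orders $\nu_1,\dots,\nu_N$. The inverse process is $$\mathcal{L}^\nu(t)=\inf\Big\{s>0:\sum_{j=1}^N\mu_j^{1/\nu_j}H_j^{\nu_j}(s)\ge t\Big\},\quad t>0,\qquad \mathcal{L}^\nu(0)=0.$$ The Caputo–Djrbashian derivative of order $\beta\in(0,1)$ is $\frac{d^{\beta}}{dt^{\beta}}u(t)=\frac{1}{\Gamma(1-\beta)}\int_0^t \frac{u'(s)}{(t-s)^{\beta}}\,ds$. *)

theory Defs
  imports "HOL-Probability.Probability"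
begin

text \<open>A process with time set \<open>[0, \<infinity>)\<close> is a function \<open>X :: real \<Rightarrow> 'a \<Rightarrow> 'b\<close>; its values at
  negative times are irrelevant and are never used.\<close>

definition independent_increments :: "'a measure \<Rightarrow> (real \<Rightarrow> 'a \<Rightarrow> real) \<Rightarrow> bool" where
  "independent_increments M X \<longleftrightarrow>
     (\<forall>n. \<forall>t :: nat \<Rightarrow> real. 0 \<le> t 0 \<longrightarrow> (\<forall>i<n. t i < t (Suc i)) \<longrightarrow>
        prob_space.indep_vars M (\<lambda>_. borel) (\<lambda>i \<omega>. X (t (Suc i)) \<omega> - X (t i) \<omega>) {..<n})"

definition stationary_increments :: "'a measure \<Rightarrow> (real \<Rightarrow> 'a \<Rightarrow> real) \<Rightarrow> bool" where
  "stationary_increments M X \<longleftrightarrow>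
     (\<forall>s\<ge>0. \<forall>h\<ge>0. distr M borel (\<lambda>\<omega>. X (s + h) \<omega> - X s \<omega>) = distr M borel (X h))"

definition stochastically_continuous :: "'a measure \<Rightarrow> (real \<Rightarrow> 'a \<Rightarrow> real) \<Rightarrow> bool" where
  "stochastically_continuous M X \<longleftrightarrow>
     (\<forall>t\<ge>0. \<forall>\<epsilon>>0.
        ((\<lambda>s. measure M {\<omega> \<in> space M. \<bar>X s \<omega> - X t \<omega>\<bar> > \<epsilon>}) \<longlongrightarrow> 0) (at t within {0..}))"

definition cadlag_path :: "(real \<Rightarrow> real) \<Rightarrow> bool" where
  "cadlag_path x \<longleftrightarrow>
     (\<forall>t\<ge>0. continuous (at_right t) x) \<and> (\<forall>t>0. \<exists>l. (x \<longlongrightarrow> l) (at_left t))"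

definition levy_process :: "'a measure \<Rightarrow> (real \<Rightarrow> 'a \<Rightarrow> real) \<Rightarrow> bool" where
  "levy_process M X \<longleftrightarrow>
     (\<forall>t\<ge>0. X t \<in> borel_measurable M) \<and>
     (AE \<omega> in M. X 0 \<omega> = 0) \<and>
     independent_increments M X \<and>
     stationary_increments M X \<and>
     stochastically_continuous M X \<and>
     (AE \<omega> in M. cadlag_path (\<lambda>t. X t \<omega>))"

definition stable_subordinator :: "'a measure \<Rightarrow> real \<Rightarrow> (real \<Rightarrow> 'a \<Rightarrow> real) \<Rightarrow> bool" where
  "stable_subordinator M \<beta> H \<longleftrightarrow>
     0 < \<beta> \<and> \<beta> < 1 \<and>
     levy_process M H \<and>
     (AE \<omega> in M. mono_on {0..} (\<lambda>t. H t \<omega>)) \<and>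
     (\<forall>t\<ge>0. \<forall>s>0. prob_space.expectation M (\<lambda>\<omega>. exp (- s * H t \<omega>)) = exp (- t * s powr \<beta>))"

text \<open>The paths of a counting process are nondecreasing, so the truncated subtraction on
  \<^typ>\<open>nat\<close> below is the true increment. The case \<open>h = 0\<close> is left out because
  \<^const>\<open>poisson_pmf\<close> is specified for positive rates only.\<close>

definition poisson_process :: "'a measure \<Rightarrow> real \<Rightarrow> (real \<Rightarrow> 'a \<Rightarrow> nat) \<Rightarrow> bool" where
  "poisson_process M \<Lambda> \<N> \<longleftrightarrow>
     0 < \<Lambda> \<and>
     (\<forall>t\<ge>0. \<N> t \<in> measurable M (count_space UNIV)) \<and>
     (\<forall>\<omega>\<in>space M. \<N> 0 \<omega> = 0 \<and> mono_on {0..} (\<lambda>t. \<N> t \<omega>) \<and>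
        (\<forall>t\<ge>0. continuous (at_right t) (\<lambda>s. \<N> s \<omega>))) \<and>
     independent_increments M (\<lambda>t \<omega>. real (\<N> t \<omega>)) \<and>
     (\<forall>s\<ge>0. \<forall>h>0. distr M (count_space UNIV) (\<lambda>\<omega>. \<N> (s + h) \<omega> - \<N> s \<omega>)
                     = measure_pmf (poisson_pmf (\<Lambda> * h)))"

definition passage_times ::
    "nat \<Rightarrow> (nat \<Rightarrow> real) \<Rightarrow> (nat \<Rightarrow> real) \<Rightarrow> (nat \<Rightarrow> real \<Rightarrow> 'a \<Rightarrow> real) \<Rightarrow> real \<Rightarrow> 'a \<Rightarrow> real set" where
  "passage_times N \<mu> \<nu> H t \<omega> = {s. s > 0 \<and> (\<Sum>j=1..N. \<mu> j powr (1 / \<nu> j) * H j s \<omega>) \<ge> t}"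

text \<open>The infimum of the empty set is an unspecified, possibly negative, real number. For
  independent stable subordinators the set is empty only on a null event, where the value is set
  to \<open>0\<close> to keep the process inside the time set \<open>[0, \<infinity>)\<close>.\<close>

definition inverse_process ::
    "nat \<Rightarrow> (nat \<Rightarrow> real) \<Rightarrow> (nat \<Rightarrow> real) \<Rightarrow> (nat \<Rightarrow> real \<Rightarrow> 'a \<Rightarrow> real) \<Rightarrow> real \<Rightarrow> 'a \<Rightarrow> real" where
  "inverse_process N \<mu> \<nu> H t \<omega> =
     (if t > 0 \<and> passage_times N \<mu> \<nu> H t \<omega> \<noteq> {} then Inf (passage_times N \<mu> \<nu> H t \<omega>) else 0)"

text \<open>A derivative or a Lebesgue integral that does not exist still denotes some value, so the
  existence of the Caputo derivative is a separate predicate. The integral is taken over the open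
  interval because \<open>u\<close> need not be differentiable at the end points, and \<^const>\<open>deriv\<close> is the
  two-sided derivative.\<close>

definition caputo_exists :: "real \<Rightarrow> (real \<Rightarrow> real) \<Rightarrow> real \<Rightarrow> bool" where
  "caputo_exists \<beta> u t \<longleftrightarrow>
     (\<forall>s\<in>{0<..<t}. u field_differentiable at s) \<and>
     set_integrable lborel {0<..<t} (\<lambda>s. deriv u s / (t - s) powr \<beta>)"

definition caputo_deriv :: "real \<Rightarrow> (real \<Rightarrow> real) \<Rightarrow> real \<Rightarrow> real" where
  "caputo_deriv \<beta> u t =
     1 / Gamma (1 - \<beta>) * (LINT s:{0<..<t}|lborel. deriv u s / (t - s) powr \<beta>)"

definition state_prob ::
    "'a measure \<Rightarrow> (real \<Rightarrow> 'a \<Rightarrow> nat) \<Rightarrow> (real \<Rightarrow> 'a \<Rightarrow> real) \<Rightarrow> nat \<Rightarrow> real \<Rightarrow> real" where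
  "state_prob M \<N> \<L> k t = measure M {\<omega> \<in> space M. \<N> (\<L> t \<omega>) \<omega> = k}"

end

theory Submission
  imports Defs
begin

text \<open>The idea is to trade the inverse process for an explicit random variable with the same
  one-dimensional laws. By the scaling property of stable laws,
  \<open>X s = (\<Sum>j. \<mu>\<^sub>j powr (1/\<nu>\<^sub>j) * H\<^sub>j s)\<close> has, for each fixed \<open>s\<close>, the law of
  \<open>Z s = (\<Sum>j. s powr (1/\<nu>\<^sub>j) * Y\<^sub>j)\<close> with \<open>Y\<^sub>j = \<mu>\<^sub>j powr (1/\<nu>\<^sub>j) * H\<^sub>j 1\<close>; this is read off from
  the common Laplace transform \<open>exp (- s * symbol z)\<close>, where \<open>symbol z = (\<Sum>j. \<mu>\<^sub>j * z powr \<nu>\<^sub>j)\<close>.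
  For fixed \<open>\<omega>\<close> the function \<open>Z\<close> is a smooth increasing bijection of the half-line. Its inverse
  \<open>R\<close> satisfies \<open>s < R t \<longleftrightarrow> Z s < t\<close>, so that \<open>P (R t > s) = P (X s < t) = P (\<L> t > s)\<close>, and its
  derivative lies between \<open>0\<close> and \<open>R t / t\<close>. Consequently \<open>E (f (R t))\<close> can be differentiated under
  the expectation for every \<open>t > 0\<close>, and the Chernoff bound \<open>E (R t) \<le> e / symbol (1/t)\<close> shows that
  the derivative is at most of order \<open>t powr (\<nu>\<^sub>j - 1)\<close> near \<open>0\<close>. This is the pointwise existence of the
  Caputo derivatives.

  The equation itself is an instance of
  \<open>(\<Sum>j. \<mu>\<^sub>j * caputo_deriv \<nu>\<^sub>j (E (f (R \<cdot>))) t) = E (f' (R t))\<close>, which holds for all sufficiently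
  smooth and integrable \<open>f\<close> (lemma \<open>caputo_mean\<close>). Both sides have the Laplace transform
  \<open>symbol z / z * (\<integral>x. exp (- symbol z * x) * f' x)\<close>: the factor \<open>symbol z / z\<close> is the transform of the kernel
  \<open>\<Sum>j. \<mu>\<^sub>j * t powr (- \<nu>\<^sub>j) / \<Gamma> (1 - \<nu>\<^sub>j)\<close> on the left, and comes from integrating by parts in
  \<open>E (f (R t)) = f 0 + (\<integral>x. f' x * P (Z x < t))\<close> on the right. Both sides are continuous in \<open>t > 0\<close>, so
  uniqueness of Laplace transforms gives equality at every \<open>t\<close>.

  Finally, \<open>\<N>\<close> has right-continuous paths and is independent of \<open>\<L>\<close>, hence
  \<open>P (\<N> (\<L> t) = k) = E (\<pi>\<^sub>k (\<L> t)) = E (\<pi>\<^sub>k (R t))\<close> with the Poisson weights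
  \<open>\<pi>\<^sub>k x = (\<Lambda> x)\<^sup>k / k! * exp (- \<Lambda> x)\<close>, and \<open>\<pi>\<^sub>k' = - \<Lambda> (\<pi>\<^sub>k - \<pi>\<^sub>k\<^sub>-\<^sub>1)\<close> turns the identity for
  \<open>f = \<pi>\<^sub>k\<close> into the claim.\<close>

section \<open>Uniqueness of Laplace transforms\<close>

text \<open>The substitution \<open>y = exp (- w)\<close> turns the Laplace transform at the natural numbers into moments
  on \<open>[0, 1]\<close>, and moments determine the integrals of continuous functions by the Weierstrass theorem.
  The weights \<open>g1\<close> and \<open>g2\<close> may change sign, so that the same lemma serves laws of random variables
  (weight \<open>1\<close>) and functions of time (where \<open>W\<close> is the time itself).\<close>

lemma weighted_laplace_eq_continuous:
  fixes g1 g2 W1 W2 :: "'a \<Rightarrow> real"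
  assumes int: "integrable M g1" "integrable M g2"
    and meas [measurable]: "W1 \<in> borel_measurable M" "W2 \<in> borel_measurable M"
    and nonneg: "\<And>x. W1 x \<ge> 0" "\<And>x. W2 x \<ge> 0"
    and eq: "\<And>n::nat. (\<integral>x. g1 x * exp (- real n * W1 x) \<partial>M) = (\<integral>x. g2 x * exp (- real n * W2 x) \<partial>M)"
    and cont: "continuous_on UNIV \<phi>"
  shows "(\<integral>x. g1 x * \<phi> (exp (- W1 x)) \<partial>M) = (\<integral>x. g2 x * \<phi> (exp (- W2 x)) \<partial>M)"
proof -
  note [measurable] = borel_measurable_integrable[OF int(1)] borel_measurable_integrable[OF int(2)]
  have [measurable]: "\<phi> \<in> borel_measurable borel" using cont by (rule borel_measurable_continuous_onI)
  have "bounded (\<phi> ` {0..1})"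
    using cont by (intro compact_imp_bounded compact_continuous_image) (auto intro: continuous_on_subset)
  then obtain B where B: "\<And>y. y \<in> {0..1} \<Longrightarrow> \<bar>\<phi> y\<bar> \<le> B"
    unfolding bounded_iff real_norm_def by blast
  have unit: "exp (- W1 x) \<in> {0..1}" "exp (- W2 x) \<in> {0..1}" for x using nonneg by auto
  have bdd_int: "integrable M (\<lambda>x. g x * h (exp (- W x)))"
    if "integrable M g" "h \<in> borel_measurable borel" "W \<in> borel_measurable M"
      "\<And>y. y \<in> {0..1} \<Longrightarrow> \<bar>h y\<bar> \<le> C" "\<And>x. exp (- W x) \<in> {0..1}" for g and h W :: "_ \<Rightarrow> real" and C :: real
  proof (rule Bochner_Integration.integrable_bound)
    show "integrable M (\<lambda>x. C * g x)" using that by auto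
    note [measurable] = that(2,3) borel_measurable_integrable[OF that(1)]
    show "(\<lambda>x. g x * h (exp (- W x))) \<in> borel_measurable M" by measurable
    have "0 \<le> C" using that(4)[of 0] by auto
    then show "AE x in M. norm (g x * h (exp (- W x))) \<le> norm (C * g x)"
      using mult_right_mono[OF that(4)[OF that(5)] abs_ge_zero]
      by (intro AE_I2) (simp add: abs_mult mult.commute)
  qed
  define G where "G = (\<integral>x. \<bar>g1 x\<bar> \<partial>M) + (\<integral>x. \<bar>g2 x\<bar> \<partial>M)"
  let ?I = "\<lambda>g W h. (\<integral>x. g x * h (exp (- W x)) \<partial>M)"
  have "\<bar>?I g1 W1 \<phi> - ?I g2 W2 \<phi>\<bar> \<le> e * G" if "e > 0" for e
  proof -
    have contI: "continuous_on {0..1} \<phi>" using cont continuous_on_subset by blast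
    obtain q where q: "real_polynomial_function q" "\<And>y. y \<in> {0..1} \<Longrightarrow> \<bar>\<phi> y - q y\<bar> < e"
      using Stone_Weierstrass_real_polynomial_function[OF compact_Icc contI \<open>e > 0\<close>] by blast
    obtain a m where am: "q = (\<lambda>y. \<Sum>i\<le>m. a i * y ^ i)"
      using q(1) by (auto simp: real_polynomial_function_iff_sum)
    have [measurable]: "q \<in> borel_measurable borel" unfolding am by measurable
    have mono_int: "integrable M (\<lambda>x. g1 x * exp (- W1 x) ^ i)" "integrable M (\<lambda>x. g2 x * exp (- W2 x) ^ i)" for i
      by (rule bdd_int[where h="\<lambda>y. y ^ i" and C=1]; use int unit in \<open>auto simp: power_le_one\<close>)+
    have "?I g1 W1 q = (\<Sum>i\<le>m. a i * (\<integral>x. g1 x * exp (- W1 x) ^ i \<partial>M))"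
      unfolding am sum_distrib_left using mono_int
      by (subst Bochner_Integration.integral_sum[symmetric] integral_mult_right_zero[symmetric])+
         (auto simp: sum_distrib_left algebra_simps intro!: Bochner_Integration.integral_cong)
    also have "\<dots> = (\<Sum>i\<le>m. a i * (\<integral>x. g2 x * exp (- W2 x) ^ i \<partial>M))"
      using eq by (simp add: exp_of_nat_mult[symmetric])
    also have "\<dots> = ?I g2 W2 q"
      unfolding am sum_distrib_left using mono_int
      by (subst Bochner_Integration.integral_sum[symmetric] integral_mult_right_zero[symmetric])+
         (auto simp: sum_distrib_left algebra_simps intro!: Bochner_Integration.integral_cong)
    finally have qq: "?I g1 W1 q = ?I g2 W2 q" .
    have qB: "\<bar>q y\<bar> \<le> B + e" if "y \<in> {0..1}" for y using B[OF that] q(2)[OF that] by linarith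
    have close: "\<bar>?I g W \<phi> - ?I g W q\<bar> \<le> e * (\<integral>x. \<bar>g x\<bar> \<partial>M)"
      if "integrable M g" "W \<in> borel_measurable M" "\<And>x. exp (- W x) \<in> {0..1}" for g W
    proof -
      have i: "integrable M (\<lambda>x. g x * \<phi> (exp (- W x)))" "integrable M (\<lambda>x. g x * q (exp (- W x)))"
        by (rule bdd_int[OF that(1) _ that(2) _ that(3)], use B qB in auto)+
      have "\<bar>?I g W \<phi> - ?I g W q\<bar> = \<bar>\<integral>x. g x * \<phi> (exp (- W x)) - g x * q (exp (- W x)) \<partial>M\<bar>"
        using i by simp
      also have "\<dots> \<le> (\<integral>x. \<bar>g x * \<phi> (exp (- W x)) - g x * q (exp (- W x))\<bar> \<partial>M)"
        by (rule integral_abs_bound)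
      also have "\<dots> \<le> (\<integral>x. e * \<bar>g x\<bar> \<partial>M)"
      proof (rule integral_mono)
        show "\<bar>g x * \<phi> (exp (- W x)) - g x * q (exp (- W x))\<bar> \<le> e * \<bar>g x\<bar>" for x
          using mult_right_mono[OF less_imp_le[OF q(2)[OF that(3)[of x]]] abs_ge_zero[of "g x"]]
          by (simp only: right_diff_distrib[symmetric] abs_mult mult.commute[of "\<bar>g x\<bar>"])
      qed (use i that(1) in auto)
      finally show ?thesis by simp
    qed
    show ?thesis using close[OF int(1) meas(1) unit(1)] close[OF int(2) meas(2) unit(2)] qq
      unfolding G_def by (simp add: distrib_left)
  qed
  note approx = this
  have "G \<ge> 0" unfolding G_def by simp
  have "\<bar>?I g1 W1 \<phi> - ?I g2 W2 \<phi>\<bar> \<le> 0 + e" if "e > 0" for e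
  proof -
    have "e / (G + 1) * G \<le> e" using \<open>G \<ge> 0\<close> that by (simp add: field_simps)
    then show ?thesis using approx[of "e / (G + 1)"] \<open>G \<ge> 0\<close> that by simp
  qed
  then have "\<bar>?I g1 W1 \<phi> - ?I g2 W2 \<phi>\<bar> \<le> 0" by (rule field_le_epsilon)
  then show ?thesis by simp
qed

text \<open>Continuous functions of \<open>exp (- w)\<close> approximate the indicator of \<open>w < c\<close> pointwise and boundedly.\<close>

lemma weighted_laplace_uniqueness:
  fixes g1 g2 W1 W2 :: "'a \<Rightarrow> real"
  assumes int: "integrable M g1" "integrable M g2"
    and meas [measurable]: "W1 \<in> borel_measurable M" "W2 \<in> borel_measurable M"
    and nonneg: "\<And>x. W1 x \<ge> 0" "\<And>x. W2 x \<ge> 0"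
    and eq: "\<And>n::nat. (\<integral>x. g1 x * exp (- real n * W1 x) \<partial>M) = (\<integral>x. g2 x * exp (- real n * W2 x) \<partial>M)"
  shows "(\<integral>x. g1 x * indicator {..<c} (W1 x) \<partial>M) = (\<integral>x. g2 x * indicator {..<c} (W2 x) \<partial>M)"
proof -
  note [measurable] = borel_measurable_integrable[OF int(1)] borel_measurable_integrable[OF int(2)]
  \<comment> \<open>a ramp that increases to the indicator of \<open>y > exp (- c)\<close>\<close>
  define \<phi> where "\<phi> n y = min 1 (max 0 (real n * (y - exp (- c))))" for n y
  have lim: "(\<lambda>n. \<phi> n (exp (- w))) \<longlonglongrightarrow> indicator {..<c} w" for w
  proof (cases "w < c")
    case True
    then have p: "exp (- w) - exp (- c) > 0" by simp
    obtain n0 :: nat where n0: "1 < real n0 * (exp (- w) - exp (- c))" using ex_less_of_nat_mult[OF p] by blast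
    have "\<phi> n (exp (- w)) = 1" if "n \<ge> n0" for n
    proof -
      have "real n0 * (exp (- w) - exp (- c)) \<le> real n * (exp (- w) - exp (- c))"
        using that p by (intro mult_right_mono) auto
      then show ?thesis using n0 unfolding \<phi>_def by linarith
    qed
    then show ?thesis using True
      by (intro tendsto_eventually) (auto simp: eventually_sequentially)
  next
    case False
    then have "real n * (exp (- w) - exp (- c)) \<le> 0" for n by (intro mult_nonneg_nonpos) auto
    then have "\<phi> n (exp (- w)) = 0" for n by (simp add: \<phi>_def max_absorb1)
    then show ?thesis using False by simp
  qed
  have conv: "(\<lambda>n. \<integral>x. g x * \<phi> n (exp (- W x)) \<partial>M) \<longlonglongrightarrow> (\<integral>x. g x * indicator {..<c} (W x) \<partial>M)"
    if [measurable]: "integrable M g" "W \<in> borel_measurable M" for g W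
  proof (rule integral_dominated_convergence)
    note [measurable] = borel_measurable_integrable[OF that(1)]
    show "integrable M (\<lambda>x. \<bar>g x\<bar>)" using that by simp
    show "(\<lambda>x. g x * \<phi> i (exp (- W x))) \<in> borel_measurable M" for i unfolding \<phi>_def by measurable
    show "(\<lambda>x. g x * indicator {..<c} (W x)) \<in> borel_measurable M" by measurable
    show "AE x in M. (\<lambda>n. g x * \<phi> n (exp (- W x))) \<longlonglongrightarrow> g x * indicator {..<c} (W x)"
      by (auto intro!: tendsto_intros lim)
    have "\<bar>\<phi> n y\<bar> \<le> 1" for n y unfolding \<phi>_def by linarith
    then show "AE x in M. norm (g x * \<phi> i (exp (- W x))) \<le> \<bar>g x\<bar>" for i
      by (auto simp: abs_mult mult_left_le)
  qed
  have "(\<integral>x. g1 x * \<phi> n (exp (- W1 x)) \<partial>M) = (\<integral>x. g2 x * \<phi> n (exp (- W2 x)) \<partial>M)" for n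
    by (rule weighted_laplace_eq_continuous[OF int meas nonneg eq])
       (auto simp: \<phi>_def intro!: continuous_intros)
  then show ?thesis
    using conv[OF int(1) meas(1)] conv[OF int(2) meas(2)] by (simp add: LIMSEQ_unique)
qed

text \<open>Continuity of \<open>w\<close> gives the conclusion at every point, not only almost everywhere: all integrals of
  \<open>w\<close> over intervals vanish, and they can be differentiated.\<close>

lemma laplace_transform_zero_imp_zero:
  fixes w :: "real \<Rightarrow> real"
  assumes cont: "continuous_on {0<..} w"
    and int: "\<And>z. z > 0 \<Longrightarrow> set_integrable lborel {0<..} (\<lambda>t. exp (- z * t) * w t)"
    and zero: "\<And>z. z > 0 \<Longrightarrow> (LINT t:{0<..}|lborel. exp (- z * t) * w t) = 0"
    and "t > 0"
  shows "w t = 0"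
proof -
  \<comment> \<open>The factor \<open>exp (- s)\<close> makes \<open>g\<close> integrable and shifts the arguments \<open>n = 0, 1, \<dots>\<close> to the admissible \<open>z = 1, 2, \<dots>\<close>.\<close>
  define g where "g s = indicator {0<..} s * (exp (- s) * w s)" for s :: real
  have g_int: "integrable lborel g"
    using int[of 1] by (simp add: set_integrable_def g_def[abs_def])
  have "(\<integral>s. g s * exp (- real n * max 0 s) \<partial>lborel) = (\<integral>s. 0 * exp (- real n * max 0 s) \<partial>lborel)" for n
  proof -
    have "(\<integral>s. g s * exp (- real n * max 0 s) \<partial>lborel) = (LINT s:{0<..}|lborel. exp (- (1 + real n) * s) * w s)"
      unfolding set_lebesgue_integral_def
      by (intro Bochner_Integration.integral_cong)
         (auto simp: g_def indicator_def exp_add[symmetric] algebra_simps)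
    then show ?thesis using zero[of "1 + real n"] by simp
  qed
  from weighted_laplace_uniqueness[OF g_int _ _ _ _ _ this]
  have below: "(\<integral>s. g s * indicator {..<c} (max 0 s) \<partial>lborel) = 0" for c :: real
    by simp
  have slice: "(LBINT s:{a..<b}. g s) = 0" if "0 < a" "a \<le> b" for a b
  proof -
    have i: "integrable lborel (\<lambda>s. g s * indicator {..<c} (max 0 s))" for c :: real
      using g_int by (rule Bochner_Integration.integrable_bound)
        (use g_int in \<open>auto simp: indicator_def intro!: borel_measurable_times\<close>)
    have "(LBINT s:{a..<b}. g s) = (\<integral>s. g s * indicator {..<b} (max 0 s) - g s * indicator {..<a} (max 0 s) \<partial>lborel)"
      unfolding set_lebesgue_integral_def using that
      by (intro Bochner_Integration.integral_cong) (auto simp: indicator_def)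
    also have "\<dots> = 0" using i below by simp
    finally show ?thesis .
  qed
  show ?thesis
  proof -
    have gc: "continuous_on {t/2..t+1} g"
    proof (rule continuous_on_eq)
      show "continuous_on {t/2..t+1} (\<lambda>s. exp (- s) * w s)"
        using \<open>t > 0\<close> by (intro continuous_intros continuous_on_subset[OF cont]) auto
    qed (use \<open>t > 0\<close> in \<open>auto simp: g_def\<close>)
    have "integral {t/2..b} g = 0" if "b \<in> {t/2..t+1}" for b
    proof -
      have "set_integrable lborel {t/2..b} g"
        unfolding set_integrable_def using g_int by (intro integrable_mult_indicator) auto
      then have "integral {t/2..b} g = (LBINT s:{t/2..b}. g s)"
        by (simp add: set_borel_integral_eq_integral)
      also have "\<dots> = (LBINT s:{t/2..<b}. g s)"
      proof (rule set_integral_cong_set)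
        show "AE x in lborel. (x \<in> {t/2..<b}) = (x \<in> {t/2..b})"
          using AE_lborel_singleton[of b] by eventually_elim auto
      qed (use borel_measurable_integrable[OF g_int] in \<open>auto simp: set_borel_measurable_def\<close>)
      finally show ?thesis using slice[of "t/2" b] that \<open>t > 0\<close> by simp
    qed
    moreover have "((\<lambda>b. integral {t/2..b} g) has_vector_derivative g t) (at t within {t/2..t+1})"
      using \<open>t > 0\<close> by (intro integral_has_vector_derivative gc) auto
    ultimately have "((\<lambda>b. 0) has_vector_derivative g t) (at t within {t/2..t+1})"
      using \<open>t > 0\<close> by (intro has_vector_derivative_transform[of t _ "\<lambda>b. 0" "\<lambda>b. integral {t/2..b} g"]) auto
    then have "((\<lambda>b. 0) has_vector_derivative g t) (at t)"
      using \<open>t > 0\<close> by (subst (asm) at_within_interior) (auto simp: interior_atLeastAtMost_real)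
    moreover have "((\<lambda>b. 0::real) has_vector_derivative 0) (at t)" by (rule has_vector_derivative_const)
    ultimately have "g t = 0" using vector_derivative_unique_at by blast
    then show ?thesis using \<open>t > 0\<close> by (simp add: g_def)
  qed
qed

section \<open>Integration on the half-line\<close>

text \<open>The integral of the majorant \<open>g x * h y\<close> factorises, so integrability on the product space comes
  for free.\<close>

lemma (in pair_sigma_finite) Fubini_dominated:
  fixes f :: "'a \<Rightarrow> 'b \<Rightarrow> real"
  assumes g: "integrable M1 g" and h: "integrable M2 h"
    and meas [measurable]: "case_prod f \<in> borel_measurable (M1 \<Otimes>\<^sub>M M2)"
    and bound: "\<And>x y. x \<in> space M1 \<Longrightarrow> y \<in> space M2 \<Longrightarrow> \<bar>f x y\<bar> \<le> g x * h y"
  shows "integrable M1 (\<lambda>x. \<integral>y. f x y \<partial>M2)"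
    and "(\<integral>x. (\<integral>y. f x y \<partial>M2) \<partial>M1) = (\<integral>y. (\<integral>x. f x y \<partial>M1) \<partial>M2)"
proof -
  note [measurable] = borel_measurable_integrable[OF g] borel_measurable_integrable[OF h]
  have i: "integrable M2 (f x)" if "x \<in> space M1" for x
  proof (rule Bochner_Integration.integrable_bound)
    show "integrable M2 (\<lambda>y. g x * h y)" using h by simp
    show "f x \<in> borel_measurable M2" using that by measurable
    show "AE y in M2. norm (f x y) \<le> norm (g x * h y)"
      using bound[OF that] by (intro AE_I2) (simp add: order_trans[OF _ abs_ge_self])
  qed
  have "integrable (M1 \<Otimes>\<^sub>M M2) (case_prod f)"
  proof (rule Fubini_integrable)
    show "integrable M1 (\<lambda>x. \<integral>y. norm (case_prod f (x, y)) \<partial>M2)"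
    proof (rule Bochner_Integration.integrable_bound)
      show "integrable M1 (\<lambda>x. g x * (\<integral>y. h y \<partial>M2))" using g by simp
      have "(\<integral>y. \<bar>f x y\<bar> \<partial>M2) \<le> g x * (\<integral>y. h y \<partial>M2)" if "x \<in> space M1" for x
      proof -
        have "(\<integral>y. \<bar>f x y\<bar> \<partial>M2) \<le> (\<integral>y. g x * h y \<partial>M2)"
          using i[OF that] h bound[OF that] by (intro integral_mono) auto
        then show ?thesis by simp
      qed
      then show "AE x in M1. norm (\<integral>y. norm (case_prod f (x, y)) \<partial>M2) \<le> norm (g x * (\<integral>y. h y \<partial>M2))"
        by (intro AE_I2) (simp add: order_trans[OF _ abs_ge_self])
    qed measurable
  qed (use i meas in auto)
  then show "integrable M1 (\<lambda>x. \<integral>y. f x y \<partial>M2)"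
    and "(\<integral>x. (\<integral>y. f x y \<partial>M2) \<partial>M1) = (\<integral>y. (\<integral>x. f x y \<partial>M1) \<partial>M2)"
    using integrable_fst'[of "case_prod f"] Fubini_integral[of f] by simp_all
qed

lemma halfline_FTC:
  fixes F g :: "real \<Rightarrow> real"
  assumes deriv: "\<And>x. x > 0 \<Longrightarrow> (F has_real_derivative g x) (at x)"
    and cont: "\<And>x. x > 0 \<Longrightarrow> isCont g x"
    and int: "set_integrable lborel {0<..} g"
    and "(F \<longlongrightarrow> A) (at_right 0)" "(F \<longlongrightarrow> B) at_top"
  shows "(LINT x:{0<..}|lborel. g x) = B - A"
proof -
  have "(LBINT x=0..\<infinity>. g x) = B - A"
  proof (rule interval_integral_FTC_integrable)
    show "(F has_vector_derivative g x) (at x)" if "0 < ereal x" for x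
      using deriv[of x] that by (simp add: has_real_derivative_iff_has_vector_derivative)
    show "set_integrable lborel (einterval 0 \<infinity>) g" using int by (simp add: zero_ereal_def)
    show "((F \<circ> real_of_ereal) \<longlongrightarrow> A) (at_right 0)" "((F \<circ> real_of_ereal) \<longlongrightarrow> B) (at_left \<infinity>)"
      using assms by (simp_all add: zero_ereal_def ereal_tendsto_simps)
  qed (use cont in auto)
  then show ?thesis by (simp add: interval_integral_to_infinity_eq zero_ereal_def)
qed

lemma tendsto_exp_neg_at_top:
  fixes z :: real assumes "z > 0" shows "((\<lambda>x. exp (- z * x)) \<longlongrightarrow> 0) at_top"
  by (rule filterlim_compose[OF exp_at_bot],
      rule filterlim_tendsto_neg_mult_at_bot[OF tendsto_const _ filterlim_ident])
     (use assms in simp)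

lemma integrable_exp_halfline:
  fixes z :: real assumes "z > 0"
  shows "set_integrable lborel {0<..} (\<lambda>t. exp (- z * t))"
    and "0 \<le> c \<Longrightarrow> (LINT t:{0<..}|lborel. exp (- z * t) * indicator {c<..} t) = exp (- z * c) / z"
proof -
  have base: "has_bochner_integral lborel (\<lambda>t. exp (- z * t) * indicator {c..} t) (exp (- z * c) / z)" for c
  proof -
    have "((\<lambda>t. - exp (- z * t) / z) \<longlongrightarrow> - 0 / z) at_top"
      using assms by (intro tendsto_intros tendsto_exp_neg_at_top) auto
    then have "(\<integral>\<^sup>+t. ennreal (exp (- z * t)) * indicator {c..} t \<partial>lborel) = ennreal (- 0 / z - (- exp (- z * c) / z))"
      using assms by (intro nn_integral_FTC_atLeast[where F="\<lambda>t. - exp (- z * t) / z"])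
        (auto intro!: derivative_eq_intros)
    then have "(\<integral>\<^sup>+t. ennreal (exp (- z * t) * indicator {c..} t) \<partial>lborel) = ennreal (exp (- z * c) / z)"
      by (simp add: ennreal_mult' ennreal_indicator)
    then show ?thesis
      using assms by (intro has_bochner_integral_nn_integral) auto
  qed
  have eq: "AE t in lborel. exp (- z * t) * indicator {c..} t = exp (- z * t) * indicator {c<..} t" for c :: real
    using AE_lborel_singleton[of c] by eventually_elim (auto simp: indicator_def)
  have base': "has_bochner_integral lborel (\<lambda>t. exp (- z * t) * indicator {c<..} t) (exp (- z * c) / z)" for c
    using base[of c] eq[of c] by (subst has_bochner_integral_cong_AE[symmetric]) auto
  show "set_integrable lborel {0<..} (\<lambda>t. exp (- z * t))"
    using base'[of 0] by (auto simp: set_integrable_def mult.commute has_bochner_integral_iff)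
  show "(LINT t:{0<..}|lborel. exp (- z * t) * indicator {c<..} t) = exp (- z * c) / z" if "0 \<le> c"
  proof -
    have "(LINT t:{0<..}|lborel. exp (- z * t) * indicator {c<..} t) = (\<integral>t. exp (- z * t) * indicator {c<..} t \<partial>lborel)"
      unfolding set_lebesgue_integral_def using that
      by (intro Bochner_Integration.integral_cong) (auto simp: indicator_def)
    then show ?thesis using base'[of c] by (simp add: has_bochner_integral_iff)
  qed
qed

lemma set_integrable_exp_bounded:
  fixes f :: "real \<Rightarrow> real"
  assumes cont: "\<And>x. x > 0 \<Longrightarrow> isCont f x"
    and bound: "\<And>x. x > 0 \<Longrightarrow> \<bar>f x\<bar> \<le> C"
    and "c > 0"
  shows "set_integrable lborel {0<..} (\<lambda>x. exp (- c * x) * f x)"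
proof (rule set_integrable_bound[rotated])
  have "(\<lambda>x. indicator {0<..} x *\<^sub>R (exp (- c * x) * f x)) \<in> borel_measurable borel"
    by (intro borel_measurable_continuous_on_indicator continuous_at_imp_continuous_on ballI
          continuous_intros cont) auto
  then show "set_borel_measurable lborel {0<..} (\<lambda>x. exp (- c * x) * f x)"
    by (simp add: set_borel_measurable_def)
  show "set_integrable lborel {0<..} (\<lambda>x. C * exp (- c * x))"
    by (intro set_integrable_mult_right integrable_exp_halfline(1) \<open>c > 0\<close>)
  show "AE x in lborel. x \<in> {0<..} \<longrightarrow> norm (exp (- c * x) * f x) \<le> norm (C * exp (- c * x))"
  proof (intro AE_I2 impI)
    fix x :: real assume "x \<in> {0<..}"
    then have "\<bar>f x\<bar> \<le> \<bar>C\<bar>" using bound[of x] by auto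
    then show "norm (exp (- c * x) * f x) \<le> norm (C * exp (- c * x))" by (simp add: abs_mult)
  qed
qed

text \<open>The value of \<open>f\<close> at \<open>0\<close> is replaced by a one-sided limit, because the rule is applied in the time
  variable to functions whose derivative may be unbounded near \<open>0\<close>.\<close>

lemma laplace_integral_by_parts:
  fixes f f' :: "real \<Rightarrow> real"
  assumes deriv: "\<And>x. x > 0 \<Longrightarrow> (f has_real_derivative f' x) (at x)"
    and cont: "\<And>x. x > 0 \<Longrightarrow> isCont f' x"
    and bound: "\<And>x. x > 0 \<Longrightarrow> \<bar>f x\<bar> \<le> C"
    and int: "set_integrable lborel {0<..} (\<lambda>x. exp (- c * x) * f' x)"
    and lim: "(f \<longlongrightarrow> A) (at_right 0)"
    and "c > 0"
  shows "(LINT x:{0<..}|lborel. exp (- c * x) * f' x) = c * (LINT x:{0<..}|lborel. exp (- c * x) * f x) - A"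
proof -
  have contf: "isCont f x" if "x > 0" for x using deriv[OF that] by (rule DERIV_isCont)
  have int_f: "set_integrable lborel {0<..} (\<lambda>x. exp (- c * x) * f x)"
    by (rule set_integrable_exp_bounded[OF contf bound \<open>c > 0\<close>])
  have "(LINT x:{0<..}|lborel. exp (- c * x) * f' x - c * (exp (- c * x) * f x)) = 0 - exp (- c * 0) * A"
  proof (rule halfline_FTC[where F="\<lambda>x. exp (- c * x) * f x"])
    show "((\<lambda>x. exp (- c * x) * f x) has_real_derivative exp (- c * x) * f' x - c * (exp (- c * x) * f x)) (at x)"
      if "x > 0" for x
      using deriv[OF that] by (auto intro!: derivative_eq_intros)
    show "isCont (\<lambda>x. exp (- c * x) * f' x - c * (exp (- c * x) * f x)) x" if "x > 0" for x
      by (intro continuous_intros cont contf that)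
    show "set_integrable lborel {0<..} (\<lambda>x. exp (- c * x) * f' x - c * (exp (- c * x) * f x))"
      using int int_f by (intro set_integral_diff set_integrable_mult_right)
    show "((\<lambda>x. exp (- c * x) * f x) \<longlongrightarrow> exp (- c * 0) * A) (at_right 0)"
      by (intro tendsto_intros lim)
    show "((\<lambda>x. exp (- c * x) * f x) \<longlongrightarrow> 0) at_top"
    proof (rule Lim_null_comparison)
      show "eventually (\<lambda>x. norm (exp (- c * x) * f x) \<le> exp (- c * x) * C) at_top"
        using eventually_gt_at_top[of 0] by eventually_elim (use bound in \<open>auto simp: abs_mult\<close>)
      have "((\<lambda>x. exp (- c * x) * C) \<longlongrightarrow> 0 * C) at_top"
        using \<open>c > 0\<close> by (intro tendsto_intros tendsto_exp_neg_at_top)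
      then show "((\<lambda>x. exp (- c * x) * C) \<longlongrightarrow> 0) at_top" by simp
    qed
  qed
  moreover have "(LINT x:{0<..}|lborel. exp (- c * x) * f' x - c * (exp (- c * x) * f x)) =
     (LINT x:{0<..}|lborel. exp (- c * x) * f' x) - c * (LINT x:{0<..}|lborel. exp (- c * x) * f x)"
    using int int_f by (subst set_integral_diff) auto
  ultimately show "(LINT x:{0<..}|lborel. exp (- c * x) * f' x) = c * (LINT x:{0<..}|lborel. exp (- c * x) * f x) - A"
    by simp
qed

text \<open>The half-line \<open>s > a\<close> is a neighbourhood of \<open>t\<close> on which the majorant is uniform; the functions
  below have no majorant that is uniform up to \<open>0\<close>.\<close>

lemma isCont_integral:
  fixes h :: "real \<Rightarrow> 'a \<Rightarrow> real"
  assumes meas: "\<And>s. s > a \<Longrightarrow> h s \<in> borel_measurable M"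
    and cont: "\<And>\<omega>. isCont (\<lambda>s. h s \<omega>) t"
    and bound: "\<And>s \<omega>. s > a \<Longrightarrow> \<bar>h s \<omega>\<bar> \<le> w \<omega>"
    and int: "integrable M w"
    and "t > a"
  shows "isCont (\<lambda>s. \<integral>\<omega>. h s \<omega> \<partial>M) t"
  unfolding continuous_at_sequentially comp_def
proof (intro allI impI)
  fix x :: "nat \<Rightarrow> real" assume x: "x \<longlonglongrightarrow> t"
  define x' where "x' n = (if x n > a then x n else t)" for n
  have ev: "eventually (\<lambda>n. x' n = x n) sequentially"
    using order_tendstoD(1)[OF x \<open>t > a\<close>] by eventually_elim (simp add: x'_def)
  have x': "x' \<longlonglongrightarrow> t" using x ev by (simp cong: tendsto_cong)
  have gt: "x' n > a" for n using \<open>t > a\<close> by (simp add: x'_def)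
  have "(\<lambda>n. \<integral>\<omega>. h (x' n) \<omega> \<partial>M) \<longlonglongrightarrow> (\<integral>\<omega>. h t \<omega> \<partial>M)"
    by (rule integral_dominated_convergence[where w=w])
       (use meas gt \<open>t > a\<close> bound int in \<open>auto intro!: isCont_tendsto_compose[OF cont x']\<close>)
  then show "(\<lambda>n. \<integral>\<omega>. h (x n) \<omega> \<partial>M) \<longlonglongrightarrow> (\<integral>\<omega>. h t \<omega> \<partial>M)"
    by (rule Lim_transform_eventually) (use ev in eventually_elim, simp)
qed

text \<open>Differentiation under the integral is continuity at \<open>t\<close> of the integrated difference quotients,
  which the mean value theorem bounds by the bound for \<open>h'\<close>.\<close>

lemma (in finite_measure) has_real_derivative_integral:
  fixes h h' :: "real \<Rightarrow> 'a \<Rightarrow> real"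
  assumes int: "\<And>s. s > a \<Longrightarrow> integrable M (h s)"
    and deriv: "\<And>s \<omega>. s > a \<Longrightarrow> ((\<lambda>s. h s \<omega>) has_real_derivative h' s \<omega>) (at s)"
    and bound: "\<And>s \<omega>. s > a \<Longrightarrow> \<bar>h' s \<omega>\<bar> \<le> B"
    and meas: "h' t \<in> borel_measurable M"
    and "t > a"
  shows "((\<lambda>s. \<integral>\<omega>. h s \<omega> \<partial>M) has_real_derivative (\<integral>\<omega>. h' t \<omega> \<partial>M)) (at t)"
proof -
  define q where "q s \<omega> = (if s = t then h' t \<omega> else (h s \<omega> - h t \<omega>) / (s - t))" for s \<omega>
  have "isCont (\<lambda>s. \<integral>\<omega>. q s \<omega> \<partial>M) t"
  proof (rule isCont_integral[where w="\<lambda>_. B"])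
    show "q s \<in> borel_measurable M" if "s > a" for s
      unfolding q_def[abs_def]
      using meas int[OF that] int[OF \<open>t > a\<close>] by (cases "s = t") auto
    show "isCont (\<lambda>s. q s \<omega>) t" for \<omega>
    proof -
      have "((\<lambda>s. (h s \<omega> - h t \<omega>) / (s - t)) \<longlongrightarrow> h' t \<omega>) (at t)"
        using deriv[OF \<open>t > a\<close>, of \<omega>] by (simp add: has_field_derivative_iff)
      then have "((\<lambda>s. q s \<omega>) \<longlongrightarrow> h' t \<omega>) (at t)"
        by (rule Lim_transform_eventually) (auto simp: q_def eventually_at_filter)
      then show ?thesis by (simp add: isCont_def q_def)
    qed
    show "\<bar>q s \<omega>\<bar> \<le> B" if "s > a" for s \<omega>
    proof (cases "s = t")
      case False
      have "\<exists>x. x > a \<and> h s \<omega> - h t \<omega> = (s - t) * h' x \<omega>"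
      proof (cases "s < t")
        case True
        from MVT2[OF this, of "\<lambda>s. h s \<omega>" "\<lambda>s. h' s \<omega>"] deriv that
        obtain x where "s < x" "h t \<omega> - h s \<omega> = (t - s) * h' x \<omega>" by (meson less_le_trans)
        then show ?thesis using that by (intro exI[of _ x]) (auto simp: algebra_simps)
      next
        case f: False
        with False have "t < s" by simp
        from MVT2[OF this, of "\<lambda>s. h s \<omega>" "\<lambda>s. h' s \<omega>"] deriv \<open>t > a\<close>
        obtain x where "t < x" "h s \<omega> - h t \<omega> = (s - t) * h' x \<omega>" by (meson less_le_trans)
        then show ?thesis using \<open>t > a\<close> by (intro exI[of _ x]) auto
      qed
      then obtain x where "x > a" "h s \<omega> - h t \<omega> = (s - t) * h' x \<omega>" by blast
      then show ?thesis using False bound[of x \<omega>] by (simp add: q_def)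
    qed (use bound[OF \<open>t > a\<close>] in \<open>simp add: q_def\<close>)
  qed (use \<open>t > a\<close> in auto)
  then have "((\<lambda>s. \<integral>\<omega>. q s \<omega> \<partial>M) \<longlongrightarrow> (\<integral>\<omega>. h' t \<omega> \<partial>M)) (at t)"
    by (simp add: isCont_def q_def)
  moreover have "eventually (\<lambda>s. (\<integral>\<omega>. q s \<omega> \<partial>M) = ((\<integral>\<omega>. h s \<omega> \<partial>M) - (\<integral>\<omega>. h t \<omega> \<partial>M)) / (s - t)) (at t)"
  proof -
    have "eventually (\<lambda>s. s > a) (at t)"
      using \<open>t > a\<close> order_tendstoD(1)[OF tendsto_ident_at] by blast
    moreover have "eventually (\<lambda>s. s \<noteq> t) (at t)" by (simp add: eventually_at_filter)
    ultimately show ?thesis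
      by eventually_elim (use int \<open>t > a\<close> in \<open>simp add: q_def\<close>)
  qed
  ultimately have "((\<lambda>s. ((\<integral>\<omega>. h s \<omega> \<partial>M) - (\<integral>\<omega>. h t \<omega> \<partial>M)) / (s - t)) \<longlongrightarrow> (\<integral>\<omega>. h' t \<omega> \<partial>M)) (at t)"
    by (rule Lim_transform_eventually)
  then show ?thesis by (simp add: has_field_derivative_iff)
qed

section \<open>Tail integrals and fractional kernels\<close>

text \<open>Integrate \<open>f (W \<omega>) - f 0 = (\<integral>x. f' x * indicator {0<..<W \<omega>} x)\<close> over \<open>\<omega>\<close> and exchange the integrals.
  The formula uses only the tail probabilities of \<open>W\<close>; two random variables with the same tails are
  compared through it.\<close>

lemma (in prob_space) expectation_tail_formula:
  fixes W :: "'a \<Rightarrow> real" and f f' :: "real \<Rightarrow> real"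
  assumes W [measurable]: "W \<in> borel_measurable M" and nonneg: "\<And>\<omega>. 0 \<le> W \<omega>"
    and deriv: "\<And>x. (f has_real_derivative f' x) (at x)"
    and cont: "\<And>x. isCont f' x"
    and int: "set_integrable lborel {0<..} f'"
  shows "expectation (\<lambda>\<omega>. f (W \<omega>)) = f 0 + (LINT x:{0<..}|lborel. f' x * prob {\<omega> \<in> space M. x < W \<omega>})"
proof -
  interpret pair_sigma_finite lborel M ..
  have [measurable]: "f' \<in> borel_measurable borel"
    using cont by (intro borel_measurable_continuous_onI continuous_at_imp_continuous_on) auto
  define F where "F x \<omega> = (if 0 < x \<and> x < W \<omega> then f' x else 0)" for x \<omega>
  have meas: "case_prod F \<in> borel_measurable (lborel \<Otimes>\<^sub>M M)"
    unfolding F_def[abs_def] by measurable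
  have g: "integrable lborel (\<lambda>x. \<bar>indicator {0<..} x * f' x\<bar>)"
    using int by (simp add: set_integrable_def)
  have "(\<integral>x. (\<integral>\<omega>. F x \<omega> \<partial>M) \<partial>lborel) = (\<integral>\<omega>. (\<integral>x. F x \<omega> \<partial>lborel) \<partial>M)"
    by (rule Fubini_dominated(2)[OF g _ meas, of "\<lambda>_. 1"]) (auto simp: F_def indicator_def)
  moreover have "(\<integral>\<omega>. F x \<omega> \<partial>M) = indicator {0<..} x *\<^sub>R (f' x * prob {\<omega> \<in> space M. x < W \<omega>})" for x
  proof -
    have "(\<integral>\<omega>. F x \<omega> \<partial>M) = (\<integral>\<omega>. indicator {0<..} x * f' x * indicator {\<omega> \<in> space M. x < W \<omega>} \<omega> \<partial>M)"
      by (intro Bochner_Integration.integral_cong) (auto simp: F_def indicator_def)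
    then show ?thesis by (simp add: Int_absorb1 Collect_conj_eq)
  qed
  moreover have "(\<integral>x. F x \<omega> \<partial>lborel) = f (W \<omega>) - f 0" for \<omega>
  proof -
    have eq: "indicator {0<..<W \<omega>} x * f' x = F x \<omega>" for x by (simp add: F_def indicator_def)
    have "set_integrable lborel {0<..<W \<omega>} f'"
      by (rule set_integrable_subset[OF int]) auto
    then have "(LINT x:{0<..<W \<omega>}|lborel. f' x) = integral {0<..<W \<omega>} f'"
      by (rule set_borel_integral_eq_integral)
    moreover have "(f' has_integral f (W \<omega>) - f 0) {0..W \<omega>}"
      using nonneg deriv by (intro fundamental_theorem_of_calculus)
        (auto simp: has_real_derivative_iff_has_vector_derivative intro: has_vector_derivative_at_within)
    ultimately show ?thesis
      by (simp add: set_lebesgue_integral_def eq has_integral_Icc_iff_Ioo integral_unique)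
  qed
  moreover have "integrable M (\<lambda>\<omega>. f (W \<omega>) - f 0)"
  proof -
    interpret flip: pair_sigma_finite M lborel ..
    have "integrable M (\<lambda>\<omega>. \<integral>x. F x \<omega> \<partial>lborel)"
    proof (rule flip.Fubini_dominated(1)[where g="\<lambda>_. 1", OF _ g])
      show "(\<lambda>(\<omega>, x). F x \<omega>) \<in> borel_measurable (M \<Otimes>\<^sub>M lborel)"
        unfolding F_def[abs_def] by measurable
    qed (auto simp: F_def indicator_def )
    then show ?thesis using calculation by simp
  qed
  moreover from this have "integrable M (\<lambda>\<omega>. (f (W \<omega>) - f 0) + f 0)"
    by (intro Bochner_Integration.integrable_add) auto
  ultimately show ?thesis by (simp add: set_lebesgue_integral_def prob_space)
qed

text \<open>The Gamma integral, rescaled by \<open>z\<close>.\<close>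

lemma gamma_kernel_laplace:
  fixes \<beta> z :: real assumes "\<beta> < 1" "z > 0"
  shows "set_integrable lborel {0<..} (\<lambda>r. exp (- z * r) * r powr (- \<beta>))"
    and "(LINT r:{0<..}|lborel. exp (- z * r) * r powr (- \<beta>)) = Gamma (1 - \<beta>) * z powr (\<beta> - 1)"
proof -
  define g where "g r = indicator {0<..} r * (exp (- r) * r powr (- \<beta>))" for r :: real
  have "(\<integral>\<^sup>+r. ennreal (g r) \<partial>lborel) = (\<integral>\<^sup>+t. ennreal (indicator {0..} t * t powr (1 - \<beta> - 1) / exp t) \<partial>lborel)"
  proof (rule nn_integral_cong_AE)
    show "AE r in lborel. ennreal (g r) = ennreal (indicator {0..} r * r powr (1 - \<beta> - 1) / exp r)"
      using AE_lborel_singleton[of 0]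
      by eventually_elim (auto simp: g_def indicator_def exp_minus field_simps)
  qed
  also have "\<dots> = ennreal (Gamma (1 - \<beta>))"
    using assms Gamma_conv_nn_integral_real[of "1 - \<beta>"] by simp
  finally have "has_bochner_integral lborel g (Gamma (1 - \<beta>))"
    using assms by (intro has_bochner_integral_nn_integral) (auto simp: g_def[abs_def] Gamma_real_nonneg)
  then have "has_bochner_integral lborel (\<lambda>r. g (0 + z * r)) (Gamma (1 - \<beta>) /\<^sub>R \<bar>z\<bar>)"
    using assms by (intro lborel_has_bochner_integral_real_affine_iff[THEN iffD1]) auto
  then have "has_bochner_integral lborel (\<lambda>r. z powr \<beta> * g (0 + z * r)) (z powr \<beta> * (Gamma (1 - \<beta>) /\<^sub>R \<bar>z\<bar>))"
    by (intro has_bochner_integral_mult_right) auto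
  moreover have "z powr \<beta> * g (0 + z * r) = indicator {0<..} r *\<^sub>R (exp (- z * r) * r powr (- \<beta>))" for r
    using assms by (auto simp: g_def indicator_def powr_mult zero_less_mult_iff powr_minus field_simps)
  moreover have "z powr \<beta> * (Gamma (1 - \<beta>) /\<^sub>R \<bar>z\<bar>) = Gamma (1 - \<beta>) * z powr (\<beta> - 1)"
    using assms by (simp add: powr_diff field_simps)
  ultimately have "has_bochner_integral lborel (\<lambda>r. indicator {0<..} r *\<^sub>R (exp (- z * r) * r powr (- \<beta>)))
      (Gamma (1 - \<beta>) * z powr (\<beta> - 1))"
    by (simp only:)
  then show "set_integrable lborel {0<..} (\<lambda>r. exp (- z * r) * r powr (- \<beta>))"
    and "(LINT r:{0<..}|lborel. exp (- z * r) * r powr (- \<beta>)) = Gamma (1 - \<beta>) * z powr (\<beta> - 1)"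
    by (simp_all add: set_integrable_def set_lebesgue_integral_def has_bochner_integral_iff)
qed

text \<open>Translation invariance makes the inner integral over \<open>t\<close> independent of \<open>s\<close>.\<close>

lemma integral_convolution:
  fixes a b :: "real \<Rightarrow> real"
  assumes a: "integrable lborel a" and b: "integrable lborel b"
  shows "integrable lborel (\<lambda>t. \<integral>s. a (t - s) * b s \<partial>lborel)"
    and "(\<integral>t. (\<integral>s. a (t - s) * b s \<partial>lborel) \<partial>lborel) = (\<integral>r. a r \<partial>lborel) * (\<integral>s. b s \<partial>lborel)"
proof -
  note [measurable] = borel_measurable_integrable[OF a] borel_measurable_integrable[OF b]
  have shift: "integrable lborel (\<lambda>t. g (t - s))" "(\<integral>t. g (t - s) \<partial>lborel) = (\<integral>r. g r \<partial>lborel)"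
    if "integrable lborel g" for g :: "real \<Rightarrow> real" and s
    using lborel_integrable_real_affine[OF that, of 1 "- s"] lborel_integral_real_affine[of 1 g "- s"] by simp_all
  have int: "integrable (lborel \<Otimes>\<^sub>M lborel) (\<lambda>(s, t). a (t - s) * b s)"
  proof (rule lborel_pair.Fubini_integrable)
    have "(\<integral>t. norm (a (t - s) * b s) \<partial>lborel) = (\<integral>r. \<bar>a r\<bar> \<partial>lborel) * \<bar>b s\<bar>" for s
      using shift(2)[of "\<lambda>r. \<bar>a r\<bar>" s] a by (simp add: abs_mult)
    then show "integrable lborel (\<lambda>s. \<integral>t. norm (case (s, t) of (s, t) \<Rightarrow> a (t - s) * b s) \<partial>lborel)"
      using b by simp
    show "AE s in lborel. integrable lborel (\<lambda>t. case (s, t) of (s, t) \<Rightarrow> a (t - s) * b s)"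
      using shift(1)[OF a] by simp
  qed measurable
  show "integrable lborel (\<lambda>t. \<integral>s. a (t - s) * b s \<partial>lborel)"
    using lborel_pair.integrable_snd[OF int] by simp
  have "(\<integral>t. (\<integral>s. a (t - s) * b s \<partial>lborel) \<partial>lborel) = (\<integral>s. (\<integral>t. a (t - s) * b s \<partial>lborel) \<partial>lborel)"
    using lborel_pair.Fubini_integral[OF int] by simp
  also have "\<dots> = (\<integral>s. (\<integral>r. a r \<partial>lborel) * b s \<partial>lborel)"
    using shift(2)[OF a] by simp
  finally show "(\<integral>t. (\<integral>s. a (t - s) * b s \<partial>lborel) \<partial>lborel) = (\<integral>r. a r \<partial>lborel) * (\<integral>s. b s \<partial>lborel)"
    by simp
qed

text \<open>Multiplication by \<open>exp (- z * t) = exp (- z * (t - s)) * exp (- z * s)\<close> leaves a convolution of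
  the weighted kernel with the weighted \<open>v\<close>.\<close>

lemma laplace_fractional_integral:
  fixes v :: "real \<Rightarrow> real"
  assumes "\<beta> < 1" "z > 0" and v: "set_integrable lborel {0<..} (\<lambda>s. exp (- z * s) * v s)"
  shows "set_integrable lborel {0<..} (\<lambda>t. exp (- z * t) * (LINT s:{0<..<t}|lborel. v s / (t - s) powr \<beta>))"
    and "(LINT t:{0<..}|lborel. exp (- z * t) * (LINT s:{0<..<t}|lborel. v s / (t - s) powr \<beta>))
          = Gamma (1 - \<beta>) * z powr (\<beta> - 1) * (LINT s:{0<..}|lborel. exp (- z * s) * v s)"
proof -
  define a where "a r = indicator {0<..} r *\<^sub>R (exp (- z * r) * r powr (- \<beta>))" for r :: real
  define b where "b s = indicator {0<..} s *\<^sub>R (exp (- z * s) * v s)" for s :: real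
  have "integrable lborel a" "integrable lborel b"
    using gamma_kernel_laplace(1)[OF assms(1,2)] v by (simp_all add: set_integrable_def a_def[abs_def] b_def[abs_def])
  note conv = integral_convolution[OF this]
  have eq: "(\<integral>s. a (t - s) * b s \<partial>lborel)
     = indicator {0<..} t *\<^sub>R (exp (- z * t) * (LINT s:{0<..<t}|lborel. v s / (t - s) powr \<beta>))" for t
  proof -
    have "(\<integral>s. a (t - s) * b s \<partial>lborel)
        = (\<integral>s. indicator {0<..} t * exp (- z * t) * (indicator {0<..<t} s *\<^sub>R (v s / (t - s) powr \<beta>)) \<partial>lborel)"
    proof (rule Bochner_Integration.integral_cong[OF refl])
      fix s
      have "exp (- z * t) = exp (- z * (t - s)) * exp (- z * s)"
        by (simp add: exp_add[symmetric] algebra_simps)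
      then show "a (t - s) * b s = indicator {0<..} t * exp (- z * t) * (indicator {0<..<t} s *\<^sub>R (v s / (t - s) powr \<beta>))"
        by (auto simp: a_def b_def indicator_def powr_minus divide_inverse)
    qed
    then show ?thesis
      unfolding set_lebesgue_integral_def integral_mult_right_zero by simp
  qed
  show "set_integrable lborel {0<..} (\<lambda>t. exp (- z * t) * (LINT s:{0<..<t}|lborel. v s / (t - s) powr \<beta>))"
    using conv(1) by (simp add: eq set_integrable_def)
  show "(LINT t:{0<..}|lborel. exp (- z * t) * (LINT s:{0<..<t}|lborel. v s / (t - s) powr \<beta>))
          = Gamma (1 - \<beta>) * z powr (\<beta> - 1) * (LINT s:{0<..}|lborel. exp (- z * s) * v s)"
    using conv(2) gamma_kernel_laplace(2)[OF assms(1,2)]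
    unfolding eq unfolding set_lebesgue_integral_def[of lborel "{0<..}"] a_def[symmetric] b_def[symmetric] by simp
qed

section \<open>Inverses of positive mixtures of powers\<close>

locale power_mixture =
  fixes J :: "'j set" and \<nu> y :: "'j \<Rightarrow> real"
  assumes finite_J: "finite J" and J_ne: "J \<noteq> {}"
    and order: "\<And>j. j \<in> J \<Longrightarrow> 0 < \<nu> j \<and> \<nu> j < 1"
    and y_pos: "\<And>j. j \<in> J \<Longrightarrow> 0 < y j"
begin

text \<open>In the application \<open>y\<close> collects the values at time \<open>1\<close> of stable subordinators of the orders \<open>\<nu>\<close>,
  and \<open>x powr (1 / \<nu> j)\<close> is the factor by which self-similarity rescales them to time \<open>x\<close>.\<close>

definition mix :: "real \<Rightarrow> real" where
  "mix x = (\<Sum>j\<in>J. x powr (1 / \<nu> j) * y j)"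

text \<open>This is \<open>x * mix' x\<close>. It is preferred to the derivative because it dominates \<open>mix\<close> itself: every
  exponent \<open>1 / \<nu> j\<close> exceeds \<open>1\<close>.\<close>

definition log_slope :: "real \<Rightarrow> real" where
  "log_slope x = (\<Sum>j\<in>J. 1 / \<nu> j * (x powr (1 / \<nu> j) * y j))"

definition mix_inv :: "real \<Rightarrow> real" where
  "mix_inv t = (THE x. 0 \<le> x \<and> mix x = t)"

lemma mix_0 [simp]: "mix 0 = 0" by (simp add: mix_def)

lemma mix_strict_mono: "0 \<le> x \<Longrightarrow> x < x' \<Longrightarrow> mix x < mix x'"
  unfolding mix_def using finite_J J_ne y_pos order
  by (intro sum_strict_mono mult_strict_right_mono powr_less_mono2) auto

lemma mix_less_iff: "0 \<le> x \<Longrightarrow> 0 \<le> x' \<Longrightarrow> mix x < mix x' \<longleftrightarrow> x < x'"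
  using mix_strict_mono[of x x'] mix_strict_mono[of x' x] by (cases x x' rule: linorder_cases) auto

lemma mix_nonneg: "0 \<le> x \<Longrightarrow> 0 \<le> mix x"
  using mix_less_iff[of x 0] by simp

lemma continuous_on_mix: "continuous_on {0..} mix"
  unfolding mix_def[abs_def] using order
  by (intro continuous_on_sum continuous_on_mult continuous_on_powr' continuous_on_id continuous_on_const) auto

lemma has_real_derivative_mix:
  assumes "0 < x" shows "(mix has_real_derivative log_slope x / x) (at x)"
proof -
  have "((\<lambda>x. \<Sum>j\<in>J. x powr (1 / \<nu> j) * y j) has_real_derivative
          (\<Sum>j\<in>J. 1 / \<nu> j * x powr (1 / \<nu> j - 1) * y j)) (at x)"
    using assms by (intro DERIV_sum derivative_eq_intros) auto
  moreover have "(\<Sum>j\<in>J. 1 / \<nu> j * x powr (1 / \<nu> j - 1) * y j) = log_slope x / x"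
    using assms by (simp add: log_slope_def sum_divide_distrib powr_diff)
  ultimately show ?thesis by (simp add: mix_def[abs_def])
qed

lemma mix_le_log_slope:
  assumes "0 \<le> x" shows "mix x \<le> log_slope x"
  unfolding mix_def log_slope_def
proof (rule sum_mono)
  fix j assume "j \<in> J"
  then have "1 \<le> 1 / \<nu> j" "0 \<le> x powr (1 / \<nu> j) * y j"
    using order[of j] y_pos[of j] by (auto simp: less_imp_le)
  then show "x powr (1 / \<nu> j) * y j \<le> 1 / \<nu> j * (x powr (1 / \<nu> j) * y j)"
    using mult_right_mono by fastforce
qed

lemma mix_inv_ex1:
  assumes "0 \<le> t" shows "\<exists>!x. 0 \<le> x \<and> mix x = t"
proof -
  obtain j where j: "j \<in> J" using J_ne by auto
  \<comment> \<open>At this point a single summand already reaches the level \<open>t\<close>.\<close>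
  define x where "x = (t / y j) powr \<nu> j"
  have "t = x powr (1 / \<nu> j) * y j"
    using assms j order[OF j] y_pos[OF j] by (simp add: x_def powr_powr)
  also have "\<dots> \<le> mix x"
    unfolding mix_def using j finite_J y_pos by (intro member_le_sum) (auto simp: less_imp_le)
  finally have "t \<le> mix x" .
  moreover have "0 \<le> x" by (simp add: x_def)
  moreover have "continuous_on {0..x} mix"
    by (rule continuous_on_subset[OF continuous_on_mix]) auto
  ultimately obtain x' where x': "0 \<le> x'" "mix x' = t"
    using IVT'[of mix 0 t x] assms by auto
  show ?thesis
  proof (intro ex1I[of _ x'] conjI)
    fix x'' assume "0 \<le> x'' \<and> mix x'' = t"
    then show "x'' = x'"
      using mix_less_iff[of x' x''] mix_less_iff[of x'' x'] x' by (cases x' x'' rule: linorder_cases) auto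
  qed (use x' in auto)
qed

lemma mix_inv:
  assumes "0 \<le> t" shows "0 \<le> mix_inv t" "mix (mix_inv t) = t"
  using theI'[OF mix_inv_ex1[OF assms]] by (auto simp: mix_inv_def)

lemma less_mix_inv_iff: "0 \<le> t \<Longrightarrow> 0 \<le> x \<Longrightarrow> x < mix_inv t \<longleftrightarrow> mix x < t"
  using mix_less_iff[of x "mix_inv t"] mix_inv[of t] by simp

lemma mix_inv_less_iff: "0 \<le> t \<Longrightarrow> 0 \<le> x \<Longrightarrow> mix_inv t < x \<longleftrightarrow> t < mix x"
  using mix_less_iff[of "mix_inv t" x] mix_inv[of t] by simp

lemma mix_inv_pos: "0 < t \<Longrightarrow> 0 < mix_inv t"
  using less_mix_inv_iff[of t 0] by simp

lemma isCont_mix_inv: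
  assumes "0 < t" shows "isCont mix_inv t"
  unfolding isCont_def
proof (rule order_tendstoI)
  have pos: "eventually (\<lambda>s. 0 < s) (at t)"
    using assms order_tendstoD(1)[OF tendsto_ident_at] by blast
  fix a
  assume a: "a < mix_inv t"
  show "eventually (\<lambda>s. a < mix_inv s) (at t)"
  proof (cases "0 \<le> a")
    case True
    then have "eventually (\<lambda>s. mix a < s) (at t)"
      using a assms less_mix_inv_iff[of t a] order_tendstoD(1)[OF tendsto_ident_at] by auto
    with pos show ?thesis by eventually_elim (use True less_mix_inv_iff in auto)
  next
    case False
    from pos show ?thesis by eventually_elim (use False in \<open>simp add: mix_inv(1) order.strict_trans2[OF _ mix_inv(1)]\<close>)
  qed
next
  have pos: "eventually (\<lambda>s. 0 < s) (at t)"
    using assms order_tendstoD(1)[OF tendsto_ident_at] by blast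
  fix a
  assume a: "mix_inv t < a"
  then have "0 \<le> a" using mix_inv(1)[of t] assms by auto
  then have "eventually (\<lambda>s. s < mix a) (at t)"
    using a assms mix_inv_less_iff[of t a] order_tendstoD(2)[OF tendsto_ident_at] by auto
  with pos show "eventually (\<lambda>s. mix_inv s < a) (at t)"
    by eventually_elim (use \<open>0 \<le> a\<close> mix_inv_less_iff in auto)
qed

lemma log_slope_mix_inv_ge: "0 \<le> t \<Longrightarrow> t \<le> log_slope (mix_inv t)"
  using mix_le_log_slope[of "mix_inv t"] mix_inv[of t] by simp

lemma has_real_derivative_mix_inv:
  assumes "0 < t"
  shows "(mix_inv has_real_derivative mix_inv t / log_slope (mix_inv t)) (at t)"
proof -
  have "DERIV mix_inv t :> inverse (log_slope (mix_inv t) / mix_inv t)"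
  proof (rule DERIV_inverse_function[where f=mix and a=0 and b="t+1"])
    show "(mix has_real_derivative log_slope (mix_inv t) / mix_inv t) (at (mix_inv t))"
      by (rule has_real_derivative_mix) (rule mix_inv_pos[OF assms])
    show "log_slope (mix_inv t) / mix_inv t \<noteq> 0"
      using mix_inv_pos[OF assms] log_slope_mix_inv_ge[of t] assms by simp
  qed (use assms mix_inv isCont_mix_inv in auto)
  then show ?thesis by (simp add: inverse_eq_divide)
qed

lemma isCont_log_slope: "0 < x \<Longrightarrow> isCont log_slope x"
  unfolding log_slope_def[abs_def] by (intro continuous_intros) auto

lemma isCont_mix_inv_deriv:
  assumes "0 < t" shows "isCont (\<lambda>t. mix_inv t / log_slope (mix_inv t)) t"
  using log_slope_mix_inv_ge[of t] assms
  by (intro continuous_intros isCont_mix_inv isCont_o2[OF isCont_mix_inv isCont_log_slope] mix_inv_pos) auto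

text \<open>The quotient is the derivative of \<open>mix_inv\<close>. The upper bound comes from
  \<open>t = mix (mix_inv t) \<le> log_slope (mix_inv t)\<close>. Multiplied by \<open>f' (mix_inv t)\<close> with \<open>x * f' x\<close>
  bounded, it becomes a bound that is uniform in \<open>y\<close>, which permits differentiation under an
  expectation over random \<open>y\<close>.\<close>

lemma mix_inv_deriv_bounds:
  assumes "0 < t"
  shows "0 \<le> mix_inv t / log_slope (mix_inv t)"
    and "mix_inv t / log_slope (mix_inv t) \<le> mix_inv t / t"
  using log_slope_mix_inv_ge[of t] mix_inv_pos[of t] assms
  by (auto intro!: divide_left_mono)

end

section \<open>Means along the inverse of a stable mixture\<close>

text \<open>The bounds are required on the half-line only, where the arguments \<open>R t\<close> below take their values.
  Since \<open>R' t \<le> R t / t\<close>, the bound on \<open>x * f' x\<close> controls the derivative of \<open>f (R t)\<close> by \<open>C / t\<close>,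
  and the bound on \<open>f'\<close> controls it by \<open>C * R t / t\<close>; the first is uniform in \<open>\<omega>\<close>, the
  second has an expectation that is integrable near \<open>t = 0\<close>. Integrability of \<open>f'\<close> is what the tail formula asks for.\<close>

definition test_function :: "(real \<Rightarrow> real) \<Rightarrow> (real \<Rightarrow> real) \<Rightarrow> bool" where
  "test_function f f' \<longleftrightarrow>
     (\<forall>x. (f has_real_derivative f' x) (at x)) \<and> (\<forall>x. isCont f' x) \<and>
     (\<exists>C. \<forall>x\<ge>0. \<bar>f x\<bar> \<le> C \<and> \<bar>f' x\<bar> \<le> C \<and> x * \<bar>f' x\<bar> \<le> C) \<and>
     set_integrable lborel {0<..} f'"

text \<open>The last assumption says that \<open>mix\<close> at \<open>x\<close> has the law of a sum of independent stable subordinators at time \<open>x\<close>.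
  The \<open>Y j\<close> are positive everywhere and not just almost surely, so that \<open>mix\<close> can be inverted
  for every \<open>\<omega>\<close>.\<close>

locale stable_mixture = prob_space M for M :: "'a measure" +
  fixes J :: "'j set" and \<mu> \<nu> :: "'j \<Rightarrow> real" and Y :: "'j \<Rightarrow> 'a \<Rightarrow> real"
  assumes finite_J: "finite J" and J_ne: "J \<noteq> {}"
    and order: "\<And>j. j \<in> J \<Longrightarrow> 0 < \<nu> j \<and> \<nu> j < 1"
    and \<mu>_pos: "\<And>j. j \<in> J \<Longrightarrow> 0 < \<mu> j"
    and Y_pos: "\<And>j \<omega>. j \<in> J \<Longrightarrow> 0 < Y j \<omega>"
    and Y_measurable [measurable]: "\<And>j. j \<in> J \<Longrightarrow> Y j \<in> borel_measurable M"
    and laplace_mix: "\<And>x z. 0 \<le> x \<Longrightarrow> 0 < z \<Longrightarrow>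
      expectation (\<lambda>\<omega>. exp (- z * power_mixture.mix J \<nu> (\<lambda>j. Y j \<omega>) x))
        = exp (- x * (\<Sum>j\<in>J. \<mu> j * z powr \<nu> j))"
begin

text \<open>\<open>R\<close> is the inverse of \<open>Z\<close>, and \<open>R t / D (R t)\<close> is its derivative in \<open>t\<close>.\<close>

definition Z :: "real \<Rightarrow> 'a \<Rightarrow> real" where "Z x \<omega> = power_mixture.mix J \<nu> (\<lambda>j. Y j \<omega>) x"
definition R :: "real \<Rightarrow> 'a \<Rightarrow> real" where "R t \<omega> = power_mixture.mix_inv J \<nu> (\<lambda>j. Y j \<omega>) t"
definition D :: "real \<Rightarrow> 'a \<Rightarrow> real" where "D x \<omega> = power_mixture.log_slope J \<nu> (\<lambda>j. Y j \<omega>) x"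
definition symbol :: "real \<Rightarrow> real" where "symbol z = (\<Sum>j\<in>J. \<mu> j * z powr \<nu> j)"
definition mean :: "(real \<Rightarrow> real) \<Rightarrow> real \<Rightarrow> real" where "mean f t = expectation (\<lambda>\<omega>. f (R t \<omega>))"
text \<open>The derivative of \<open>mean f\<close>, where \<open>f'\<close> is the derivative of \<open>f\<close>.\<close>

definition mean_rate :: "(real \<Rightarrow> real) \<Rightarrow> real \<Rightarrow> real" where
  "mean_rate f' t = expectation (\<lambda>\<omega>. f' (R t \<omega>) * (R t \<omega> / D (R t \<omega>) \<omega>))"

lemma power_mixture_Y: "power_mixture J \<nu> (\<lambda>j. Y j \<omega>)"
  using finite_J J_ne order Y_pos by unfold_locales auto

lemma Z_eq: "Z x \<omega> = (\<Sum>j\<in>J. x powr (1 / \<nu> j) * Y j \<omega>)"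
  by (simp add: Z_def power_mixture.mix_def[OF power_mixture_Y])

lemma D_eq: "D x \<omega> = (\<Sum>j\<in>J. 1 / \<nu> j * (x powr (1 / \<nu> j) * Y j \<omega>))"
  by (simp add: D_def power_mixture.log_slope_def[OF power_mixture_Y])

lemma Z_measurable [measurable]: "case_prod Z \<in> borel_measurable (borel \<Otimes>\<^sub>M M)"
  unfolding Z_eq[abs_def] by measurable

lemma D_measurable [measurable]: "case_prod D \<in> borel_measurable (borel \<Otimes>\<^sub>M M)"
  unfolding D_eq[abs_def] by measurable

lemma Z_nonneg: "0 \<le> x \<Longrightarrow> 0 \<le> Z x \<omega>"
  unfolding Z_def by (rule power_mixture.mix_nonneg[OF power_mixture_Y])

lemma symbol_ge: "j \<in> J \<Longrightarrow> \<mu> j * z powr \<nu> j \<le> symbol z"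
  unfolding symbol_def using finite_J \<mu>_pos by (intro member_le_sum) (auto simp: less_imp_le)

lemma symbol_pos:
  assumes "0 < z" shows "0 < symbol z"
proof -
  obtain j where j: "j \<in> J" using J_ne by auto
  have "0 < \<mu> j * z powr \<nu> j" using \<mu>_pos[OF j] assms by simp
  with symbol_ge[OF j, of z] show ?thesis by simp
qed

lemma laplace_Z: "0 \<le> x \<Longrightarrow> 0 < z \<Longrightarrow> expectation (\<lambda>\<omega>. exp (- z * Z x \<omega>)) = exp (- symbol z * x)"
  using laplace_mix[of x z] by (simp add: Z_def symbol_def mult.commute)

lemma R_nonneg: "0 \<le> t \<Longrightarrow> 0 \<le> R t \<omega>"
  unfolding R_def by (rule power_mixture.mix_inv[OF power_mixture_Y])

lemma less_R_iff: "0 \<le> t \<Longrightarrow> 0 \<le> x \<Longrightarrow> x < R t \<omega> \<longleftrightarrow> Z x \<omega> < t"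
  unfolding R_def Z_def by (rule power_mixture.less_mix_inv_iff[OF power_mixture_Y])

lemma R_measurable:
  assumes "0 \<le> t" shows "R t \<in> borel_measurable M"
  unfolding borel_measurable_iff_greater
proof
  fix a
  show "{\<omega> \<in> space M. a < R t \<omega>} \<in> sets M"
  proof (cases "0 \<le> a")
    case True
    then have "{\<omega> \<in> space M. a < R t \<omega>} = {\<omega> \<in> space M. Z a \<omega> < t}"
      using less_R_iff[OF assms] by auto
    then show ?thesis by simp
  next
    case False
    then have "{\<omega> \<in> space M. a < R t \<omega>} = space M"
      using R_nonneg[OF assms] by (auto simp: not_le intro: less_le_trans)
    then show ?thesis by simp
  qed
qed

text \<open>The Chernoff bound, with the parameter \<open>1 / t\<close> that fits the level \<open>t\<close>.\<close>

lemma prob_Z_less_le: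
  assumes "0 \<le> x" "0 < t"
  shows "prob {\<omega> \<in> space M. Z x \<omega> < t} \<le> exp 1 * exp (- symbol (1 / t) * x)"
proof -
  have "prob {\<omega> \<in> space M. Z x \<omega> < t} = expectation (indicator {\<omega> \<in> space M. Z x \<omega> < t})"
    by (simp add: Int_absorb1 Collect_conj_eq)
  also have "\<dots> \<le> expectation (\<lambda>\<omega>. exp 1 * exp (- (1 / t) * Z x \<omega>))"
  proof (rule integral_mono)
    have "integrable M (\<lambda>\<omega>. exp (- (1 / t) * Z x \<omega>))"
      using assms Z_nonneg by (intro integrable_const_bound[of _ 1]) auto
    then show "integrable M (\<lambda>\<omega>. exp 1 * exp (- (1 / t) * Z x \<omega>))" by simp
    show "indicator {\<omega> \<in> space M. Z x \<omega> < t} \<omega> \<le> exp 1 * exp (- (1 / t) * Z x \<omega>)" for \<omega>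
      using assms by (auto simp: indicator_def exp_add[symmetric] field_simps)
  qed (auto simp: emeasure_eq_measure)
  also have "\<dots> = exp 1 * exp (- symbol (1 / t) * x)" using laplace_Z[of x "1 / t"] assms by simp
  finally show ?thesis .
qed

text \<open>The mean is the integral over \<open>x > 0\<close> of \<open>P (R t > x) = P (Z x < t)\<close>, which decays exponentially.\<close>

lemma expectation_R_le:
  assumes "0 < t"
  shows "integrable M (R t)" and "expectation (R t) \<le> exp 1 / symbol (1 / t)"
proof -
  interpret pair_sigma_finite M lborel ..
  note [measurable] = R_measurable[OF less_imp_le[OF assms]]
  define c where "c = symbol (1 / t)"
  have c: "0 < c" unfolding c_def using assms by (intro symbol_pos) auto
  have "(\<integral>\<^sup>+\<omega>. ennreal (R t \<omega>) \<partial>M) = (\<integral>\<^sup>+\<omega>. (\<integral>\<^sup>+x. indicator {0<..} x * indicator {..<R t \<omega>} x \<partial>lborel) \<partial>M)"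
  proof (rule nn_integral_cong)
    fix \<omega>
    have "(\<integral>\<^sup>+x. indicator {0<..} x * indicator {..<R t \<omega>} x \<partial>lborel) = (\<integral>\<^sup>+x. indicator {0<..<R t \<omega>} x \<partial>lborel)"
      by (intro nn_integral_cong) (auto simp: indicator_def)
    then show "ennreal (R t \<omega>) = (\<integral>\<^sup>+x. indicator {0<..} x * indicator {..<R t \<omega>} x \<partial>lborel)"
      using R_nonneg[of t \<omega>] assms by simp
  qed
  also have "\<dots> = (\<integral>\<^sup>+x. (\<integral>\<^sup>+\<omega>. indicator {0<..} x * indicator {..<R t \<omega>} x \<partial>M) \<partial>lborel)"
  proof (rule Fubini'[symmetric])
    have "(\<lambda>(\<omega>, x). if 0 < x \<and> x < R t \<omega> then 1 else 0 :: ennreal) \<in> borel_measurable (M \<Otimes>\<^sub>M lborel)"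
      by measurable
    moreover have "(\<lambda>(\<omega>, x). if 0 < x \<and> x < R t \<omega> then 1 else 0 :: ennreal) = (\<lambda>(\<omega>, x). indicator {0<..} x * indicator {..<R t \<omega>} x)"
      by (auto simp: fun_eq_iff indicator_def)
    ultimately show "(\<lambda>(\<omega>, x). indicator {0<..} x * indicator {..<R t \<omega>} x :: ennreal) \<in> borel_measurable (M \<Otimes>\<^sub>M lborel)"
      by simp
  qed
  also have "\<dots> \<le> (\<integral>\<^sup>+x. ennreal (exp 1 * (exp (- c * x) * indicator {0<..} x)) \<partial>lborel)"
  proof (rule nn_integral_mono)
    fix x :: real
    show "(\<integral>\<^sup>+\<omega>. indicator {0<..} x * indicator {..<R t \<omega>} x \<partial>M) \<le> ennreal (exp 1 * (exp (- c * x) * indicator {0<..} x))"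
    proof (cases "0 < x")
      case True
      have "(\<integral>\<^sup>+\<omega>. indicator {0<..} x * indicator {..<R t \<omega>} x \<partial>M) = (\<integral>\<^sup>+\<omega>. indicator {\<omega> \<in> space M. Z x \<omega> < t} \<omega> \<partial>M)"
        using True assms less_R_iff[of t x] by (intro nn_integral_cong) (auto simp: indicator_def)
      also have "\<dots> = ennreal (prob {\<omega> \<in> space M. Z x \<omega> < t})"
        by (simp add: emeasure_eq_measure)
      also have "\<dots> \<le> ennreal (exp 1 * exp (- c * x))"
        using prob_Z_less_le[of x t] True assms unfolding c_def by (intro ennreal_leI) auto
      finally show ?thesis using True by simp
    qed simp
  qed
  also have "\<dots> = ennreal (\<integral>x. exp 1 * (exp (- c * x) * indicator {0<..} x) \<partial>lborel)"
    using integrable_exp_halfline(1)[OF c]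
    by (intro nn_integral_eq_integral) (auto simp: set_integrable_def mult.commute)
  also have "(\<integral>x. exp 1 * (exp (- c * x) * indicator {0<..} x) \<partial>lborel) = exp 1 / c"
  proof -
    have "(\<integral>x. exp (- c * x) * indicator {0<..} x \<partial>lborel) = (LINT x:{0<..}|lborel. exp (- c * x) * indicator {0<..} x)"
      unfolding set_lebesgue_integral_def
      by (intro Bochner_Integration.integral_cong) (auto simp: indicator_def)
    then show ?thesis
      unfolding integral_mult_right_zero using integrable_exp_halfline(2)[OF c, of 0] by simp
  qed
  finally have le: "(\<integral>\<^sup>+\<omega>. ennreal (R t \<omega>) \<partial>M) \<le> ennreal (exp 1 / c)" .
  then show int: "integrable M (R t)"
    using R_nonneg[of t] assms by (intro integrableI_nonneg) (auto intro: le_less_trans)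
  show "expectation (R t) \<le> exp 1 / symbol (1 / t)"
    using le nn_integral_eq_integral[OF int] R_nonneg[of t] assms c by (simp add: c_def[symmetric])
qed

lemma expectation_R_le_powr:
  assumes "j \<in> J" "0 < t"
  shows "expectation (R t) \<le> exp 1 / \<mu> j * t powr \<nu> j"
proof -
  have "exp 1 / symbol (1 / t) \<le> exp 1 / (\<mu> j * (1 / t) powr \<nu> j)"
    using symbol_ge[OF assms(1), of "1 / t"] \<mu>_pos[OF assms(1)] assms(2)
    by (intro divide_left_mono mult_pos_pos symbol_pos) auto
  also have "\<dots> = exp 1 / \<mu> j * t powr \<nu> j"
    using assms(2) by (simp add: powr_divide)
  finally show ?thesis using expectation_R_le(2)[OF assms(2)] by linarith
qed

lemma R_rate_bounds:
  assumes "0 < t"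
  shows "0 \<le> R t \<omega> / D (R t \<omega>) \<omega>" and "R t \<omega> / D (R t \<omega>) \<omega> \<le> R t \<omega> / t"
  using power_mixture.mix_inv_deriv_bounds[OF power_mixture_Y assms] by (simp_all add: R_def D_def)

lemma has_real_derivative_R:
  assumes "0 < t" shows "((\<lambda>t. R t \<omega>) has_real_derivative R t \<omega> / D (R t \<omega>) \<omega>) (at t)"
  using power_mixture.has_real_derivative_mix_inv[OF power_mixture_Y assms] by (simp add: R_def[abs_def] D_def)

text \<open>One constant for all bounds. The first estimate is uniform in \<open>\<omega>\<close> and serves as a majorant for
  \<open>t\<close> away from \<open>0\<close>; the second one keeps the smallness of \<open>R t\<close> for small \<open>t\<close>.\<close>

lemma mean_rate_integrand_bound:
  assumes "test_function f f'"
  obtains C where "\<And>t \<omega>. 0 < t \<Longrightarrow> \<bar>f' (R t \<omega>) * (R t \<omega> / D (R t \<omega>) \<omega>)\<bar> \<le> C / t"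
    and "\<And>t \<omega>. 0 < t \<Longrightarrow> \<bar>f' (R t \<omega>) * (R t \<omega> / D (R t \<omega>) \<omega>)\<bar> \<le> C * R t \<omega> / t"
    and "\<And>x. 0 \<le> x \<Longrightarrow> \<bar>f x\<bar> \<le> C" and "\<And>x. 0 \<le> x \<Longrightarrow> \<bar>f' x\<bar> \<le> C" and "0 \<le> C"
proof -
  from assms obtain C where C: "\<And>x. 0 \<le> x \<Longrightarrow> \<bar>f x\<bar> \<le> C" "\<And>x. 0 \<le> x \<Longrightarrow> \<bar>f' x\<bar> \<le> C"
    "\<And>x. 0 \<le> x \<Longrightarrow> x * \<bar>f' x\<bar> \<le> C"
    unfolding test_function_def by blast
  have base: "\<bar>f' (R t \<omega>) * (R t \<omega> / D (R t \<omega>) \<omega>)\<bar> \<le> \<bar>f' (R t \<omega>)\<bar> * (R t \<omega> / t)" if "0 < t" for t \<omega>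
    using R_rate_bounds[OF that, of \<omega>] unfolding abs_mult by (intro mult_left_mono) auto
  show ?thesis
  proof (rule that[of C])
    fix t :: real and \<omega> assume t: "0 < t"
    have R0: "0 \<le> R t \<omega>" using R_nonneg t by simp
    have "\<bar>f' (R t \<omega>)\<bar> * (R t \<omega> / t) \<le> C / t"
      using C(3)[OF R0] t by (simp add: divide_right_mono mult.commute)
    then show "\<bar>f' (R t \<omega>) * (R t \<omega> / D (R t \<omega>) \<omega>)\<bar> \<le> C / t"
      using base[OF t, of \<omega>] by linarith
    have "\<bar>f' (R t \<omega>)\<bar> * (R t \<omega> / t) \<le> C * (R t \<omega> / t)"
      using C(2)[OF R0] R0 t by (intro mult_right_mono) auto
    then show "\<bar>f' (R t \<omega>) * (R t \<omega> / D (R t \<omega>) \<omega>)\<bar> \<le> C * R t \<omega> / t"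
      using base[OF t, of \<omega>] by simp
  qed (use C order_trans[OF abs_ge_zero C(1)[of 0]] in auto)
qed

lemma mean_rate_integrand_measurable:
  assumes "test_function f f'" "0 < t"
  shows "(\<lambda>\<omega>. f' (R t \<omega>) * (R t \<omega> / D (R t \<omega>) \<omega>)) \<in> borel_measurable M"
proof -
  note [measurable] = R_measurable[OF less_imp_le[OF assms(2)]]
  have [measurable]: "f' \<in> borel_measurable borel"
    using assms by (intro borel_measurable_continuous_onI continuous_at_imp_continuous_on) (auto simp: test_function_def)
  show ?thesis by measurable
qed

lemma test_function_measurable: "test_function f f' \<Longrightarrow> f \<in> borel_measurable borel"
  unfolding test_function_def
  by (intro borel_measurable_continuous_onI continuous_at_imp_continuous_on) (auto intro: DERIV_isCont)

lemma integrable_test_function_R: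
  assumes "test_function f f'" "0 \<le> t"
  shows "integrable M (\<lambda>\<omega>. f (R t \<omega>))"
proof -
  note [measurable] = R_measurable[OF assms(2)] test_function_measurable[OF assms(1)]
  obtain C where "\<And>x. 0 \<le> x \<Longrightarrow> \<bar>f x\<bar> \<le> C" using assms unfolding test_function_def by blast
  then show ?thesis using R_nonneg[OF assms(2)] by (intro integrable_const_bound[of _ C]) auto
qed

lemma has_real_derivative_mean:
  assumes f: "test_function f f'" and t: "0 < t"
  shows "(mean f has_real_derivative mean_rate f' t) (at t)"
proof -
  obtain C where C: "\<And>t \<omega>. 0 < t \<Longrightarrow> \<bar>f' (R t \<omega>) * (R t \<omega> / D (R t \<omega>) \<omega>)\<bar> \<le> C / t" "0 \<le> C"
    using mean_rate_integrand_bound[OF f] by metis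
  show ?thesis
    unfolding mean_def[abs_def] mean_rate_def
  proof (rule has_real_derivative_integral[where a="t / 2" and B="C / (t / 2)"])
    fix s assume s: "t / 2 < s"
    with t show "integrable M (\<lambda>\<omega>. f (R s \<omega>))" by (intro integrable_test_function_R[OF f]) auto
    fix \<omega>
    show "((\<lambda>s. f (R s \<omega>)) has_real_derivative f' (R s \<omega>) * (R s \<omega> / D (R s \<omega>) \<omega>)) (at s)"
      using f s t unfolding test_function_def by (intro DERIV_chain2[OF _ has_real_derivative_R]) auto
    have "C / s \<le> C / (t / 2)" using s t C(2) by (intro divide_left_mono) auto
    then show "\<bar>f' (R s \<omega>) * (R s \<omega> / D (R s \<omega>) \<omega>)\<bar> \<le> C / (t / 2)"
      using C(1)[of s \<omega>] s t by linarith
  qed (use t mean_rate_integrand_measurable[OF f] in auto)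
qed

lemma isCont_mean_rate:
  assumes f: "test_function f f'" and t: "0 < t"
  shows "isCont (mean_rate f') t"
proof -
  obtain C where C: "\<And>t \<omega>. 0 < t \<Longrightarrow> \<bar>f' (R t \<omega>) * (R t \<omega> / D (R t \<omega>) \<omega>)\<bar> \<le> C / t" "0 \<le> C"
    using mean_rate_integrand_bound[OF f] by metis
  show ?thesis
    unfolding mean_rate_def[abs_def]
  proof (rule isCont_integral[where a="t / 2" and w="\<lambda>_. C / (t / 2)"])
    fix \<omega>
    have "isCont (\<lambda>t. R t \<omega>) t" using has_real_derivative_R[OF t] by (rule DERIV_isCont)
    then have "isCont (\<lambda>s. f' (R s \<omega>)) t"
      by (rule isCont_o2) (use f in \<open>simp add: test_function_def\<close>)
    moreover have "isCont (\<lambda>t. R t \<omega> / D (R t \<omega>) \<omega>) t"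
      using power_mixture.isCont_mix_inv_deriv[OF power_mixture_Y t] by (simp add: R_def[abs_def] D_def[abs_def])
    ultimately show "isCont (\<lambda>s. f' (R s \<omega>) * (R s \<omega> / D (R s \<omega>) \<omega>)) t"
      by (rule isCont_mult)
    fix s assume s: "t / 2 < s"
    have "C / s \<le> C / (t / 2)" using s t C(2) by (intro divide_left_mono) auto
    then show "\<bar>f' (R s \<omega>) * (R s \<omega> / D (R s \<omega>) \<omega>)\<bar> \<le> C / (t / 2)"
      using C(1)[of s \<omega>] s t by linarith
  qed (use t mean_rate_integrand_measurable[OF f] in auto)
qed

text \<open>The singularity at \<open>0\<close> is integrable for every single \<open>j\<close>, and this makes the Caputo derivatives of
  all orders below \<open>1\<close> exist.\<close>

lemma mean_rate_bound:
  assumes f: "test_function f f'" and j: "j \<in> J"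
  obtains K where "0 \<le> K" "\<And>t. 0 < t \<Longrightarrow> \<bar>mean_rate f' t\<bar> \<le> K * t powr (\<nu> j - 1)"
proof -
  obtain C where C: "\<And>t \<omega>. 0 < t \<Longrightarrow> \<bar>f' (R t \<omega>) * (R t \<omega> / D (R t \<omega>) \<omega>)\<bar> \<le> C * R t \<omega> / t" "0 \<le> C"
    using mean_rate_integrand_bound[OF f] by metis
  show ?thesis
  proof (rule that[of "C * (exp 1 / \<mu> j)"])
    fix t :: real assume t: "0 < t"
    have "\<bar>mean_rate f' t\<bar> \<le> expectation (\<lambda>\<omega>. \<bar>f' (R t \<omega>) * (R t \<omega> / D (R t \<omega>) \<omega>)\<bar>)"
      unfolding mean_rate_def by (rule integral_abs_bound)
    also have "\<dots> \<le> expectation (\<lambda>\<omega>. C / t * R t \<omega>)"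
    proof (rule integral_mono)
      show int: "integrable M (\<lambda>\<omega>. C / t * R t \<omega>)" using expectation_R_le(1)[OF t] by simp
      show "integrable M (\<lambda>\<omega>. \<bar>f' (R t \<omega>) * (R t \<omega> / D (R t \<omega>) \<omega>)\<bar>)"
      proof (rule Bochner_Integration.integrable_bound[OF int])
        show "AE \<omega> in M. norm \<bar>f' (R t \<omega>) * (R t \<omega> / D (R t \<omega>) \<omega>)\<bar> \<le> norm (C / t * R t \<omega>)"
        proof (intro AE_I2)
          fix \<omega>
          have "C * R t \<omega> / t \<le> \<bar>C / t * R t \<omega>\<bar>"
            using abs_ge_self[of "C / t * R t \<omega>"] by (simp only: times_divide_eq_left)
          with C(1)[OF t, of \<omega>] show "norm \<bar>f' (R t \<omega>) * (R t \<omega> / D (R t \<omega>) \<omega>)\<bar> \<le> norm (C / t * R t \<omega>)"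
            unfolding real_norm_def abs_abs by linarith
        qed
      qed (use mean_rate_integrand_measurable[OF f t] in measurable)
    qed (use C(1)[OF t] in simp)
    also have "\<dots> \<le> C / t * (exp 1 / \<mu> j * t powr \<nu> j)"
      using expectation_R_le_powr[OF j t] C(2) t by (simp only: integral_mult_right_zero) (intro mult_left_mono, auto)
    also have "\<dots> = C * (exp 1 / \<mu> j) * t powr (\<nu> j - 1)"
      using t by (simp add: powr_diff mult_ac)
    finally show "\<bar>mean_rate f' t\<bar> \<le> C * (exp 1 / \<mu> j) * t powr (\<nu> j - 1)" .
  qed (use C(2) \<mu>_pos[OF j] in simp)
qed

lemma mean_tendsto_0:
  assumes f: "test_function f f'"
  shows "(mean f \<longlongrightarrow> f 0) (at_right 0)"
proof -
  obtain C where C: "\<And>x. 0 \<le> x \<Longrightarrow> \<bar>f' x\<bar> \<le> C" "0 \<le> C"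
    using mean_rate_integrand_bound[OF f] by metis
  obtain j where j: "j \<in> J" using J_ne by auto
  have lip: "\<bar>f x - f 0\<bar> \<le> C * x" if "0 \<le> x" for x
  proof (cases "x = 0")
    case False
    with that have "0 < x" by simp
    from MVT2[OF this, of f f'] f obtain y where "0 < y" "f x - f 0 = (x - 0) * f' y"
      unfolding test_function_def by auto
    then show ?thesis using C(1)[of y] \<open>0 < x\<close> by (simp add: abs_mult mult.commute)
  qed simp
  have "((\<lambda>t. mean f t - f 0) \<longlongrightarrow> 0) (at_right 0)"
  proof (rule Lim_null_comparison)
    show "eventually (\<lambda>t. norm (mean f t - f 0) \<le> C * (exp 1 / \<mu> j * t powr \<nu> j)) (at_right 0)"
      using eventually_at_right_less[of 0]
    proof eventually_elim
      case (elim t)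
      have "mean f t - f 0 = expectation (\<lambda>\<omega>. f (R t \<omega>) - f 0)"
        using integrable_test_function_R[OF f] elim by (simp add: mean_def prob_space)
      also have "\<bar>\<dots>\<bar> \<le> expectation (\<lambda>\<omega>. \<bar>f (R t \<omega>) - f 0\<bar>)" by (rule integral_abs_bound)
      also have "\<dots> \<le> expectation (\<lambda>\<omega>. C * R t \<omega>)"
        using integrable_test_function_R[OF f, of t] elim expectation_R_le(1)[OF elim] lip[OF R_nonneg[of t]]
        by (intro integral_mono) auto
      also have "\<dots> \<le> C * (exp 1 / \<mu> j * t powr \<nu> j)"
        using expectation_R_le_powr[OF j elim] C(2) by (simp only: integral_mult_right_zero) (intro mult_left_mono, auto)
      finally show ?case by simp
    qed
    have "((\<lambda>t. C * (exp 1 / \<mu> j * t powr \<nu> j)) \<longlongrightarrow> C * (exp 1 / \<mu> j * 0 powr \<nu> j)) (at_right 0)"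
      using order[OF j] by (intro tendsto_intros tendsto_powr') (auto simp: eventually_at_filter)
    then show "((\<lambda>t. C * (exp 1 / \<mu> j * t powr \<nu> j)) \<longlongrightarrow> 0) (at_right 0)" by simp
  qed
  then show ?thesis by (rule LIM_zero_cancel)
qed

end

section \<open>Fractional derivatives of the means\<close>

text \<open>The substitution \<open>s = t * \<theta>\<close> moves the dependence on \<open>t\<close> from the domain of integration into the
  integrand, where it can be dominated by the Beta density with parameters \<open>\<alpha>\<close> and \<open>1 - \<beta>\<close>.\<close>

lemma
  fixes v :: "real \<Rightarrow> real"
  assumes cont: "\<And>s. s > 0 \<Longrightarrow> isCont v s"
    and bound: "\<And>s. s > 0 \<Longrightarrow> \<bar>v s\<bar> \<le> K * s powr (\<alpha> - 1)"
    and "0 < \<alpha>" "\<alpha> \<le> 1" "\<beta> < 1" "t > 0"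
  shows set_integrable_fractional_integral: "set_integrable lborel {0<..<t} (\<lambda>s. v s / (t - s) powr \<beta>)"
    and isCont_fractional_integral: "isCont (\<lambda>t. LINT s:{0<..<t}|lborel. v s / (t - s) powr \<beta>) t"
proof -
  define h where "h t \<theta> = indicator {0<..<1} \<theta> * (v (t * \<theta>) / (1 - \<theta>) powr \<beta>)" for t \<theta> :: real
  define w where "w \<theta> = indicator {0<..<1} \<theta> * (\<theta> powr (\<alpha> - 1) * (1 - \<theta>) powr (- \<beta>))" for \<theta> :: real
  have w_int: "integrable lborel w"
  proof -
    have "set_integrable lborel {0..1} (\<lambda>\<theta>. \<theta> powr (\<alpha> - 1) * (1 - \<theta>) powr ((1 - \<beta>) - 1))"
      using assms by (intro integrable_Beta) auto
    then have "set_integrable lborel {0<..<1} (\<lambda>\<theta>. \<theta> powr (\<alpha> - 1) * (1 - \<theta>) powr ((1 - \<beta>) - 1))"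
      by (rule set_integrable_subset) auto
    then show ?thesis by (simp add: set_integrable_def w_def[abs_def])
  qed
  have K: "0 \<le> K" using order_trans[OF abs_ge_zero bound[of 1]] by simp
  have h_meas: "h t \<in> borel_measurable lborel" if "t > 0" for t
  proof -
    have "(\<lambda>\<theta>. indicator {0<..<1} \<theta> *\<^sub>R (v (t * \<theta>) / (1 - \<theta>) powr \<beta>)) \<in> borel_measurable borel"
      using that
      by (intro borel_measurable_continuous_on_indicator continuous_at_imp_continuous_on ballI
            continuous_intros isCont_o2[OF _ cont]) auto
    then show ?thesis by (simp add: h_def[abs_def])
  qed
  have h_bound: "\<bar>h s \<theta>\<bar> \<le> K * a powr (\<alpha> - 1) * w \<theta>" if "a \<le> s" "0 < a" for s a \<theta>
  proof (cases "\<theta> \<in> {0<..<1}")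
    case True
    then have "\<bar>v (s * \<theta>)\<bar> \<le> K * (s * \<theta>) powr (\<alpha> - 1)" using bound[of "s * \<theta>"] that by simp
    also have "\<dots> = K * (s powr (\<alpha> - 1) * \<theta> powr (\<alpha> - 1))" using True that by (simp add: powr_mult)
    also have "\<dots> \<le> K * (a powr (\<alpha> - 1) * \<theta> powr (\<alpha> - 1))"
      using that K assms by (intro mult_left_mono mult_right_mono powr_mono2') auto
    finally have "\<bar>v (s * \<theta>)\<bar> * (1 - \<theta>) powr (- \<beta>)
        \<le> K * (a powr (\<alpha> - 1) * \<theta> powr (\<alpha> - 1)) * (1 - \<theta>) powr (- \<beta>)"
      by (intro mult_right_mono) auto
    then show ?thesis using True by (simp add: h_def w_def abs_mult powr_minus divide_inverse mult_ac)
  qed (simp add: h_def w_def)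
  have h_int: "integrable lborel (h t)" if "t > 0" for t
  proof (rule Bochner_Integration.integrable_bound)
    show "integrable lborel (\<lambda>\<theta>. K * t powr (\<alpha> - 1) * w \<theta>)" using w_int by simp
    show "AE \<theta> in lborel. norm (h t \<theta>) \<le> norm (K * t powr (\<alpha> - 1) * w \<theta>)"
      using h_bound[of t t] that by (intro AE_I2) (simp add: order_trans[OF _ abs_ge_self])
  qed (rule h_meas[OF that])
  have scale: "indicator {0<..<t} (0 + t * \<theta>) *\<^sub>R (v (0 + t * \<theta>) / (t - (0 + t * \<theta>)) powr \<beta>) = t powr (- \<beta>) * h t \<theta>"
    if "t > 0" for t \<theta>
  proof -
    have "t - t * \<theta> = t * (1 - \<theta>)" by (simp add: algebra_simps)
    then have "(t - t * \<theta>) powr \<beta> = t powr \<beta> * (1 - \<theta>) powr \<beta>" using that by (simp add: powr_mult)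
    then show ?thesis
      using that by (auto simp: h_def indicator_def powr_minus divide_inverse zero_less_mult_iff)
  qed
  show "set_integrable lborel {0<..<t} (\<lambda>s. v s / (t - s) powr \<beta>)"
  proof -
    have "integrable lborel (\<lambda>\<theta>. t powr (- \<beta>) * h t \<theta>)" using h_int \<open>t > 0\<close> by simp
    then show ?thesis
      unfolding set_integrable_def scale[OF \<open>t > 0\<close>, symmetric]
      using lborel_integrable_real_affine_iff[of t _ 0] \<open>t > 0\<close> by blast
  qed
  have eq: "(LINT s:{0<..<t}|lborel. v s / (t - s) powr \<beta>) = t powr (1 - \<beta>) * (\<integral>\<theta>. h t \<theta> \<partial>lborel)" if "t > 0" for t
  proof -
    have "(LINT s:{0<..<t}|lborel. v s / (t - s) powr \<beta>) = t * (t powr (- \<beta>) * (\<integral>\<theta>. h t \<theta> \<partial>lborel))"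
      unfolding set_lebesgue_integral_def
      by (subst lborel_integral_real_affine[of t _ 0]) (use that scale[OF that] in auto)
    then show ?thesis using that by (simp add: powr_diff powr_minus divide_inverse)
  qed
  have "isCont (\<lambda>t. \<integral>\<theta>. h t \<theta> \<partial>lborel) t"
  proof (rule isCont_integral[where a="t / 2" and w="\<lambda>\<theta>. K * (t / 2) powr (\<alpha> - 1) * w \<theta>"])
    show "isCont (\<lambda>s. h s \<theta>) t" for \<theta>
    proof (cases "\<theta> \<in> {0<..<1}")
      case True
      then show ?thesis unfolding h_def[abs_def] using \<open>t > 0\<close>
        by (intro continuous_intros isCont_o2[OF _ cont]) auto
    qed (simp add: h_def[abs_def])
  qed (use \<open>t > 0\<close> h_meas h_bound[of "t / 2"] w_int in auto)
  then have c: "isCont (\<lambda>t. t powr (1 - \<beta>) * (\<integral>\<theta>. h t \<theta> \<partial>lborel)) t"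
    using \<open>t > 0\<close> by (intro continuous_intros) auto
  have "eventually (\<lambda>s. 0 < s) (nhds t)" using \<open>t > 0\<close> eventually_nhds_in_open[of "{0<..}" t] by simp
  then have "eventually (\<lambda>s. (LINT u:{0<..<s}|lborel. v u / (s - u) powr \<beta>) = s powr (1 - \<beta>) * (\<integral>\<theta>. h s \<theta> \<partial>lborel)) (nhds t)"
    by eventually_elim (rule eq)
  then show "isCont (\<lambda>t. LINT s:{0<..<t}|lborel. v s / (t - s) powr \<beta>) t"
    using c by (subst isCont_cong) auto
qed

context stable_mixture begin

text \<open>The tail probability is written as an integral over \<open>\<omega>\<close>, in the form in which it is jointly
  measurable in \<open>x\<close> and \<open>t\<close>.\<close>

lemma mean_eq_tail:
  assumes f: "test_function f f'" and t: "0 < t"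
  shows "mean f t = f 0 + (LINT x:{0<..}|lborel. f' x * (\<integral>\<omega>. (if Z x \<omega> < t then 1 else 0) \<partial>M))"
proof -
  have "mean f t = f 0 + (LINT x:{0<..}|lborel. f' x * prob {\<omega> \<in> space M. x < R t \<omega>})"
    unfolding mean_def
  proof (rule expectation_tail_formula)
    show "0 \<le> R t \<omega>" for \<omega> using R_nonneg t by simp
    show "R t \<in> borel_measurable M" using R_measurable t by simp
  qed (use f in \<open>auto simp: test_function_def\<close>)
  also have "(LINT x:{0<..}|lborel. f' x * prob {\<omega> \<in> space M. x < R t \<omega>})
      = (LINT x:{0<..}|lborel. f' x * (\<integral>\<omega>. (if Z x \<omega> < t then 1 else 0) \<partial>M))"
  proof (rule set_lebesgue_integral_cong)
    show "\<forall>x. x \<in> {0<..} \<longrightarrow> f' x * prob {\<omega> \<in> space M. x < R t \<omega>} = f' x * (\<integral>\<omega>. (if Z x \<omega> < t then 1 else 0) \<partial>M)"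
    proof (intro allI impI)
      fix x :: real assume "x \<in> {0<..}"
      then have "{\<omega> \<in> space M. x < R t \<omega>} = {\<omega> \<in> space M. Z x \<omega> < t}"
        using less_R_iff[of t x] t by auto
      moreover have "(\<integral>\<omega>. (if Z x \<omega> < t then 1 else 0 :: real) \<partial>M) = (\<integral>\<omega>. indicator {\<omega> \<in> space M. Z x \<omega> < t} \<omega> \<partial>M)"
        by (intro Bochner_Integration.integral_cong) (auto simp: indicator_def)
      moreover have "(\<integral>\<omega>. indicator {\<omega> \<in> space M. Z x \<omega> < t} \<omega> \<partial>M) = prob {\<omega> \<in> space M. Z x \<omega> < t}"
        by (simp add: Int_absorb1 Collect_conj_eq)
      ultimately show "f' x * prob {\<omega> \<in> space M. x < R t \<omega>} = f' x * (\<integral>\<omega>. (if Z x \<omega> < t then 1 else 0) \<partial>M)"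
        by (simp only:)
    qed
  qed simp
  finally show ?thesis .
qed

lemma mean_bounded:
  assumes f: "test_function f f'"
  obtains C where "\<And>t. 0 \<le> t \<Longrightarrow> \<bar>mean f t\<bar> \<le> C"
proof -
  obtain C where C: "\<And>x. 0 \<le> x \<Longrightarrow> \<bar>f x\<bar> \<le> C" using f unfolding test_function_def by blast
  have "\<bar>mean f t\<bar> \<le> C" if "0 \<le> t" for t
  proof -
    have "\<bar>mean f t\<bar> \<le> expectation (\<lambda>\<omega>. \<bar>f (R t \<omega>)\<bar>)" unfolding mean_def by (rule integral_abs_bound)
    also have "\<dots> \<le> expectation (\<lambda>\<omega>. C)"
      using integrable_test_function_R[OF f that] C R_nonneg[OF that] by (intro integral_mono) auto
    finally show ?thesis by (simp add: prob_space)
  qed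
  then show ?thesis by (rule that)
qed

lemma isCont_mean: "test_function f f' \<Longrightarrow> 0 < t \<Longrightarrow> isCont (mean f) t"
  using has_real_derivative_mean by (blast intro: DERIV_isCont)

lemma set_integrable_laplace_mean:
  assumes f: "test_function f f'" and z: "0 < z"
  shows "set_integrable lborel {0<..} (\<lambda>t. exp (- z * t) * mean f t)"
proof -
  obtain C where "\<And>t. 0 \<le> t \<Longrightarrow> \<bar>mean f t\<bar> \<le> C" using mean_bounded[OF f] by blast
  then show ?thesis by (intro set_integrable_exp_bounded[where C=C] isCont_mean[OF f] z) auto
qed

lemma test_function_by_parts:
  assumes f: "test_function f f'" and c: "0 < c"
  shows "(LINT x:{0<..}|lborel. exp (- c * x) * f' x) = c * (LINT x:{0<..}|lborel. exp (- c * x) * f x) - f 0"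
proof -
  obtain C where C: "\<And>x. 0 \<le> x \<Longrightarrow> \<bar>f x\<bar> \<le> C \<and> \<bar>f' x\<bar> \<le> C" using f unfolding test_function_def by blast
  show ?thesis
  proof (rule laplace_integral_by_parts[OF _ _ _ _ _ c])
    show "set_integrable lborel {0<..} (\<lambda>x. exp (- c * x) * f' x)"
      using f C by (intro set_integrable_exp_bounded[where C=C] c) (auto simp: test_function_def)
    have "isCont f 0" using f unfolding test_function_def by (blast intro: DERIV_isCont)
    then show "(f \<longlongrightarrow> f 0) (at_right 0)"
      unfolding isCont_def by (rule filterlim_mono) (auto simp: at_within_le_at)
    show "\<bar>f x\<bar> \<le> C" if "0 < x" for x using C[of x] that by simp
  qed (use f in \<open>auto simp: test_function_def\<close>)
qed

lemma laplace_prob_Z_less: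
  assumes "0 < x" "0 < z"
  shows "(\<integral>t. indicator {0<..} t * exp (- z * t) * (\<integral>\<omega>. (if Z x \<omega> < t then 1 else 0) \<partial>M) \<partial>lborel)
    = exp (- symbol z * x) / z"
proof -
  interpret pair_sigma_finite lborel M ..
  define F where "F t \<omega> = indicator {0<..} t * exp (- z * t) * (if Z x \<omega> < t then 1 else 0 :: real)" for t \<omega>
  have "(\<integral>t. (\<integral>\<omega>. F t \<omega> \<partial>M) \<partial>lborel) = (\<integral>\<omega>. (\<integral>t. F t \<omega> \<partial>lborel) \<partial>M)"
  proof (rule Fubini_dominated(2))
    show "integrable lborel (\<lambda>t. indicator {0<..} t * exp (- z * t))"
      using integrable_exp_halfline(1)[OF assms(2)] by (simp add: set_integrable_def)
    show "integrable M (\<lambda>_. 1 :: real)" by simp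
    show "(\<lambda>(t, \<omega>). F t \<omega>) \<in> borel_measurable (lborel \<Otimes>\<^sub>M M)"
      unfolding F_def[abs_def] by measurable
  qed (auto simp: F_def)
  also have "\<dots> = (\<integral>\<omega>. exp (- z * Z x \<omega>) / z \<partial>M)"
  proof (rule Bochner_Integration.integral_cong[OF refl])
    fix \<omega>
    show "(\<integral>t. F t \<omega> \<partial>lborel) = exp (- z * Z x \<omega>) / z"
      using integrable_exp_halfline(2)[OF assms(2) Z_nonneg[of x \<omega>]] assms(1)
      unfolding set_lebesgue_integral_def F_def by (simp add: indicator_def of_bool_def mult.assoc)
  qed
  also have "\<dots> = exp (- symbol z * x) / z" using laplace_Z[of x z] assms by simp
  finally show ?thesis by (simp add: F_def)
qed

text \<open>Insert the tail formula and exchange the integrals. For fixed \<open>x\<close> the integral over \<open>t\<close> is the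
  Laplace transform of the distribution function of \<open>Z x\<close>, that is, \<open>exp (- symbol z * x) / z\<close>. The
  remaining integral of \<open>exp (- symbol z * x) * f' x\<close> is integrated by parts.\<close>

lemma laplace_mean:
  assumes f: "test_function f f'" and z: "0 < z"
  shows "(LINT t:{0<..}|lborel. exp (- z * t) * mean f t)
    = symbol z / z * (LINT x:{0<..}|lborel. exp (- symbol z * x) * f x)"
proof -
  define G where "G x t = (\<integral>\<omega>. (if Z x \<omega> < t then 1 else 0 :: real) \<partial>M)" for x t
  define F where "F t x = indicator {0<..} t * exp (- z * t) * (indicator {0<..} x * f' x * G x t)" for t x
  have [measurable]: "f' \<in> borel_measurable borel"
    using f by (intro borel_measurable_continuous_onI continuous_at_imp_continuous_on) (auto simp: test_function_def)
  have G_le: "\<bar>G x t\<bar> \<le> 1" for x t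
  proof -
    have "\<bar>G x t\<bar> \<le> (\<integral>\<omega>. \<bar>if Z x \<omega> < t then 1 else 0 :: real\<bar> \<partial>M)" unfolding G_def by (rule integral_abs_bound)
    also have "\<dots> \<le> (\<integral>\<omega>. 1 \<partial>M)"
      by (intro integral_mono integrable_const_bound[of _ 1]) auto
    finally show ?thesis by (simp add: prob_space)
  qed
  have g: "integrable lborel (\<lambda>t. indicator {0<..} t * exp (- z * t))"
    using integrable_exp_halfline(1)[OF z] by (simp add: set_integrable_def)
  have h: "integrable lborel (\<lambda>x. \<bar>indicator {0<..} x * f' x\<bar>)"
    using f by (simp add: set_integrable_def test_function_def)
  have meas: "(\<lambda>(t, x). F t x) \<in> borel_measurable (lborel \<Otimes>\<^sub>M lborel)"
    unfolding F_def[abs_def] G_def by measurable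
  have bound: "\<bar>F t x\<bar> \<le> indicator {0<..} t * exp (- z * t) * \<bar>indicator {0<..} x * f' x\<bar>" for t x
  proof -
    have "\<bar>indicator {0<..} x * f' x\<bar> * \<bar>G x t\<bar> \<le> \<bar>indicator {0<..} x * f' x\<bar>"
      using G_le[of x t] by (intro mult_left_le) auto
    then show ?thesis unfolding F_def by (auto simp: abs_mult indicator_def)
  qed
  note fub = lborel_pair.Fubini_dominated[OF g h meas bound]
  have inner_x: "(\<integral>x. F t x \<partial>lborel) = indicator {0<..} t *\<^sub>R (exp (- z * t) * mean f t - exp (- z * t) * f 0)" for t
  proof (cases "0 < t")
    case True
    have "(\<integral>x. F t x \<partial>lborel) = exp (- z * t) * (LINT x:{0<..}|lborel. f' x * G x t)"
      unfolding F_def set_lebesgue_integral_def integral_mult_right_zero using True by (simp add: mult.assoc)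
    then show ?thesis using mean_eq_tail[OF f True] True by (simp add: G_def algebra_simps)
  qed (simp add: F_def)
  have inner_t: "(\<integral>t. F t x \<partial>lborel) = indicator {0<..} x *\<^sub>R (exp (- symbol z * x) * f' x / z)" for x
  proof (cases "0 < x")
    case True
    have "(\<integral>t. F t x \<partial>lborel) = (\<integral>t. f' x * (indicator {0<..} t * exp (- z * t) * G x t) \<partial>lborel)"
      using True by (intro Bochner_Integration.integral_cong) (auto simp: F_def)
    also have "\<dots> = f' x * (exp (- symbol z * x) / z)"
      unfolding integral_mult_right_zero using laplace_prob_Z_less[OF True z] by (simp add: G_def)
    finally show ?thesis using True by simp
  qed (simp add: F_def)
  have "(LINT t:{0<..}|lborel. exp (- z * t) * mean f t - exp (- z * t) * f 0)
      = (LINT x:{0<..}|lborel. exp (- symbol z * x) * f' x / z)"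
    using fub(2) unfolding inner_x inner_t by (simp only: set_lebesgue_integral_def)
  moreover have "(LINT t:{0<..}|lborel. exp (- z * t) * mean f t - exp (- z * t) * f 0)
      = (LINT t:{0<..}|lborel. exp (- z * t) * mean f t) - f 0 / z"
  proof -
    have "(LINT t:{0<..}|lborel. exp (- z * t) * f 0) = f 0 / z"
    proof -
      have "(LINT t:{0<..}|lborel. exp (- z * t)) = (LINT t:{0<..}|lborel. exp (- z * t) * indicator {0<..} t)"
        unfolding set_lebesgue_integral_def by (intro Bochner_Integration.integral_cong) (auto simp: indicator_def)
      then show ?thesis using integrable_exp_halfline(2)[OF z, of 0] by simp
    qed
    then show ?thesis
      using set_integrable_laplace_mean[OF f z] integrable_exp_halfline(1)[OF z]
      by (subst set_integral_diff) auto
  qed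
  ultimately have "(LINT t:{0<..}|lborel. exp (- z * t) * mean f t)
      = (f 0 + (LINT x:{0<..}|lborel. exp (- symbol z * x) * f' x)) / z"
    by (simp add: add_divide_distrib)
  then show ?thesis using test_function_by_parts[OF f symbol_pos[OF z]] by simp
qed

text \<open>Integration by parts in \<open>t\<close>, followed by integration by parts in \<open>x\<close> in the opposite direction; the
  terms \<open>f 0\<close> cancel.\<close>

lemma laplace_mean_rate:
  assumes f: "test_function f f'" and z: "0 < z"
  shows "set_integrable lborel {0<..} (\<lambda>t. exp (- z * t) * mean_rate f' t)"
    and "(LINT t:{0<..}|lborel. exp (- z * t) * mean_rate f' t)
      = (LINT x:{0<..}|lborel. exp (- symbol z * x) * f' x)"
proof -
  obtain j where j: "j \<in> J" using J_ne by auto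
  obtain K where K: "0 \<le> K" "\<And>t. 0 < t \<Longrightarrow> \<bar>mean_rate f' t\<bar> \<le> K * t powr (\<nu> j - 1)"
    using mean_rate_bound[OF f j] by blast
  show int: "set_integrable lborel {0<..} (\<lambda>t. exp (- z * t) * mean_rate f' t)"
  proof (rule set_integrable_bound)
    show "set_integrable lborel {0<..} (\<lambda>t. K * (exp (- z * t) * t powr (- (1 - \<nu> j))))"
      using order[OF j] z by (intro set_integrable_mult_right gamma_kernel_laplace(1)) auto
    have "(\<lambda>t. indicator {0<..} t *\<^sub>R (exp (- z * t) * mean_rate f' t)) \<in> borel_measurable borel"
      by (intro borel_measurable_continuous_on_indicator continuous_at_imp_continuous_on ballI
            continuous_intros isCont_mean_rate[OF f]) auto
    then show "set_borel_measurable lborel {0<..} (\<lambda>t. exp (- z * t) * mean_rate f' t)"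
      by (simp add: set_borel_measurable_def)
    show "AE t in lborel. t \<in> {0<..} \<longrightarrow>
        norm (exp (- z * t) * mean_rate f' t) \<le> norm (K * (exp (- z * t) * t powr (- (1 - \<nu> j))))"
      using K by (intro AE_I2) (auto simp: abs_mult mult.left_commute[of K])
  qed
  obtain C where C: "\<And>t. 0 \<le> t \<Longrightarrow> \<bar>mean f t\<bar> \<le> C" using mean_bounded[OF f] by blast
  have "(LINT t:{0<..}|lborel. exp (- z * t) * mean_rate f' t) = z * (LINT t:{0<..}|lborel. exp (- z * t) * mean f t) - f 0"
    by (rule laplace_integral_by_parts[where C=C, OF has_real_derivative_mean[OF f] isCont_mean_rate[OF f] _ int mean_tendsto_0[OF f] z])
       (use C in auto)
  then show "(LINT t:{0<..}|lborel. exp (- z * t) * mean_rate f' t)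
      = (LINT x:{0<..}|lborel. exp (- symbol z * x) * f' x)"
    using test_function_by_parts[OF f symbol_pos[OF z]] laplace_mean[OF f z] z by simp
qed

lemma deriv_mean: "test_function f f' \<Longrightarrow> 0 < t \<Longrightarrow> deriv (mean f) t = mean_rate f' t"
  by (intro DERIV_imp_deriv has_real_derivative_mean)

lemma caputo_deriv_mean:
  assumes "test_function f f'"
  shows "caputo_deriv \<beta> (mean f) t = 1 / Gamma (1 - \<beta>) * (LINT s:{0<..<t}|lborel. mean_rate f' s / (t - s) powr \<beta>)"
  unfolding caputo_deriv_def using deriv_mean[OF assms]
  by (intro arg_cong2[where f="(*)"] refl set_lebesgue_integral_cong) auto

lemma caputo_exists_mean:
  assumes f: "test_function f f'" and "\<beta> < 1" "0 < t"
  shows "caputo_exists \<beta> (mean f) t"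
proof -
  obtain j where j: "j \<in> J" using J_ne by auto
  obtain K where K: "0 \<le> K" "\<And>t. 0 < t \<Longrightarrow> \<bar>mean_rate f' t\<bar> \<le> K * t powr (\<nu> j - 1)"
    using mean_rate_bound[OF f j] by blast
  have "set_integrable lborel {0<..<t} (\<lambda>s. mean_rate f' s / (t - s) powr \<beta>)"
    using order[OF j] assms by (intro set_integrable_fractional_integral[OF isCont_mean_rate[OF f] K(2)]) auto
  then have "set_integrable lborel {0<..<t} (\<lambda>s. deriv (mean f) s / (t - s) powr \<beta>)"
    using deriv_mean[OF f] by (subst set_integrable_cong[OF refl refl]) auto
  moreover have "mean f field_differentiable at s" if "s \<in> {0<..<t}" for s
    unfolding field_differentiable_def using has_real_derivative_mean[OF f, of s] that by (intro exI) auto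
  ultimately show ?thesis by (simp add: caputo_exists_def)
qed

text \<open>The weighted sum of Caputo derivatives along the inverse process acts as ordinary differentiation
  of \<open>f\<close>. The second derivative \<open>f''\<close> occurs only because the right-hand side is itself the mean of
  a test function, which gives its continuity and its Laplace transform.\<close>

lemma caputo_mean:
  assumes f: "test_function f f'" and f': "test_function f' f''" and t: "0 < t"
  shows "(\<Sum>j\<in>J. \<mu> j * caputo_deriv (\<nu> j) (mean f) t) = mean f' t"
proof -
  define I where "I j t = (LINT s:{0<..<t}|lborel. mean_rate f' s / (t - s) powr \<nu> j)" for j t
  \<comment> \<open>The difference of the two sides is continuous and has Laplace transform \<open>0\<close>.\<close>
  define w where "w t = (\<Sum>j\<in>J. \<mu> j / Gamma (1 - \<nu> j) * I j t) - mean f' t" for t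
  have Gamma_pos: "0 < Gamma (1 - \<nu> j)" if "j \<in> J" for j
    using order[OF that] by (intro Gamma_real_pos) auto
  have "w t = 0"
  proof (rule laplace_transform_zero_imp_zero[OF _ _ _ t])
    have "isCont (I j) t" if j: "j \<in> J" and "t > 0" for j t
    proof -
      obtain K where K: "0 \<le> K" "\<And>t. 0 < t \<Longrightarrow> \<bar>mean_rate f' t\<bar> \<le> K * t powr (\<nu> j - 1)"
        using mean_rate_bound[OF f j] by blast
      show ?thesis unfolding I_def[abs_def]
        using order[OF j] that by (intro isCont_fractional_integral[OF isCont_mean_rate[OF f] K(2)]) auto
    qed
    then show "continuous_on {0<..} w"
      unfolding w_def[abs_def]
      by (intro continuous_at_imp_continuous_on ballI continuous_intros isCont_mean[OF f']) auto
    fix z :: real assume z: "0 < z"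
    have I_int: "set_integrable lborel {0<..} (\<lambda>t. exp (- z * t) * I j t)"
      and I_lap: "(LINT t:{0<..}|lborel. exp (- z * t) * I j t)
        = Gamma (1 - \<nu> j) * z powr (\<nu> j - 1) * (LINT x:{0<..}|lborel. exp (- symbol z * x) * f' x)"
      if "j \<in> J" for j
      using laplace_fractional_integral[OF _ z laplace_mean_rate(1)[OF f z], of "\<nu> j"] order[OF that] laplace_mean_rate(2)[OF f z]
      by (simp_all add: I_def)
    have split: "exp (- z * t) * w t = (\<Sum>j\<in>J. \<mu> j / Gamma (1 - \<nu> j) * (exp (- z * t) * I j t)) - exp (- z * t) * mean f' t" for t
      by (simp add: w_def right_diff_distrib sum_distrib_left mult_ac)
    have sum_int: "set_integrable lborel {0<..} (\<lambda>t. \<Sum>j\<in>J. \<mu> j / Gamma (1 - \<nu> j) * (exp (- z * t) * I j t))"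
      unfolding set_integrable_def scaleR_sum_right
      using set_integrable_mult_right[OF I_int] by (intro Bochner_Integration.integrable_sum) (simp add: set_integrable_def)
    show "set_integrable lborel {0<..} (\<lambda>t. exp (- z * t) * w t)"
      unfolding split using sum_int set_integrable_laplace_mean[OF f' z] by (rule set_integral_diff)
    have "(LINT t:{0<..}|lborel. exp (- z * t) * w t)
      = (LINT t:{0<..}|lborel. \<Sum>j\<in>J. \<mu> j / Gamma (1 - \<nu> j) * (exp (- z * t) * I j t)) - (LINT t:{0<..}|lborel. exp (- z * t) * mean f' t)"
      unfolding split using sum_int set_integrable_laplace_mean[OF f' z] by (rule set_integral_diff)
    also have "(LINT t:{0<..}|lborel. \<Sum>j\<in>J. \<mu> j / Gamma (1 - \<nu> j) * (exp (- z * t) * I j t))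
      = (\<Sum>j\<in>J. LINT t:{0<..}|lborel. \<mu> j / Gamma (1 - \<nu> j) * (exp (- z * t) * I j t))"
      unfolding set_lebesgue_integral_def scaleR_sum_right
      using set_integrable_mult_right[OF I_int] by (intro Bochner_Integration.integral_sum) (simp add: set_integrable_def)
    also have "\<dots> = (\<Sum>j\<in>J. \<mu> j * z powr \<nu> j / z * (LINT x:{0<..}|lborel. exp (- symbol z * x) * f' x))"
    proof (rule sum.cong[OF refl])
      fix j assume j: "j \<in> J"
      show "(LINT t:{0<..}|lborel. \<mu> j / Gamma (1 - \<nu> j) * (exp (- z * t) * I j t))
        = \<mu> j * z powr \<nu> j / z * (LINT x:{0<..}|lborel. exp (- symbol z * x) * f' x)"
        using Gamma_pos[OF j] z by (simp only: set_integral_mult_right I_lap[OF j]) (simp add: powr_diff)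
    qed
    also have "\<dots> = symbol z / z * (LINT x:{0<..}|lborel. exp (- symbol z * x) * f' x)"
      by (simp add: symbol_def sum_distrib_right sum_divide_distrib)
    also have "(LINT t:{0<..}|lborel. exp (- z * t) * mean f' t)
      = symbol z / z * (LINT x:{0<..}|lborel. exp (- symbol z * x) * f' x)"
      by (rule laplace_mean[OF f' z])
    finally show "(LINT t:{0<..}|lborel. exp (- z * t) * w t) = 0" by simp
  qed
  then show ?thesis by (simp add: w_def I_def caputo_deriv_mean[OF f])
qed

end

section \<open>Poisson weights\<close>

definition poisson_weight :: "real \<Rightarrow> nat \<Rightarrow> real \<Rightarrow> real" where
  "poisson_weight \<Lambda> k x = (\<Lambda> * x) ^ k / fact k * exp (- \<Lambda> * x)"

definition poisson_weight_deriv :: "real \<Rightarrow> nat \<Rightarrow> real \<Rightarrow> real" where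
  "poisson_weight_deriv \<Lambda> k x = - \<Lambda> * (poisson_weight \<Lambda> k x - (if k = 0 then 0 else poisson_weight \<Lambda> (k - 1) x))"

text \<open>The weights are probabilities.\<close>

lemma poisson_weight_bounds:
  assumes "0 < \<Lambda>" "0 \<le> x"
  shows "0 \<le> poisson_weight \<Lambda> k x" "poisson_weight \<Lambda> k x \<le> 1"
proof -
  show "0 \<le> poisson_weight \<Lambda> k x" using assms by (simp add: poisson_weight_def)
  show "poisson_weight \<Lambda> k x \<le> 1"
  proof (cases "x = 0")
    case False
    then have "poisson_weight \<Lambda> k x = pmf (poisson_pmf (\<Lambda> * x)) k"
      using assms by (simp add: poisson_weight_def)
    then show ?thesis by (simp add: pmf_le_1)
  next
    case True
    then show ?thesis by (cases k) (auto simp: poisson_weight_def)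
  qed
qed

lemma isCont_poisson_weight: "isCont (poisson_weight \<Lambda> k) x"
  unfolding poisson_weight_def[abs_def] by (intro continuous_intros) auto

lemma has_real_derivative_poisson_weight:
  "(poisson_weight \<Lambda> k has_real_derivative poisson_weight_deriv \<Lambda> k x) (at x)"
proof (cases k)
  case 0
  then show ?thesis
    unfolding poisson_weight_def[abs_def] poisson_weight_deriv_def by (auto intro!: derivative_eq_intros)
next
  case (Suc n)
  have lin: "((\<lambda>x. \<Lambda> * x) has_real_derivative \<Lambda>) (at x)" by (auto intro!: derivative_eq_intros)
  have e: "((\<lambda>x. exp (- \<Lambda> * x)) has_real_derivative exp (- \<Lambda> * x) * - \<Lambda>) (at x)"
    by (auto intro!: derivative_eq_intros)
  note D = DERIV_mult[OF DERIV_cdivide[OF DERIV_power[OF lin, of "Suc n"], of "fact (Suc n)"] e]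
  have "real (Suc n) * (\<Lambda> * (\<Lambda> * x) ^ n) / fact (Suc n) = \<Lambda> * ((\<Lambda> * x) ^ n / fact n)"
    by (simp add: fact_Suc del: of_nat_Suc)
  then show ?thesis
    unfolding Suc poisson_weight_def[abs_def] poisson_weight_deriv_def
    by (intro DERIV_cong[OF D]) (simp add: right_diff_distrib mult_ac del: fact_Suc power_Suc of_nat_Suc)
qed

lemma isCont_poisson_weight_deriv: "isCont (poisson_weight_deriv \<Lambda> k) x"
  unfolding poisson_weight_deriv_def[abs_def]
  by (cases k) (auto intro!: continuous_intros isCont_poisson_weight)

text \<open>Half of the exponential decay is used for integrability; the other half makes the power bounded, since what
  remains is \<open>2 ^ k\<close> times a Poisson weight of rate \<open>\<Lambda> / 2\<close>.\<close>

lemma set_integrable_poisson_weight: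
  assumes "0 < \<Lambda>" shows "set_integrable lborel {0<..} (poisson_weight \<Lambda> k)"
proof -
  have "set_integrable lborel {0<..} (\<lambda>x. exp (- (\<Lambda> / 2) * x) * (2 ^ k * poisson_weight (\<Lambda> / 2) k x))"
  proof (rule set_integrable_exp_bounded[where C="2 ^ k"])
    show "isCont (\<lambda>x. 2 ^ k * poisson_weight (\<Lambda> / 2) k x) x" for x
      by (intro continuous_intros isCont_poisson_weight)
    show "\<bar>2 ^ k * poisson_weight (\<Lambda> / 2) k x\<bar> \<le> 2 ^ k" if "0 < x" for x
      using poisson_weight_bounds[of "\<Lambda> / 2" x k] assms that by (simp add: abs_mult)
  qed (use assms in simp)
  moreover have "exp (- (\<Lambda> / 2) * x) * (2 ^ k * poisson_weight (\<Lambda> / 2) k x) = poisson_weight \<Lambda> k x" for x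
  proof -
    have "exp (- (\<Lambda> / 2) * x) * exp (- (\<Lambda> / 2) * x) = exp (- \<Lambda> * x)" by (simp add: exp_add[symmetric])
    moreover have "2 ^ k * (\<Lambda> / 2 * x) ^ k = (\<Lambda> * x) ^ k" by (simp add: power_mult_distrib[symmetric])
    moreover have "e * (2 ^ k * (A / fact k * e)) = 2 ^ k * A / fact k * (e * e)" for e A :: real
      by simp
    ultimately show ?thesis unfolding poisson_weight_def by (simp only:)
  qed
  ultimately show ?thesis by simp
qed

lemma test_function_diff:
  assumes "test_function f f'" "test_function g g'"
  shows "test_function (\<lambda>x. a * (f x - g x)) (\<lambda>x. a * (f' x - g' x))"
proof -
  obtain C where C: "\<And>x. 0 \<le> x \<Longrightarrow> \<bar>f x\<bar> \<le> C \<and> \<bar>f' x\<bar> \<le> C \<and> x * \<bar>f' x\<bar> \<le> C"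
    using assms(1) unfolding test_function_def by blast
  obtain B where B: "\<And>x. 0 \<le> x \<Longrightarrow> \<bar>g x\<bar> \<le> B \<and> \<bar>g' x\<bar> \<le> B \<and> x * \<bar>g' x\<bar> \<le> B"
    using assms(2) unfolding test_function_def by blast
  show ?thesis
    unfolding test_function_def
  proof (intro conjI allI exI[of _ "\<bar>a\<bar> * (C + B)"] impI)
    fix x :: real
    show "((\<lambda>x. a * (f x - g x)) has_real_derivative a * (f' x - g' x)) (at x)"
      using assms unfolding test_function_def by (auto intro!: derivative_eq_intros)
    show "isCont (\<lambda>x. a * (f' x - g' x)) x"
      using assms unfolding test_function_def by (intro continuous_intros) auto
    assume x: "0 \<le> x"
    show "\<bar>a * (f x - g x)\<bar> \<le> \<bar>a\<bar> * (C + B)" "\<bar>a * (f' x - g' x)\<bar> \<le> \<bar>a\<bar> * (C + B)"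
      unfolding abs_mult using C[OF x] B[OF x] by (intro mult_left_mono; linarith)+
    have "x * \<bar>f' x - g' x\<bar> \<le> x * (\<bar>f' x\<bar> + \<bar>g' x\<bar>)" using x by (intro mult_left_mono) auto
    also have "\<dots> \<le> C + B" using C[OF x] B[OF x] by (simp add: distrib_left)
    finally have "\<bar>a\<bar> * (x * \<bar>f' x - g' x\<bar>) \<le> \<bar>a\<bar> * (C + B)" by (intro mult_left_mono) auto
    then show "x * \<bar>a * (f' x - g' x)\<bar> \<le> \<bar>a\<bar> * (C + B)" by (simp add: abs_mult mult.left_commute)
  next
    show "set_integrable lborel {0<..} (\<lambda>x. a * (f' x - g' x))"
      using assms unfolding test_function_def by (intro set_integrable_mult_right set_integral_diff) auto
  qed
qed

lemma test_function_poisson_weight: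
  assumes "0 < \<Lambda>" shows "test_function (poisson_weight \<Lambda> k) (poisson_weight_deriv \<Lambda> k)"
proof -
  \<comment> \<open>Multiplying a weight by \<open>x\<close> gives a multiple of the next weight.\<close>
  have times: "x * poisson_weight \<Lambda> m x \<le> real (Suc m) / \<Lambda>" if "0 \<le> x" for x m
  proof -
    have "\<Lambda> * (x * poisson_weight \<Lambda> m x) = \<Lambda> * x * ((\<Lambda> * x) ^ m / fact m) * exp (- \<Lambda> * x)"
      unfolding poisson_weight_def by (simp only: mult.assoc)
    also have "\<Lambda> * x * ((\<Lambda> * x) ^ m / fact m) = real (Suc m) * (\<Lambda> * x * (\<Lambda> * x) ^ m) / fact (Suc m)"
      by (simp add: fact_Suc del: of_nat_Suc)
    also have "\<dots> * exp (- \<Lambda> * x) = real (Suc m) * poisson_weight \<Lambda> (Suc m) x"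
      unfolding poisson_weight_def power_Suc by (simp only: times_divide_eq_right[symmetric] mult.assoc)
    finally have "x * poisson_weight \<Lambda> m x = real (Suc m) / \<Lambda> * poisson_weight \<Lambda> (Suc m) x"
      using assms by (simp add: eq_divide_eq mult.commute del: of_nat_Suc)
    also have "\<dots> \<le> real (Suc m) / \<Lambda> * 1"
      using poisson_weight_bounds[OF assms that] assms by (intro mult_left_mono) auto
    finally show ?thesis by simp
  qed
  have prev: "0 \<le> (if k = 0 then 0 else poisson_weight \<Lambda> (k - 1) x)" "(if k = 0 then 0 else poisson_weight \<Lambda> (k - 1) x) \<le> 1"
     "x * (if k = 0 then 0 else poisson_weight \<Lambda> (k - 1) x) \<le> real (Suc k) / \<Lambda>"
    if "0 \<le> x" for x
    using poisson_weight_bounds[OF assms that, of "k - 1"] times[OF that, of "k - 1"] assms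
    by (auto simp: le_divide_eq)
  show ?thesis
    unfolding test_function_def
  proof (intro conjI allI exI[of _ "1 + \<Lambda> + real (Suc k)"] impI)
    fix x :: real
    show "(poisson_weight \<Lambda> k has_real_derivative poisson_weight_deriv \<Lambda> k x) (at x)"
      by (rule has_real_derivative_poisson_weight)
    show "isCont (poisson_weight_deriv \<Lambda> k) x"
      by (rule isCont_poisson_weight_deriv)
    assume x: "0 \<le> x"
    let ?q = "if k = 0 then 0 else poisson_weight \<Lambda> (k - 1) x"
    note b = poisson_weight_bounds[OF assms x, of k]
    show "\<bar>poisson_weight \<Lambda> k x\<bar> \<le> 1 + \<Lambda> + real (Suc k)" using b assms by simp
    have "\<bar>poisson_weight \<Lambda> k x - ?q\<bar> \<le> 1" using b prev(1,2)[OF x] by linarith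
    then have "\<Lambda> * \<bar>poisson_weight \<Lambda> k x - ?q\<bar> \<le> \<Lambda> * 1" using assms by (intro mult_left_mono) auto
    then have d: "\<bar>poisson_weight_deriv \<Lambda> k x\<bar> \<le> \<Lambda>"
      using assms unfolding poisson_weight_deriv_def abs_mult by simp
    then show "\<bar>poisson_weight_deriv \<Lambda> k x\<bar> \<le> 1 + \<Lambda> + real (Suc k)" by simp
    have "0 \<le> x * poisson_weight \<Lambda> k x" "0 \<le> x * ?q" using x b(1) prev(1)[OF x] by (auto intro: mult_nonneg_nonneg)
    then have "\<bar>x * poisson_weight \<Lambda> k x - x * ?q\<bar> \<le> real (Suc k) / \<Lambda>"
      using times[OF x, of k] prev(3)[OF x] by linarith
    then have m1: "\<Lambda> * \<bar>x * poisson_weight \<Lambda> k x - x * ?q\<bar> \<le> \<Lambda> * (real (Suc k) / \<Lambda>)"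
      using assms by (intro mult_left_mono) auto
    have m2: "\<bar>x * poisson_weight \<Lambda> k x - x * ?q\<bar> = x * \<bar>poisson_weight \<Lambda> k x - ?q\<bar>"
      unfolding right_diff_distrib[symmetric] abs_mult using x by simp
    have m3: "x * \<bar>poisson_weight_deriv \<Lambda> k x\<bar> = \<Lambda> * (x * \<bar>poisson_weight \<Lambda> k x - ?q\<bar>)"
      unfolding poisson_weight_deriv_def abs_mult abs_minus abs_of_pos[OF assms] by (rule mult.left_commute)
    have "x * \<bar>poisson_weight_deriv \<Lambda> k x\<bar> \<le> \<Lambda> * (real (Suc k) / \<Lambda>)"
      unfolding m3 m2[symmetric] by (rule m1)
    also have "\<dots> = real (Suc k)" using assms by simp
    finally show "x * \<bar>poisson_weight_deriv \<Lambda> k x\<bar> \<le> 1 + \<Lambda> + real (Suc k)" using assms by simp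
  next
    show "set_integrable lborel {0<..} (poisson_weight_deriv \<Lambda> k)"
    proof -
      have prev_int: "set_integrable lborel {0<..} (\<lambda>x. if k = 0 then 0 else poisson_weight \<Lambda> (k - 1) x)"
      proof (cases "k = 0")
        case True
        then show ?thesis by (simp add: set_integrable_def)
      next
        case False
        then show ?thesis using set_integrable_poisson_weight[OF assms, of "k - 1"] by simp
      qed
      show ?thesis
        unfolding poisson_weight_deriv_def[abs_def]
        by (intro set_integrable_mult_right set_integral_diff(1) set_integrable_poisson_weight assms prev_int)
    qed
  qed
qed

lemma test_function_poisson_weight_deriv:
  assumes "0 < \<Lambda>" shows "\<exists>f''. test_function (poisson_weight_deriv \<Lambda> k) f''"
proof -
  have "test_function (\<lambda>_. 0) (\<lambda>_. 0)"
    unfolding test_function_def set_integrable_def by (intro conjI allI exI[of _ 0] impI) simp_all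
  then have "test_function (\<lambda>x. if k = 0 then 0 else poisson_weight \<Lambda> (k - 1) x)
      (\<lambda>x. if k = 0 then 0 else poisson_weight_deriv \<Lambda> (k - 1) x)"
    using test_function_poisson_weight[OF assms, of "k - 1"] by (cases "k = 0") auto
  then have A: "test_function (\<lambda>x. - \<Lambda> * (poisson_weight \<Lambda> k x - (if k = 0 then 0 else poisson_weight \<Lambda> (k - 1) x)))
      (\<lambda>x. - \<Lambda> * (poisson_weight_deriv \<Lambda> k x - (if k = 0 then 0 else poisson_weight_deriv \<Lambda> (k - 1) x)))"
    by (rule test_function_diff[OF test_function_poisson_weight[OF assms]])
  have eq: "poisson_weight_deriv \<Lambda> k = (\<lambda>x. - \<Lambda> * (poisson_weight \<Lambda> k x - (if k = 0 then 0 else poisson_weight \<Lambda> (k - 1) x)))"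
    by (rule ext) (rule poisson_weight_deriv_def)
  from A have "test_function (poisson_weight_deriv \<Lambda> k)
      (\<lambda>x. - \<Lambda> * (poisson_weight_deriv \<Lambda> k x - (if k = 0 then 0 else poisson_weight_deriv \<Lambda> (k - 1) x)))"
    by (rule subst[OF eq[symmetric]])
  then show ?thesis by (intro exI)
qed

section \<open>Poisson processes at independent times\<close>

text \<open>For \<open>h = 0\<close> the formula is true but does not follow from the law of the increments, which is
  specified for \<open>h > 0\<close>; the discretisation below therefore uses positive times only.\<close>

lemma (in prob_space) poisson_process_marginal:
  assumes P: "poisson_process M \<Lambda> \<N>" and h: "0 < h"
  shows "prob {\<omega> \<in> space M. \<N> h \<omega> = k} = poisson_weight \<Lambda> k h"
proof -
  have \<Lambda>: "0 < \<Lambda>" and meas: "\<N> h \<in> measurable M (count_space UNIV)" "\<N> 0 \<in> measurable M (count_space UNIV)"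
    and zero: "\<And>\<omega>. \<omega> \<in> space M \<Longrightarrow> \<N> 0 \<omega> = 0"
    and law: "distr M (count_space UNIV) (\<lambda>\<omega>. \<N> (0 + h) \<omega> - \<N> 0 \<omega>) = measure_pmf (poisson_pmf (\<Lambda> * h))"
    using P h unfolding poisson_process_def by auto
  have "distr M (count_space UNIV) (\<lambda>\<omega>. \<N> (0 + h) \<omega> - \<N> 0 \<omega>) = distr M (count_space UNIV) (\<N> h)"
    by (rule distr_cong) (simp_all add: zero)
  then have "measure (distr M (count_space UNIV) (\<N> h)) {k} = measure (measure_pmf (poisson_pmf (\<Lambda> * h))) {k}"
    unfolding law by simp
  then have "measure (distr M (count_space UNIV) (\<N> h)) {k} = pmf (poisson_pmf (\<Lambda> * h)) k"
    unfolding measure_pmf_single .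
  moreover have "measure (distr M (count_space UNIV) (\<N> h)) {k} = prob (\<N> h -` {k} \<inter> space M)"
    using meas by (intro measure_distr) auto
  moreover have "\<N> h -` {k} \<inter> space M = {\<omega> \<in> space M. \<N> h \<omega> = k}" by auto
  ultimately show ?thesis using \<Lambda> h by (simp add: poisson_weight_def)
qed

text \<open>The family \<open>X\<close> is only required to be measurable for each index. With countably many indices, \<open>X\<close> at the random
  index \<open>K\<close> is handled by splitting along the values of \<open>K\<close>.\<close>

lemma (in prob_space) prob_at_independent_discrete_time:
  fixes K :: "'a \<Rightarrow> nat" and q :: "nat \<Rightarrow> real"
  assumes K [measurable]: "K \<in> measurable M (count_space UNIV)"
    and N [measurable]: "\<And>m. X m \<in> measurable M (count_space UNIV)"
    and indep: "\<And>m. prob {\<omega> \<in> space M. X m \<omega> = k \<and> K \<omega> = m} = c m * prob {\<omega> \<in> space M. K \<omega> = m}"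
    and c: "\<And>m. 0 \<le> c m" "\<And>m. c m \<le> (1 :: real)"
  shows "prob {\<omega> \<in> space M. X (K \<omega>) \<omega> = k} = expectation (\<lambda>\<omega>. c (K \<omega>))"
proof -
  define A where "A m = {\<omega> \<in> space M. X m \<omega> = k \<and> K \<omega> = m}" for m
  define B where "B m = {\<omega> \<in> space M. K \<omega> = m}" for m
  have A: "A m \<in> sets M" and B: "B m \<in> sets M" for m
    unfolding A_def B_def by measurable
  have disj: "disjoint_family A" "disjoint_family B"
    unfolding A_def B_def disjoint_family_on_def by auto
  have "{\<omega> \<in> space M. X (K \<omega>) \<omega> = k} = (\<Union>m. A m)" by (auto simp: A_def)
  then have "emeasure M {\<omega> \<in> space M. X (K \<omega>) \<omega> = k} = (\<Sum>m. emeasure M (A m))"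
    using A disj by (simp add: suminf_emeasure image_subset_iff)
  also have "\<dots> = (\<Sum>m. ennreal (c m) * emeasure M (B m))"
    using indep c by (simp add: A_def B_def emeasure_eq_measure ennreal_mult)
  also have "\<dots> = (\<Sum>m. \<integral>\<^sup>+\<omega>. ennreal (c m) * indicator (B m) \<omega> \<partial>M)"
    using B by (simp add: nn_integral_cmult_indicator)
  also have "\<dots> = (\<integral>\<^sup>+\<omega>. (\<Sum>m. ennreal (c m) * indicator (B m) \<omega>) \<partial>M)"
    using B by (intro nn_integral_suminf[symmetric]) auto
  also have "\<dots> = (\<integral>\<^sup>+\<omega>. ennreal (c (K \<omega>)) \<partial>M)"
    by (intro nn_integral_cong suminf_cmult_indicator disj(2)) (simp add: B_def)
  also have "\<dots> = ennreal (expectation (\<lambda>\<omega>. c (K \<omega>)))"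
  proof (rule nn_integral_eq_integral)
    have "(\<lambda>\<omega>. c (K \<omega>)) \<in> borel_measurable M" by measurable
    then show "integrable M (\<lambda>\<omega>. c (K \<omega>))" using c by (intro integrable_const_bound[of _ 1]) auto
  qed (use c in auto)
  finally show ?thesis
    using c by (simp add: emeasure_eq_measure integral_nonneg)
qed

text \<open>Independence concerns the product \<open>\<sigma>\<close>-algebra on paths, for which evaluation of a path at a random
  time is not measurable, so Fubini's theorem does not apply to the joint law directly. Instead the random time is approximated from above by the times
  \<open>(\<lfloor>(n + 1) * L t\<rfloor> + 1) / (n + 1)\<close>, which take countably many values. They are strictly larger than
  \<open>L t\<close>, so right-continuity of the paths applies, and strictly positive.\<close>

lemma (in prob_space) poisson_process_at_independent_time:
  assumes P: "poisson_process M \<Lambda> \<N>"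
    and indep: "indep_var (PiM {0..} (\<lambda>_. borel)) (\<lambda>\<omega>. \<lambda>s\<in>{0..}. real (\<N> s \<omega>))
                  (PiM {0..} (\<lambda>_. borel)) (\<lambda>\<omega>. \<lambda>s\<in>{0..}. L s \<omega>)"
    and t: "0 \<le> t" and L_nonneg: "\<And>\<omega>. 0 \<le> L t \<omega>"
  shows "L t \<in> borel_measurable M"
    and "prob {\<omega> \<in> space M. \<N> (L t \<omega>) \<omega> = k} = expectation (\<lambda>\<omega>. poisson_weight \<Lambda> k (L t \<omega>))"
proof -
  define T where "T = L t"
  have T_nonneg: "0 \<le> T \<omega>" for \<omega> unfolding T_def by (rule L_nonneg)
  have proj: "(\<lambda>f. f s) \<in> measurable (PiM {0..} (\<lambda>_. borel)) (borel :: real measure)" if "0 \<le> s" for s :: real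
    using that by (intro measurable_component_singleton) simp
  have indep_T: "indep_var borel (\<lambda>\<omega>. real (\<N> s \<omega>)) borel T" if "0 \<le> s" for s
    using indep_var_compose[OF indep proj[OF that] proj[OF t]] that t by (simp add: comp_def T_def)
  have T [measurable]: "T \<in> borel_measurable M"
    by (rule indep_var_rv2[OF indep_T[OF order_refl]])
  then show "L t \<in> borel_measurable M" by (simp add: T_def)
  have \<Lambda>: "0 < \<Lambda>" and N_meas: "\<And>t. 0 \<le> t \<Longrightarrow> \<N> t \<in> measurable M (count_space UNIV)"
    and cont: "\<And>\<omega> t. \<omega> \<in> space M \<Longrightarrow> 0 \<le> t \<Longrightarrow> continuous (at_right t) (\<lambda>s. \<N> s \<omega>)"
    using P unfolding poisson_process_def by auto
  have [measurable]: "poisson_weight \<Lambda> k \<in> borel_measurable borel"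
    by (intro borel_measurable_continuous_onI continuous_at_imp_continuous_on ballI isCont_poisson_weight)
  define K where "K n \<omega> = nat \<lfloor>real (Suc n) * T \<omega>\<rfloor>" for n \<omega>
  define q where "q n m = (real m + 1) / real (Suc n)" for n m :: nat
  have q_pos: "0 < q n m" for n m unfolding q_def by (intro divide_pos_pos) auto
  have K_meas [measurable]: "K n \<in> measurable M (count_space UNIV)" for n
    unfolding K_def by measurable
  have N_q [measurable]: "\<N> (q n m) \<in> measurable M (count_space UNIV)" for n m
    using q_pos[of n m] by (intro N_meas) simp
  have grid: "prob {\<omega> \<in> space M. \<N> (q n (K n \<omega>)) \<omega> = k} = expectation (\<lambda>\<omega>. poisson_weight \<Lambda> k (q n (K n \<omega>)))" for n
  proof (rule prob_at_independent_discrete_time[where X="\<lambda>m. \<N> (q n m)" and c="\<lambda>m. poisson_weight \<Lambda> k (q n m)"])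
    fix m
    define B where "B = {x :: real. nat \<lfloor>real (Suc n) * x\<rfloor> = m}"
    have B: "B \<in> sets borel" unfolding B_def by measurable
    have "indep_var borel (\<lambda>\<omega>. real (\<N> (q n m) \<omega>)) borel T"
      by (intro indep_T less_imp_le q_pos)
    from indep_varD[OF this, of "{real k}" B] B
    have "prob ((\<lambda>\<omega>. (real (\<N> (q n m) \<omega>), T \<omega>)) -` ({real k} \<times> B) \<inter> space M)
      = prob ((\<lambda>\<omega>. real (\<N> (q n m) \<omega>)) -` {real k} \<inter> space M) * prob (T -` B \<inter> space M)" by simp
    moreover have "(\<lambda>\<omega>. (real (\<N> (q n m) \<omega>), T \<omega>)) -` ({real k} \<times> B) \<inter> space M
        = {\<omega> \<in> space M. \<N> (q n m) \<omega> = k \<and> K n \<omega> = m}"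
      by (auto simp: B_def K_def)
    moreover have "(\<lambda>\<omega>. real (\<N> (q n m) \<omega>)) -` {real k} \<inter> space M = {\<omega> \<in> space M. \<N> (q n m) \<omega> = k}" by auto
    moreover have "T -` B \<inter> space M = {\<omega> \<in> space M. K n \<omega> = m}" by (auto simp: B_def K_def)
    ultimately show "prob {\<omega> \<in> space M. \<N> (q n m) \<omega> = k \<and> K n \<omega> = m}
        = poisson_weight \<Lambda> k (q n m) * prob {\<omega> \<in> space M. K n \<omega> = m}"
      using poisson_process_marginal[OF P q_pos[of n m], of k] by simp
    show "0 \<le> poisson_weight \<Lambda> k (q n m)" "poisson_weight \<Lambda> k (q n m) \<le> 1"
      using poisson_weight_bounds[OF \<Lambda> less_imp_le[OF q_pos]] by auto
  qed (rule K_meas N_q)+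
  have above: "T \<omega> < q n (K n \<omega>)" "q n (K n \<omega>) \<le> T \<omega> + 1 / real (Suc n)" for n \<omega>
  proof -
    have r: "real (K n \<omega>) = of_int \<lfloor>real (Suc n) * T \<omega>\<rfloor>"
      unfolding K_def using T_nonneg[of \<omega>] by (simp add: of_nat_nat del: of_nat_Suc)
    have "real (Suc n) * T \<omega> < real (K n \<omega>) + 1" unfolding r by linarith
    then show "T \<omega> < q n (K n \<omega>)"
      unfolding q_def by (simp add: less_divide_eq mult.commute del: of_nat_Suc)
    have "real (K n \<omega>) + 1 \<le> real (Suc n) * T \<omega> + 1" unfolding r by linarith
    then have "q n (K n \<omega>) \<le> (real (Suc n) * T \<omega> + 1) / real (Suc n)"
      unfolding q_def by (intro divide_right_mono) auto
    also have "\<dots> = T \<omega> + 1 / real (Suc n)" by (simp add: add_divide_distrib del: of_nat_Suc)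
    finally show "q n (K n \<omega>) \<le> T \<omega> + 1 / real (Suc n)" .
  qed
  have lim: "(\<lambda>n. q n (K n \<omega>)) \<longlonglongrightarrow> T \<omega>" for \<omega>
  proof (rule tendsto_sandwich[of "\<lambda>_. T \<omega>" _ _ "\<lambda>n. T \<omega> + 1 / real (Suc n)"])
    have "(\<lambda>n. T \<omega> + 1 / real (Suc n)) \<longlonglongrightarrow> T \<omega> + 0"
      by (intro tendsto_add tendsto_const LIMSEQ_Suc[OF lim_1_over_n])
    then show "(\<lambda>n. T \<omega> + 1 / real (Suc n)) \<longlonglongrightarrow> T \<omega>" by simp
  qed (use above in \<open>auto intro: less_imp_le always_eventually\<close>)
  have lim_right: "filterlim (\<lambda>n. q n (K n \<omega>)) (at_right (T \<omega>)) sequentially" for \<omega>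
    unfolding filterlim_at using lim[of \<omega>] above(1)[of \<omega>] by (simp add: less_imp_neq[symmetric])
  have evN: "eventually (\<lambda>n. \<N> (q n (K n \<omega>)) \<omega> = \<N> (T \<omega>) \<omega>) sequentially" if "\<omega> \<in> space M" for \<omega>
  proof -
    have "((\<lambda>s. \<N> s \<omega>) \<longlongrightarrow> \<N> (T \<omega>) \<omega>) (at_right (T \<omega>))"
      using cont[OF that T_nonneg] by (simp add: continuous_within)
    from filterlim_compose[OF this lim_right]
    have "(\<lambda>n. \<N> (q n (K n \<omega>)) \<omega>) \<longlonglongrightarrow> \<N> (T \<omega>) \<omega>" .
    then show ?thesis by (simp add: tendsto_discrete)
  qed
  have sets_n: "{\<omega> \<in> space M. \<N> (q n (K n \<omega>)) \<omega> = k} \<in> sets M" for n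
  proof -
    have "(\<lambda>\<omega>. \<N> (q n (K n \<omega>)) \<omega>) \<in> measurable M (count_space UNIV)"
      by (rule measurable_compose_countable[OF N_q K_meas])
    then show ?thesis by measurable
  qed
  define E where "E n = (indicator {\<omega> \<in> space M. \<N> (q n (K n \<omega>)) \<omega> = k} :: 'a \<Rightarrow> real)" for n
  define E' where "E' = (indicator {\<omega> \<in> space M. \<N> (T \<omega>) \<omega> = k} :: 'a \<Rightarrow> real)"
  have E_lim: "(\<lambda>n. E n \<omega>) \<longlonglongrightarrow> E' \<omega>" if "\<omega> \<in> space M" for \<omega>
    by (rule tendsto_eventually) (use evN[OF that] in eventually_elim, simp add: E_def E'_def indicator_def)
  have E_meas: "E n \<in> borel_measurable M" for n
    unfolding E_def using sets_n by simp
  have E'_meas: "E' \<in> borel_measurable M"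
    by (rule borel_measurable_LIMSEQ_real[OF E_lim E_meas])
  have E_le: "\<bar>E n \<omega>\<bar> \<le> 1" for n \<omega> by (simp add: E_def indicator_def)
  have "(\<lambda>n. expectation (E n)) \<longlonglongrightarrow> expectation E'"
    by (rule integral_dominated_convergence[where w="\<lambda>_. 1"])
       (auto simp: E_meas E'_meas E_lim E_le)
  moreover have "expectation (E n) = prob {\<omega> \<in> space M. \<N> (q n (K n \<omega>)) \<omega> = k}" for n
    unfolding E_def using sets_n by (simp add: Int_absorb1 Collect_conj_eq)
  moreover have "expectation E' = prob {\<omega> \<in> space M. \<N> (T \<omega>) \<omega> = k}"
    unfolding E'_def by (simp add: Int_absorb2 subset_eq)
  moreover have "(\<lambda>n. expectation (\<lambda>\<omega>. poisson_weight \<Lambda> k (q n (K n \<omega>)))) \<longlonglongrightarrow> expectation (\<lambda>\<omega>. poisson_weight \<Lambda> k (T \<omega>))"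
  proof (rule integral_dominated_convergence[where w="\<lambda>_. 1"])
    show "AE \<omega> in M. (\<lambda>n. poisson_weight \<Lambda> k (q n (K n \<omega>))) \<longlonglongrightarrow> poisson_weight \<Lambda> k (T \<omega>)"
      by (intro AE_I2 isCont_tendsto_compose[OF isCont_poisson_weight] lim)
    show "(\<lambda>\<omega>. poisson_weight \<Lambda> k (q n (K n \<omega>))) \<in> borel_measurable M" for n
      by measurable
    show "AE \<omega> in M. norm (poisson_weight \<Lambda> k (q n (K n \<omega>))) \<le> 1" for n
      using poisson_weight_bounds[OF \<Lambda> less_imp_le[OF q_pos]] by (intro AE_I2) simp
  qed simp_all
  ultimately have "prob {\<omega> \<in> space M. \<N> (T \<omega>) \<omega> = k} = expectation (\<lambda>\<omega>. poisson_weight \<Lambda> k (T \<omega>))"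
    using grid by (simp add: LIMSEQ_unique)
  then show "prob {\<omega> \<in> space M. \<N> (L t \<omega>) \<omega> = k} = expectation (\<lambda>\<omega>. poisson_weight \<Lambda> k (L t \<omega>))"
    by (simp add: T_def)
qed

section \<open>Independent stable subordinators\<close>

lemma (in prob_space) stable_subordinator_nonneg:
  assumes "stable_subordinator M \<beta> H" "0 \<le> t"
  shows "AE \<omega> in M. 0 \<le> H t \<omega>"
proof -
  have "AE \<omega> in M. mono_on {0..} (\<lambda>t. H t \<omega>)" "AE \<omega> in M. H 0 \<omega> = 0"
    using assms unfolding stable_subordinator_def levy_process_def by auto
  then show ?thesis
  proof eventually_elim
    case (elim \<omega>)
    have "H 0 \<omega> \<le> H t \<omega>" using elim(1) assms(2) by (auto dest: mono_onD)
    with elim(2) show ?case by simp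
  qed
qed

lemma stable_subordinator_measurable:
  "stable_subordinator M \<beta> H \<Longrightarrow> 0 \<le> t \<Longrightarrow> H t \<in> borel_measurable M"
  unfolding stable_subordinator_def levy_process_def by blast

text \<open>\<open>P (H t \<le> 0)\<close> is at most \<open>E (exp (- s * H t)) = exp (- t * s powr \<beta>)\<close> for every \<open>s > 0\<close>.\<close>

lemma (in prob_space) stable_subordinator_pos:
  assumes H: "stable_subordinator M \<beta> H" and t: "0 < t"
  shows "AE \<omega> in M. 0 < H t \<omega>"
proof -
  have [measurable]: "H t \<in> borel_measurable M" using stable_subordinator_measurable[OF H] t by simp
  have \<beta>: "0 < \<beta>" and lap: "\<And>s. 0 < s \<Longrightarrow> expectation (\<lambda>\<omega>. exp (- s * H t \<omega>)) = exp (- t * s powr \<beta>)"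
    using H t unfolding stable_subordinator_def by auto
  define A where "A = {\<omega> \<in> space M. H t \<omega> \<le> 0}"
  have A: "A \<in> sets M" unfolding A_def by measurable
  have "prob A \<le> exp (- real (Suc n))" for n
  proof -
    \<comment> \<open>solves \<open>t * s powr \<beta> = n + 1\<close>\<close>
    define s where "s = (real (Suc n) / t) powr (1 / \<beta>)"
    have s: "0 < s" unfolding s_def using t by simp
    have "t * s powr \<beta> = real (Suc n)" using t \<beta> by (simp add: s_def powr_powr del: of_nat_Suc)
    then have e: "expectation (\<lambda>\<omega>. exp (- s * H t \<omega>)) = exp (- real (Suc n))"
      using lap[OF s] by simp
    have "prob A = expectation (indicator A)" using A by simp
    also have "\<dots> \<le> expectation (\<lambda>\<omega>. exp (- s * H t \<omega>))"
    proof (rule integral_mono)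
      have "AE \<omega> in M. norm (exp (- s * H t \<omega>)) \<le> 1"
        using stable_subordinator_nonneg[OF H less_imp_le[OF t]] by eventually_elim (use s in simp)
      then show "integrable M (\<lambda>\<omega>. exp (- s * H t \<omega>))" by (rule integrable_const_bound) measurable
      show "indicator A \<omega> \<le> exp (- s * H t \<omega>)" for \<omega>
        using s by (simp add: A_def indicator_def mult_nonneg_nonpos)
    qed (use A in \<open>simp add: emeasure_eq_measure\<close>)
    finally show ?thesis using e by simp
  qed
  moreover have "(\<lambda>n. exp (- real (Suc n))) \<longlonglongrightarrow> 0"
    by (intro filterlim_compose[OF exp_at_bot] LIMSEQ_Suc filterlim_compose[OF filterlim_uminus_at_bot_at_top filterlim_real_sequentially])
  ultimately have "prob A \<le> 0" by (intro LIMSEQ_le_const) auto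
  then have "prob A = 0" using measure_nonneg[of M A] by linarith
  then have "AE \<omega> in M. \<omega> \<notin> A" using A by (simp add: prob_eq_0)
  with AE_space show ?thesis by eventually_elim (auto simp: A_def)
qed

lemma (in prob_space) laplace_independent_subordinators:
  fixes J :: "'j set" and H :: "'j \<Rightarrow> real \<Rightarrow> 'a \<Rightarrow> real"
  assumes J: "finite J"
    and H: "\<And>j. j \<in> J \<Longrightarrow> stable_subordinator M (\<nu> j) (H j)"
    and indep: "indep_vars (\<lambda>_. PiM {0..} (\<lambda>_. borel)) (\<lambda>j \<omega>. \<lambda>t\<in>{0..}. H j t \<omega>) J"
    and \<tau>: "0 \<le> \<tau>" and b: "\<And>j. j \<in> J \<Longrightarrow> 0 \<le> b j"
  shows "expectation (\<lambda>\<omega>. exp (- (\<Sum>j\<in>J. b j * H j \<tau> \<omega>))) = exp (- \<tau> * (\<Sum>j\<in>J. b j powr \<nu> j))"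
proof -
  have meas: "(\<lambda>f. exp (- b j * f \<tau>)) \<in> measurable (PiM {0..} (\<lambda>_. borel)) (borel :: real measure)" for j
  proof -
    have [measurable]: "(\<lambda>f. f \<tau>) \<in> measurable (PiM {0..} (\<lambda>_. borel)) (borel :: real measure)"
      using \<tau> by (intro measurable_component_singleton) simp
    show ?thesis by measurable
  qed
  have "indep_vars (\<lambda>_. borel) (\<lambda>j \<omega>. exp (- b j * (\<lambda>t\<in>{0..}. H j t \<omega>) \<tau>)) J"
    by (rule indep_vars_compose2[OF indep meas])
  then have ind: "indep_vars (\<lambda>_. borel) (\<lambda>j \<omega>. exp (- b j * H j \<tau> \<omega>)) J"
    using \<tau> by simp
  have int: "integrable M (\<lambda>\<omega>. exp (- b j * H j \<tau> \<omega>))" if j: "j \<in> J" for j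
  proof -
    have [measurable]: "H j \<tau> \<in> borel_measurable M" by (rule stable_subordinator_measurable[OF H[OF j] \<tau>])
    have "AE \<omega> in M. norm (exp (- b j * H j \<tau> \<omega>)) \<le> 1"
      using stable_subordinator_nonneg[OF H[OF j] \<tau>] by eventually_elim (use b[OF j] in simp)
    then show ?thesis by (rule integrable_const_bound) measurable
  qed
  have one: "expectation (\<lambda>\<omega>. exp (- b j * H j \<tau> \<omega>)) = exp (- \<tau> * b j powr \<nu> j)" if j: "j \<in> J" for j
  proof (cases "b j = 0")
    case True
    then show ?thesis by (simp add: prob_space)
  next
    case False
    with b[OF j] have "0 < b j" by simp
    then show ?thesis using H[OF j] \<tau> unfolding stable_subordinator_def by blast
  qed
  have "expectation (\<lambda>\<omega>. exp (- (\<Sum>j\<in>J. b j * H j \<tau> \<omega>))) = expectation (\<lambda>\<omega>. \<Prod>j\<in>J. exp (- b j * H j \<tau> \<omega>))"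
    using J by (simp add: exp_sum[symmetric] sum_negf)
  also have "\<dots> = (\<Prod>j\<in>J. expectation (\<lambda>\<omega>. exp (- b j * H j \<tau> \<omega>)))"
    by (rule indep_vars_lebesgue_integral[OF J ind int])
  also have "\<dots> = (\<Prod>j\<in>J. exp (- \<tau> * b j powr \<nu> j))"
    by (rule prod.cong[OF refl one])
  also have "\<dots> = exp (- \<tau> * (\<Sum>j\<in>J. b j powr \<nu> j))"
    using J by (simp add: exp_sum[symmetric] sum_distrib_left sum_negf)
  finally show ?thesis .
qed

locale independent_subordinators = prob_space M for M :: "'a measure" +
  fixes N :: nat and \<mu> \<nu> :: "nat \<Rightarrow> real" and H :: "nat \<Rightarrow> real \<Rightarrow> 'a \<Rightarrow> real"
  assumes N_pos: "1 \<le> N"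
    and weight_pos: "\<And>j. j \<in> {1..N} \<Longrightarrow> 0 < \<mu> j"
    and orders: "\<And>j. j \<in> {1..N} \<Longrightarrow> 0 < \<nu> j \<and> \<nu> j < 1"
    and subordinator: "\<And>j. j \<in> {1..N} \<Longrightarrow> stable_subordinator M (\<nu> j) (H j)"
    and independent: "indep_vars (\<lambda>_. PiM {0..} (\<lambda>_. borel)) (\<lambda>j \<omega>. \<lambda>t\<in>{0..}. H j t \<omega>) {1..N}"
begin

definition X :: "real \<Rightarrow> 'a \<Rightarrow> real" where
  "X s \<omega> = (\<Sum>j=1..N. \<mu> j powr (1 / \<nu> j) * H j s \<omega>)"

text \<open>The value \<open>1\<close> is attained on a null set only; it makes \<open>Y j\<close> positive everywhere.\<close>

definition Y :: "nat \<Rightarrow> 'a \<Rightarrow> real" where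
  "Y j \<omega> = \<mu> j powr (1 / \<nu> j) * (if 0 < H j 1 \<omega> then H j 1 \<omega> else 1)"

lemma H_measurable: "j \<in> {1..N} \<Longrightarrow> 0 \<le> t \<Longrightarrow> H j t \<in> borel_measurable M"
  by (rule stable_subordinator_measurable[OF subordinator])

lemma X_measurable: "0 \<le> s \<Longrightarrow> X s \<in> borel_measurable M"
  unfolding X_def[abs_def] by (intro borel_measurable_sum borel_measurable_times H_measurable) auto

lemma AE_Y: "AE \<omega> in M. \<forall>j\<in>{1..N}. Y j \<omega> = \<mu> j powr (1 / \<nu> j) * H j 1 \<omega>"
proof (rule AE_finite_allI)
  show "AE \<omega> in M. Y j \<omega> = \<mu> j powr (1 / \<nu> j) * H j 1 \<omega>" if "j \<in> {1..N}" for j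
    using stable_subordinator_pos[OF subordinator[OF that], of 1] by (auto simp: Y_def)
qed simp

lemma laplace_X:
  assumes "0 \<le> s" "0 < z"
  shows "expectation (\<lambda>\<omega>. exp (- z * X s \<omega>)) = exp (- s * (\<Sum>j=1..N. \<mu> j * z powr \<nu> j))"
proof -
  have "(z * \<mu> j powr (1 / \<nu> j)) powr \<nu> j = \<mu> j * z powr \<nu> j" if "j \<in> {1..N}" for j
    using assms orders[OF that] weight_pos[OF that] by (simp add: powr_mult powr_powr)
  then have eq: "(\<Sum>j=1..N. (z * \<mu> j powr (1 / \<nu> j)) powr \<nu> j) = (\<Sum>j=1..N. \<mu> j * z powr \<nu> j)"
    by (intro sum.cong) auto
  have "expectation (\<lambda>\<omega>. exp (- (\<Sum>j\<in>{1..N}. (z * \<mu> j powr (1 / \<nu> j)) * H j s \<omega>)))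
      = exp (- s * (\<Sum>j\<in>{1..N}. (z * \<mu> j powr (1 / \<nu> j)) powr \<nu> j))"
    by (rule laplace_independent_subordinators[OF _ subordinator independent assms(1)]) (use assms in auto)
  moreover have "- z * X s \<omega> = - (\<Sum>j\<in>{1..N}. (z * \<mu> j powr (1 / \<nu> j)) * H j s \<omega>)" for \<omega>
  proof -
    have "z * X s \<omega> = (\<Sum>j\<in>{1..N}. (z * \<mu> j powr (1 / \<nu> j)) * H j s \<omega>)"
      by (simp only: X_def sum_distrib_left mult.assoc)
    then show ?thesis by (simp only: minus_mult_left[symmetric])
  qed
  ultimately show ?thesis unfolding eq by (simp only:)
qed

text \<open>Self-similarity of stable laws, in terms of Laplace transforms: the coefficients
  \<open>b j = z * x powr (1 / \<nu> j) * \<mu> j powr (1 / \<nu> j)\<close> satisfy \<open>b j powr \<nu> j = x * \<mu> j * z powr \<nu> j\<close>.\<close>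

sublocale stable_mixture M "{1..N}" \<mu> \<nu> Y
proof
  show "finite {1..N}" "{1..N} \<noteq> {}" using N_pos by auto
  show "0 < \<nu> j \<and> \<nu> j < 1" "0 < \<mu> j" if "j \<in> {1..N}" for j using that orders weight_pos by auto
  show Y_pos: "0 < Y j \<omega>" if "j \<in> {1..N}" for j \<omega>
    using weight_pos[OF that] by (simp add: Y_def)
  show Y_meas: "Y j \<in> borel_measurable M" if "j \<in> {1..N}" for j
  proof -
    have [measurable]: "H j 1 \<in> borel_measurable M" using H_measurable[OF that] by simp
    show ?thesis unfolding Y_def[abs_def] by measurable
  qed
  fix x z :: real assume x: "0 \<le> x" and z: "0 < z"
  have power_mixture_Y: "power_mixture {1..N} \<nu> (\<lambda>j. Y j \<omega>)" for \<omega>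
    using N_pos orders Y_pos by unfold_locales auto
  define b where "b j = z * x powr (1 / \<nu> j) * \<mu> j powr (1 / \<nu> j)" for j
  have b: "b j powr \<nu> j = x * (\<mu> j * z powr \<nu> j)" if "j \<in> {1..N}" for j
    using x z orders[OF that] weight_pos[OF that] by (simp add: b_def powr_mult powr_powr)
  have "expectation (\<lambda>\<omega>. exp (- z * power_mixture.mix {1..N} \<nu> (\<lambda>j. Y j \<omega>) x))
      = expectation (\<lambda>\<omega>. exp (- (\<Sum>j\<in>{1..N}. b j * H j 1 \<omega>)))"
  proof (rule integral_cong_AE)
    show "AE \<omega> in M. exp (- z * power_mixture.mix {1..N} \<nu> (\<lambda>j. Y j \<omega>) x) = exp (- (\<Sum>j\<in>{1..N}. b j * H j 1 \<omega>))"
      using AE_Y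
    proof eventually_elim
      case (elim \<omega>)
      have "z * power_mixture.mix {1..N} \<nu> (\<lambda>j. Y j \<omega>) x = (\<Sum>j\<in>{1..N}. b j * H j 1 \<omega>)"
        unfolding power_mixture.mix_def[OF power_mixture_Y] sum_distrib_left
      proof (rule sum.cong[OF refl])
        fix j assume "j \<in> {1..N}"
        then have "Y j \<omega> = \<mu> j powr (1 / \<nu> j) * H j 1 \<omega>" using elim by blast
        then show "z * (x powr (1 / \<nu> j) * Y j \<omega>) = b j * H j 1 \<omega>" by (simp add: b_def)
      qed
      then show ?case by simp
    qed
    show "(\<lambda>\<omega>. exp (- z * power_mixture.mix {1..N} \<nu> (\<lambda>j. Y j \<omega>) x)) \<in> borel_measurable M"
      unfolding power_mixture.mix_def[OF power_mixture_Y]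
      by (rule measurable_compose[OF _ borel_measurable_exp])
         (intro borel_measurable_times borel_measurable_sum borel_measurable_const Y_meas)
    show "(\<lambda>\<omega>. exp (- (\<Sum>j\<in>{1..N}. b j * H j 1 \<omega>))) \<in> borel_measurable M"
      by (rule measurable_compose[OF _ borel_measurable_exp])
         (intro borel_measurable_uminus borel_measurable_times borel_measurable_sum borel_measurable_const H_measurable, auto)
  qed
  also have "\<dots> = exp (- 1 * (\<Sum>j\<in>{1..N}. b j powr \<nu> j))"
    by (rule laplace_independent_subordinators[OF _ subordinator independent]) (use z in \<open>auto simp: b_def\<close>)
  also have "(\<Sum>j\<in>{1..N}. b j powr \<nu> j) = x * (\<Sum>j\<in>{1..N}. \<mu> j * z powr \<nu> j)"
    unfolding sum_distrib_left by (rule sum.cong[OF refl b])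
  finally show "expectation (\<lambda>\<omega>. exp (- z * power_mixture.mix {1..N} \<nu> (\<lambda>j. Y j \<omega>) x))
      = exp (- x * (\<Sum>j\<in>{1..N}. \<mu> j * z powr \<nu> j))"
    by simp
qed

lemma AE_X_nonneg:
  assumes "0 \<le> s" shows "AE \<omega> in M. 0 \<le> X s \<omega>"
proof -
  have "AE \<omega> in M. \<forall>j\<in>{1..N}. 0 \<le> H j s \<omega>"
    by (intro AE_finite_allI stable_subordinator_nonneg[OF subordinator assms]) auto
  then show ?thesis unfolding X_def by eventually_elim (intro sum_nonneg mult_nonneg_nonneg, auto)
qed

text \<open>Both sides have the same Laplace transform. Truncation at \<open>0\<close> makes the variables nonnegative
  everywhere; as \<open>t > 0\<close>, it does not affect the events.\<close>

lemma prob_X_less: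
  assumes "0 \<le> s" "0 < t"
  shows "prob {\<omega> \<in> space M. X s \<omega> < t} = prob {\<omega> \<in> space M. Z s \<omega> < t}"
proof -
  note [measurable] = X_measurable[OF assms(1)]
  have XZ: "(\<integral>\<omega>. 1 * indicator {..<t} (max 0 (X s \<omega>)) \<partial>M) = (\<integral>\<omega>. 1 * indicator {..<t} (max 0 (Z s \<omega>)) \<partial>M :: real)"
  proof (rule weighted_laplace_uniqueness)
    fix n :: nat
    show "(\<integral>\<omega>. 1 * exp (- real n * max 0 (X s \<omega>)) \<partial>M) = (\<integral>\<omega>. 1 * exp (- real n * max 0 (Z s \<omega>)) \<partial>M)"
    proof (cases "n = 0")
      case False
      have "(\<integral>\<omega>. 1 * exp (- real n * max 0 (X s \<omega>)) \<partial>M) = (\<integral>\<omega>. exp (- real n * X s \<omega>) \<partial>M)"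
      proof (rule integral_cong_AE)
        show "AE \<omega> in M. 1 * exp (- real n * max 0 (X s \<omega>)) = exp (- real n * X s \<omega>)"
          using AE_X_nonneg[OF assms(1)] by eventually_elim simp
      qed measurable
      also have "\<dots> = exp (- symbol (real n) * s)"
        using laplace_X[OF assms(1), of "real n"] False unfolding symbol_def by (simp add: mult.commute)
      also have "\<dots> = (\<integral>\<omega>. exp (- real n * Z s \<omega>) \<partial>M)"
        using laplace_Z[OF assms(1), of "real n"] False by simp
      also have "\<dots> = (\<integral>\<omega>. 1 * exp (- real n * max 0 (Z s \<omega>)) \<partial>M)"
        using Z_nonneg[OF assms(1)] by (simp add: max_absorb2)
      finally show ?thesis .
    qed simp
    show "(\<lambda>\<omega>. max 0 (X s \<omega>)) \<in> borel_measurable M" "(\<lambda>\<omega>. max 0 (Z s \<omega>)) \<in> borel_measurable M"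
      by measurable
  qed simp_all
  have prob_eq: "(\<integral>\<omega>. 1 * indicator {..<t} (max 0 (V \<omega>)) \<partial>M :: real) = prob {\<omega> \<in> space M. V \<omega> < t}"
    if [measurable]: "V \<in> borel_measurable M" for V :: "'a \<Rightarrow> real"
  proof -
    have "(\<integral>\<omega>. 1 * indicator {..<t} (max 0 (V \<omega>)) \<partial>M :: real) = (\<integral>\<omega>. indicator {\<omega> \<in> space M. V \<omega> < t} \<omega> \<partial>M :: real)"
      using assms(2) by (intro Bochner_Integration.integral_cong) (auto simp: indicator_def)
    then show ?thesis by (simp add: Int_absorb1 Collect_conj_eq)
  qed
  have "Z s \<in> borel_measurable M" by measurable
  from XZ prob_eq[OF this] prob_eq[OF X_measurable[OF assms(1)]] show ?thesis by (simp only:)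
qed

text \<open>The paths stay below \<open>t\<close> up to time \<open>n\<close> with exponentially small probability.\<close>

lemma AE_X_reaches:
  assumes "0 < t" shows "AE \<omega> in M. \<exists>s>0. t \<le> X s \<omega>"
proof -
  note [measurable] = X_measurable
  define A where "A = {\<omega> \<in> space M. \<forall>n::nat. X (real (Suc n)) \<omega> < t}"
  have A: "A \<in> sets M" unfolding A_def by measurable
  define c where "c = symbol (1 / t)"
  have c: "0 < c" unfolding c_def using assms by (intro symbol_pos) auto
  have le: "prob A \<le> exp 1 * exp (- c * real (Suc n))" for n
  proof -
    have "prob A \<le> prob {\<omega> \<in> space M. X (real (Suc n)) \<omega> < t}"
      by (intro finite_measure_mono) (auto simp: A_def)
    also have "\<dots> = prob {\<omega> \<in> space M. Z (real (Suc n)) \<omega> < t}" by (rule prob_X_less) (use assms in auto)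
    also have "\<dots> \<le> exp 1 * exp (- c * real (Suc n))" unfolding c_def by (rule prob_Z_less_le) (use assms in auto)
    finally show ?thesis .
  qed
  have lim: "(\<lambda>n. exp 1 * exp (- c * real (Suc n))) \<longlonglongrightarrow> exp 1 * 0"
    by (intro tendsto_mult tendsto_const LIMSEQ_Suc filterlim_compose[OF tendsto_exp_neg_at_top[OF c] filterlim_real_sequentially])
  have "prob A \<le> exp 1 * 0" by (rule LIMSEQ_le_const[OF lim]) (use le in blast)
  then have "prob A = 0" using measure_nonneg[of M A] by linarith
  then have "AE \<omega> in M. \<omega> \<notin> A" using A by (simp add: prob_eq_0)
  with AE_space show ?thesis
  proof eventually_elim
    case (elim \<omega>)
    then obtain n :: nat where "t \<le> X (real (Suc n)) \<omega>" by (auto simp: A_def not_less)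
    then show ?case by (intro exI[of _ "real (Suc n)"]) auto
  qed
qed

text \<open>The passage times form an up-set of the half-line by monotonicity. By right-continuity,
  \<open>X x < t\<close> implies that \<open>X\<close> stays below \<open>t\<close> a little beyond \<open>x\<close>, so that the infimum exceeds \<open>x\<close>.\<close>

lemma AE_inverse_process_greater_iff:
  assumes t: "0 < t" and x: "0 < x"
  shows "AE \<omega> in M. x < inverse_process N \<mu> \<nu> H t \<omega> \<longleftrightarrow> X x \<omega> < t"
proof -
  have paths: "AE \<omega> in M. \<forall>j\<in>{1..N}. mono_on {0..} (\<lambda>t. H j t \<omega>) \<and> cadlag_path (\<lambda>t. H j t \<omega>)"
  proof (rule AE_finite_allI)
    fix j assume "j \<in> {1..N}"
    from subordinator[OF this]
    have "AE \<omega> in M. mono_on {0..} (\<lambda>t. H j t \<omega>)" "AE \<omega> in M. cadlag_path (\<lambda>t. H j t \<omega>)"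
      unfolding stable_subordinator_def levy_process_def by auto
    then show "AE \<omega> in M. mono_on {0..} (\<lambda>t. H j t \<omega>) \<and> cadlag_path (\<lambda>t. H j t \<omega>)" by eventually_elim simp
  qed simp
  from paths AE_X_reaches[OF t] show ?thesis
  proof eventually_elim
    case (elim \<omega>)
    have mono: "X s \<omega> \<le> X s' \<omega>" if "0 \<le> s" "s \<le> s'" for s s'
      unfolding X_def
    proof (intro sum_mono mult_left_mono)
      fix j assume "j \<in> {1..N}"
      then have "mono_on {0..} (\<lambda>t. H j t \<omega>)" using elim(1) by blast
      then show "H j s \<omega> \<le> H j s' \<omega>"
        by (rule mono_onD[where f="\<lambda>t. H j t \<omega>"]) (use that in auto)
    qed simp
    have right: "((\<lambda>s. X s \<omega>) \<longlongrightarrow> X x \<omega>) (at_right x)"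
      unfolding X_def
    proof (intro tendsto_sum tendsto_mult tendsto_const)
      fix j assume "j \<in> {1..N}"
      then have "cadlag_path (\<lambda>t. H j t \<omega>)" using elim(1) by blast
      then show "((\<lambda>s. H j s \<omega>) \<longlongrightarrow> H j x \<omega>) (at_right x)"
        using x by (simp add: cadlag_path_def continuous_within)
    qed
    define S where "S = {s. 0 < s \<and> t \<le> X s \<omega>}"
    have S_eq: "passage_times N \<mu> \<nu> H t \<omega> = S" by (simp add: passage_times_def S_def X_def)
    have ne: "S \<noteq> {}" using elim(2) by (auto simp: S_def)
    have bdd: "bdd_below S" by (rule bdd_belowI[of _ 0]) (auto simp: S_def)
    have L: "inverse_process N \<mu> \<nu> H t \<omega> = Inf S"
      using t ne by (simp add: inverse_process_def S_eq)
    show ?case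
      unfolding L
    proof
      assume "x < Inf S"
      then have "x \<notin> S" using cInf_lower[OF _ bdd, of x] by auto
      then show "X x \<omega> < t" using x by (simp add: S_def)
    next
      assume lt: "X x \<omega> < t"
      from order_tendstoD(2)[OF right lt] obtain b where b: "x < b" "\<And>s. x < s \<Longrightarrow> s < b \<Longrightarrow> X s \<omega> < t"
        unfolding eventually_at_right_field by blast
      have "b \<le> Inf S"
      proof (rule cInf_greatest[OF ne])
        fix s assume s: "s \<in> S"
        show "b \<le> s"
        proof (rule ccontr)
          assume "\<not> b \<le> s"
          then have "X s \<omega> < t"
            using b(2)[of s] mono[of s x] lt s by (cases "s \<le> x") (auto simp: S_def)
          then show False using s by (simp add: S_def)
        qed
      qed
      with b(1) show "x < Inf S" by simp
    qed
  qed
qed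

lemma inverse_process_nonneg: "0 \<le> inverse_process N \<mu> \<nu> H t \<omega>"
  unfolding inverse_process_def by (auto intro!: cInf_greatest simp: passage_times_def)

text \<open>The inverse process at time \<open>t\<close> and \<open>R t\<close> have the same tails.\<close>

lemma expectation_inverse_process:
  assumes f: "test_function f f'" and t: "0 < t"
    and meas [measurable]: "inverse_process N \<mu> \<nu> H t \<in> borel_measurable M"
  shows "expectation (\<lambda>\<omega>. f (inverse_process N \<mu> \<nu> H t \<omega>)) = mean f t"
proof -
  note R_meas [measurable] = R_measurable[OF less_imp_le[OF t]]
  have tail: "expectation (\<lambda>\<omega>. f (W \<omega>)) = f 0 + (LINT x:{0<..}|lborel. f' x * prob {\<omega> \<in> space M. x < W \<omega>})"
    if "W \<in> borel_measurable M" "\<And>\<omega>. 0 \<le> W \<omega>" for W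
    using f unfolding test_function_def by (intro expectation_tail_formula that) auto
  have eq: "prob {\<omega> \<in> space M. x < inverse_process N \<mu> \<nu> H t \<omega>} = prob {\<omega> \<in> space M. x < R t \<omega>}"
    if x: "0 < x" for x
  proof -
    note [measurable] = X_measurable[OF less_imp_le[OF x]]
    have "prob {\<omega> \<in> space M. x < inverse_process N \<mu> \<nu> H t \<omega>} = prob {\<omega> \<in> space M. X x \<omega> < t}"
    proof (rule finite_measure_eq_AE)
      show "AE \<omega> in M. (\<omega> \<in> {\<omega> \<in> space M. x < inverse_process N \<mu> \<nu> H t \<omega>}) = (\<omega> \<in> {\<omega> \<in> space M. X x \<omega> < t})"
        using AE_inverse_process_greater_iff[OF t x] by eventually_elim simp
    qed measurable
    also have "\<dots> = prob {\<omega> \<in> space M. Z x \<omega> < t}" using x t by (intro prob_X_less) auto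
    also have "{\<omega> \<in> space M. Z x \<omega> < t} = {\<omega> \<in> space M. x < R t \<omega>}"
      using less_R_iff[of t x] x t by auto
    finally show ?thesis .
  qed
  have "expectation (\<lambda>\<omega>. f (inverse_process N \<mu> \<nu> H t \<omega>))
      = f 0 + (LINT x:{0<..}|lborel. f' x * prob {\<omega> \<in> space M. x < inverse_process N \<mu> \<nu> H t \<omega>})"
    by (rule tail[OF meas inverse_process_nonneg])
  also have "(LINT x:{0<..}|lborel. f' x * prob {\<omega> \<in> space M. x < inverse_process N \<mu> \<nu> H t \<omega>})
      = (LINT x:{0<..}|lborel. f' x * prob {\<omega> \<in> space M. x < R t \<omega>})"
    using eq by (intro set_lebesgue_integral_cong) auto
  also have "f 0 + \<dots> = mean f t"
    unfolding mean_def by (rule tail[OF R_meas, symmetric]) (use R_nonneg t in simp)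
  finally show ?thesis .
qed

end

section \<open>The fractional equation\<close>

text \<open>Values at \<open>0\<close> do not enter the Caputo derivative: only the interior of the interval matters.\<close>

lemma caputo_cong:
  assumes "\<And>s. 0 < s \<Longrightarrow> u s = w s"
  shows "caputo_exists \<beta> u t = caputo_exists \<beta> w t" and "caputo_deriv \<beta> u t = caputo_deriv \<beta> w t"
proof -
  have ev: "eventually (\<lambda>x. u x = w x) (nhds s)" if "0 < s" for s
    using eventually_nhds_in_open[of "{0<..}" s] that assms by (auto elim!: eventually_mono)
  have d: "deriv u s = deriv w s" if "0 < s" for s
    by (rule deriv_cong_ev[OF ev[OF that] refl])
  have "u field_differentiable at s \<longleftrightarrow> w field_differentiable at s" if "0 < s" for s
    unfolding field_differentiable_def using DERIV_cong_ev[OF refl ev[OF that] refl] by auto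
  moreover have "set_integrable lborel {0<..<t} (\<lambda>s. deriv u s / (t - s) powr \<beta>)
      = set_integrable lborel {0<..<t} (\<lambda>s. deriv w s / (t - s) powr \<beta>)"
    using d by (intro set_integrable_cong) auto
  ultimately show "caputo_exists \<beta> u t = caputo_exists \<beta> w t" by (auto simp: caputo_exists_def)
  have "(LINT s:{0<..<t}|lborel. deriv u s / (t - s) powr \<beta>) = (LINT s:{0<..<t}|lborel. deriv w s / (t - s) powr \<beta>)"
    using d by (intro set_lebesgue_integral_cong) auto
  then show "caputo_deriv \<beta> u t = caputo_deriv \<beta> w t" by (simp add: caputo_deriv_def)
qed

context stable_mixture begin

lemma mean_poisson_weight_deriv:
  assumes "0 < \<Lambda>" "0 \<le> t"
  shows "mean (poisson_weight_deriv \<Lambda> k) t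
    = - \<Lambda> * (mean (poisson_weight \<Lambda> k) t - (if k = 0 then 0 else mean (poisson_weight \<Lambda> (k - 1)) t))"
proof -
  note int = integrable_test_function_R[OF test_function_poisson_weight[OF assms(1)] assms(2)]
  show ?thesis
  proof (cases "k = 0")
    case True
    then show ?thesis unfolding mean_def poisson_weight_deriv_def by simp
  next
    case False
    have "mean (poisson_weight_deriv \<Lambda> k) t
      = (\<integral>\<omega>. - \<Lambda> * (poisson_weight \<Lambda> k (R t \<omega>) - poisson_weight \<Lambda> (k - 1) (R t \<omega>)) \<partial>M)"
      unfolding mean_def poisson_weight_deriv_def using False by (simp only: if_False)
    also have "\<dots> = - \<Lambda> * (mean (poisson_weight \<Lambda> k) t - mean (poisson_weight \<Lambda> (k - 1)) t)"
      unfolding mean_def integral_mult_right_zero using int by simp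
    finally show ?thesis using False by (simp only: if_False)
  qed
qed

end

theorem theorem13:
  fixes M :: "'a measure" and N :: nat and \<mu> \<nu> :: "nat \<Rightarrow> real" and \<Lambda> :: real
    and H :: "nat \<Rightarrow> real \<Rightarrow> 'a \<Rightarrow> real" and \<N> :: "real \<Rightarrow> 'a \<Rightarrow> nat"
    and \<L> :: "real \<Rightarrow> 'a \<Rightarrow> real" and p :: "nat \<Rightarrow> real \<Rightarrow> real"
  defines "\<L> \<equiv> inverse_process N \<mu> \<nu> H"
  defines "p \<equiv> state_prob M \<N> \<L>"
  assumes "prob_space M" and "N \<ge> 1"
    and "\<And>j. j \<in> {1..N} \<Longrightarrow> 0 < \<mu> j"
    and "\<And>j. j \<in> {1..N} \<Longrightarrow> 0 < \<nu> j \<and> \<nu> j < 1"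
    and "\<Lambda> > 0"
    and "\<And>j. j \<in> {1..N} \<Longrightarrow> stable_subordinator M (\<nu> j) (H j)"
    and "prob_space.indep_vars M (\<lambda>_. PiM {0..} (\<lambda>_. borel))
           (\<lambda>j \<omega>. \<lambda>t\<in>{0..}. H j t \<omega>) {1..N}"
    and "poisson_process M \<Lambda> \<N>"
    and "prob_space.indep_var M
           (PiM {0..} (\<lambda>_. borel)) (\<lambda>\<omega>. \<lambda>t\<in>{0..}. real (\<N> t \<omega>))
           (PiM {0..} (\<lambda>_. borel)) (\<lambda>\<omega>. \<lambda>t\<in>{0..}. \<L> t \<omega>)"
  shows "(\<forall>k. \<forall>t>0.
            (\<forall>j\<in>{1..N}. caputo_exists (\<nu> j) (p k) t) \<and>
            (\<Sum>j=1..N. \<mu> j * caputo_deriv (\<nu> j) (p k) t)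
              = - \<Lambda> * (p k t - (if k = 0 then 0 else p (k - 1) t)))
         \<and> p 0 0 = 1 \<and> (\<forall>k\<ge>1. p k 0 = 0)"
proof -
  interpret independent_subordinators M N \<mu> \<nu> H
    by (intro independent_subordinators.intro independent_subordinators_axioms.intro assms)
  have indep: "indep_var (PiM {0..} (\<lambda>_. borel)) (\<lambda>\<omega>. \<lambda>t\<in>{0..}. real (\<N> t \<omega>))
      (PiM {0..} (\<lambda>_. borel)) (\<lambda>\<omega>. \<lambda>t\<in>{0..}. \<L> t \<omega>)" by fact
  have nonneg: "0 \<le> \<L> t \<omega>" for t \<omega> unfolding \<L>_def by (rule inverse_process_nonneg)
  note test = test_function_poisson_weight[OF \<open>0 < \<Lambda>\<close>]
  have p_eq: "p k t = mean (poisson_weight \<Lambda> k) t" if t: "0 < t" for k t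
  proof -
    note sub = poisson_process_at_independent_time[OF \<open>poisson_process M \<Lambda> \<N>\<close> indep less_imp_le[OF t] nonneg]
    have "p k t = expectation (\<lambda>\<omega>. poisson_weight \<Lambda> k (\<L> t \<omega>))"
      unfolding p_def state_prob_def by (rule sub(2))
    also have "\<dots> = mean (poisson_weight \<Lambda> k) t"
      unfolding \<L>_def by (rule expectation_inverse_process[OF test t sub(1)[unfolded \<L>_def]])
    finally show ?thesis .
  qed
  have "caputo_exists (\<nu> j) (p k) t" if "0 < t" "j \<in> {1..N}" for j k t
    using caputo_exists_mean[OF test _ that(1), of "\<nu> j" k] assms(6)[OF that(2)]
      caputo_cong(1)[of "p k" "mean (poisson_weight \<Lambda> k)" "\<nu> j" t] p_eq by simp
  moreover have "(\<Sum>j=1..N. \<mu> j * caputo_deriv (\<nu> j) (p k) t)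
      = - \<Lambda> * (p k t - (if k = 0 then 0 else p (k - 1) t))" if t: "0 < t" for k t
  proof -
    obtain f'' where f'': "test_function (poisson_weight_deriv \<Lambda> k) f''"
      using test_function_poisson_weight_deriv[OF \<open>0 < \<Lambda>\<close>] by blast
    have "(\<Sum>j=1..N. \<mu> j * caputo_deriv (\<nu> j) (p k) t)
        = (\<Sum>j=1..N. \<mu> j * caputo_deriv (\<nu> j) (mean (poisson_weight \<Lambda> k)) t)"
      using caputo_cong(2)[of "p k" "mean (poisson_weight \<Lambda> k)"] p_eq by simp
    also have "\<dots> = mean (poisson_weight_deriv \<Lambda> k) t" by (rule caputo_mean[OF test f'' t])
    also have "\<dots> = - \<Lambda> * (p k t - (if k = 0 then 0 else p (k - 1) t))"
      using mean_poisson_weight_deriv[OF \<open>0 < \<Lambda>\<close>, of t k] t by (simp add: p_eq)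
    finally show ?thesis .
  qed
  moreover have start: "p k 0 = prob {\<omega> \<in> space M. 0 = k}" for k
  proof -
    have "\<N> (\<L> 0 \<omega>) \<omega> = 0" if "\<omega> \<in> space M" for \<omega>
      using \<open>poisson_process M \<Lambda> \<N>\<close> that by (simp add: \<L>_def inverse_process_def poisson_process_def)
    then have "{\<omega> \<in> space M. \<N> (\<L> 0 \<omega>) \<omega> = k} = {\<omega> \<in> space M. 0 = k}" by auto
    then show ?thesis by (simp add: p_def state_prob_def)
  qed
  moreover have "p 0 0 = 1" by (simp add: start prob_space)
  moreover have "p k 0 = 0" if "1 \<le> k" for k using that by (simp add: start)
  ultimately show ?thesis by blast
qed

end
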